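(* Let $\Omega\subset\mathbb{R}^N$ be a bounded open set, let $0<\alpha<2$, and let $f\in L^{\frac{N}{\alpha},1}(\Omega)$. Let $u$ be the (weak) solution of $$(-\Delta)^{\alpha/2}u=f \ \text{ in }\Omega,\qquad u=0\ \text{ on }\partial\Omega.$$ Then $u\in L^{\infty}(\Omega)$.
   Context: Lorentz spaces. $|\cdot|$ denotes $N$-dimensional Lebesgue measure. For a real measurable function $g$ on a bounded open set $\Omega\subset\mathbb{R}^N$, let $\mu_g(t)=|\{x\in\Omega:|g(x)|>t\}|$, $t\ge0$, and $g^{*}(s)=\sup\{t\ge0:\mu_g(t)>s\}$ for $s\in(0,|\Omega|)$ (extended by $0$ for $s\ge|\Omega|$). For $0<p\le\infty$, $0<q<\infty$, $g\in L^{p,q}(\Omega)$ means $\|g\|_{L^{p,q}(\Omega)}=\big(\int_0^{+\infty}[t^{1/p}g^{*}(t)]^q\frac{dt}{t}\big)^{1/q}<\infty$; for $q=\infty$ it means $\sup_{t>0}t^{1/p}g^{*}(t)<\infty$. Function space. Put $\mathcal{C}_\Omega=\Omega\times(0,+\infty)$ (points written $(x,y)$) and $\partial_L\mathcal{C}_\Omega=\partial\Omega\times[0,+\infty)$. Define $$X_0^{\alpha}(\mathcal{C}_\Omega)=\Big\{w\in H^1(\mathcal{C}_\Omega):\ w=0\text{ on }\partial_L\mathcal{C}_\Omega,\ \int_{\mathcal{C}_\Omega}y^{1-\alpha}|\nabla w|^2\,dx\,dy<\infty\Big\},$$ with norm $\big(\int_{\mathcal{C}_\Omega}y^{1-\alpha}|\nabla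 w|^2\,dx\,dy\big)^{1/2}$; the trace of $w$ on $\Omega$ is $tr_\Omega w=w(\cdot,0)$. Constant. $\kappa_\alpha=\dfrac{2^{1-\alpha}\Gamma(1-\frac{\alpha}{2})}{\Gamma(\frac{\alpha}{2})}$. Weak solutions. For $f\in L^{\frac{2N}{N+\alpha}}(\Omega)$, the weak solution of $(-\Delta)^{\alpha/2}u=f$ in $\Omega$, $u=0$ on $\partial\Omega$, is $u=tr_\Omega w$, where $w\in X_0^\alpha(\mathcal{C}_\Omega)$ is the weak solution of $$-\operatorname{div}(y^{1-\alpha}\nabla w)=0\text{ in }\mathcal{C}_\Omega,\quad w=0\text{ on }\partial_L\mathcal{C}_\Omega,\quad -\tfrac{1}{\kappa_\alpha}\lim_{y\to0^+}y^{1-\alpha}\tfrac{\partial w}{\partial y}=f\text{ in }\Omega,$$ meaning that for every $\varphi\in X_0^\alpha(\mathcal{C}_\Omega)$ $$\int_{\mathcal{C}_\Omega}y^{1-\alpha}\nabla w\cdot\nabla\varphi\,dx\,dy=\kappa_\alpha\int_\Omega f(x)\varphi(x,0)\,dx.$$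
   Formalization: The formal theorem assumes α ≠ N, which excludes only N = 1, α = 1; there the claim fails: on Ω = (-1/2,1/2), f(x) = 1/(|x| log²(1/|x|)) lies in L^{1,1} = L¹ and has a weak solution, which is unbounded (of log log(1/|x|) growth) at 0. *)

theory Defs
  imports "HOL-Analysis.Analysis"
begin

subsection \<open>Lebesgue and Lorentz spaces\<close>

text \<open>Elements are representatives; only their values on \<open>U\<close> matter.
  All exponents \<open>p > 0\<close> are allowed, including \<open>p < 1\<close>.\<close>

definition Lp :: "real \<Rightarrow> 'a::euclidean_space set \<Rightarrow> ('a \<Rightarrow> 'b::euclidean_space) set" where
  "Lp p U = {g \<in> borel_measurable (lebesgue_on U).
               integrable (lebesgue_on U) (\<lambda>x. norm (g x) powr p)}"

definition L_infinity :: "'a::euclidean_space set \<Rightarrow> ('a \<Rightarrow> real) set" where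
  "L_infinity U = {g \<in> borel_measurable (lebesgue_on U).
                     \<exists>C. AE x in lebesgue_on U. \<bar>g x\<bar> \<le> C}"

definition distribution_fun :: "'a::euclidean_space set \<Rightarrow> ('a \<Rightarrow> real) \<Rightarrow> real \<Rightarrow> real" where
  "distribution_fun \<Omega> g t = measure lebesgue {x \<in> \<Omega>. \<bar>g x\<bar> > t}"

text \<open>The supremum is taken in \<open>[0, \<infinity>)\<close>, so it is \<open>0\<close> over the empty set; hence the
  inserted \<open>0\<close>. For \<open>\<Omega>\<close> of finite measure and \<open>s > 0\<close> the set is bounded above.\<close>

definition decreasing_rearrangement ::
    "'a::euclidean_space set \<Rightarrow> ('a \<Rightarrow> real) \<Rightarrow> real \<Rightarrow> real" where
  "decreasing_rearrangement \<Omega> g s =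
     (if 0 < s \<and> s < measure lebesgue \<Omega>
      then Sup (insert 0 {t. t \<ge> 0 \<and> distribution_fun \<Omega> g t > s}) else 0)"

text \<open>Used for finite exponents \<open>p, q > 0\<close>.\<close>

definition Lorentz :: "real \<Rightarrow> real \<Rightarrow> 'a::euclidean_space set \<Rightarrow> ('a \<Rightarrow> real) set" where
  "Lorentz p q \<Omega> = {g \<in> borel_measurable (lebesgue_on \<Omega>).
     (\<integral>\<^sup>+ t \<in> {0<..}. ennreal ((t powr (1 / p) * decreasing_rearrangement \<Omega> g t) powr q / t)
        \<partial>lborel) < \<infinity>}"

subsection \<open>Sobolev space \<open>H\<^sup>1\<close>\<close>

primrec C_k :: "nat \<Rightarrow> ('a::euclidean_space \<Rightarrow> real) \<Rightarrow> bool" where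
  "C_k 0 \<psi> \<longleftrightarrow> continuous_on UNIV \<psi>"
| "C_k (Suc k) \<psi> \<longleftrightarrow> (\<forall>x. \<psi> differentiable (at x)) \<and>
     (\<forall>b\<in>Basis. C_k k (\<lambda>x. frechet_derivative \<psi> (at x) b))"

definition test_functions :: "'a::euclidean_space set \<Rightarrow> ('a \<Rightarrow> real) set" where
  "test_functions U = {\<psi>. (\<forall>k. C_k k \<psi>) \<and>
     (\<exists>K. compact K \<and> K \<subseteq> U \<and> (\<forall>x. x \<notin> K \<longrightarrow> \<psi> x = 0))}"

definition locally_integrable_on ::
    "('a::euclidean_space \<Rightarrow> 'b::euclidean_space) \<Rightarrow> 'a set \<Rightarrow> bool" where
  "locally_integrable_on g U \<longleftrightarrow>
     (\<forall>K. compact K \<longrightarrow> K \<subseteq> U \<longrightarrow> integrable (lebesgue_on K) g)"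

definition has_weak_gradient ::
    "'a::euclidean_space set \<Rightarrow> ('a \<Rightarrow> real) \<Rightarrow> ('a \<Rightarrow> 'a) \<Rightarrow> bool" where
  "has_weak_gradient U w G \<longleftrightarrow> locally_integrable_on w U \<and> locally_integrable_on G U \<and>
     (\<forall>\<psi>\<in>test_functions U. \<forall>b\<in>Basis.
        (LINT x|lebesgue_on U. w x * frechet_derivative \<psi> (at x) b)
          = - (LINT x|lebesgue_on U. (G x \<bullet> b) * \<psi> x))"

text \<open>Determined up to a null subset of \<open>U\<close>.\<close>

definition weak_grad :: "'a::euclidean_space set \<Rightarrow> ('a \<Rightarrow> real) \<Rightarrow> 'a \<Rightarrow> 'a" where
  "weak_grad U w = (SOME G. has_weak_gradient U w G)"

definition H1 :: "'a::euclidean_space set \<Rightarrow> ('a \<Rightarrow> real) set" where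
  "H1 U = {w \<in> Lp 2 U. (\<exists>G. has_weak_gradient U w G) \<and> weak_grad U w \<in> Lp 2 U}"

definition H1_norm :: "'a::euclidean_space set \<Rightarrow> ('a \<Rightarrow> real) \<Rightarrow> real" where
  "H1_norm U w = sqrt ((LINT x|lebesgue_on U. (w x)\<^sup>2)
                     + (LINT x|lebesgue_on U. (norm (weak_grad U w x))\<^sup>2))"

subsection \<open>The half-cylinder and the extension problem\<close>

definition cylinder :: "'a::euclidean_space set \<Rightarrow> ('a \<times> real) set" where
  "cylinder \<Omega> = \<Omega> \<times> {0<..}"

text \<open>No regularity of \<open>\<partial>\<Omega>\<close> is assumed, so \<open>w = 0\<close> on \<open>\<partial>\<Omega> \<times> [0, \<infinity>)\<close> is understood in the usual
  way: \<open>w\<close> is an \<open>H\<^sup>1\<close>-limit of smooth functions vanishing near the lateral boundary. A test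
  function on \<open>\<Omega> \<times> \<real>\<close> need not vanish on \<open>\<Omega> \<times> {0}\<close>. The trace on \<open>\<Omega>\<close> is the continuous
  extension of \<open>\<psi> \<mapsto> \<psi>(\<cdot>, 0)\<close> from such functions to their \<open>H\<^sup>1\<close>-limits, with values in
  \<open>L\<^sup>2(\<Omega>)\<close>; as a function it is only determined almost everywhere, hence the relational form.\<close>

definition vanishes_laterally :: "'a::euclidean_space set \<Rightarrow> ('a \<times> real \<Rightarrow> real) \<Rightarrow> bool" where
  "vanishes_laterally \<Omega> w \<longleftrightarrow>
     (\<exists>\<psi>. (\<forall>k::nat. \<psi> k \<in> test_functions (\<Omega> \<times> UNIV)) \<and>
          (\<lambda>k. H1_norm (cylinder \<Omega>) (\<lambda>z. w z - \<psi> k z)) \<longlonglongrightarrow> 0)"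

definition has_trace ::
    "'a::euclidean_space set \<Rightarrow> ('a \<times> real \<Rightarrow> real) \<Rightarrow> ('a \<Rightarrow> real) \<Rightarrow> bool" where
  "has_trace \<Omega> w u \<longleftrightarrow> w \<in> H1 (cylinder \<Omega>) \<and> u \<in> Lp 2 \<Omega> \<and>
     (\<exists>\<psi>. (\<forall>k::nat. \<psi> k \<in> test_functions (\<Omega> \<times> UNIV)) \<and>
          (\<lambda>k. H1_norm (cylinder \<Omega>) (\<lambda>z. w z - \<psi> k z)) \<longlonglongrightarrow> 0 \<and>
          (\<lambda>k. LINT x|lebesgue_on \<Omega>. (u x - \<psi> k (x, 0))\<^sup>2) \<longlonglongrightarrow> 0)"

definition X0 :: "real \<Rightarrow> 'a::euclidean_space set \<Rightarrow> ('a \<times> real \<Rightarrow> real) set" where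
  "X0 \<alpha> \<Omega> = {w \<in> H1 (cylinder \<Omega>). vanishes_laterally \<Omega> w \<and>
     integrable (lebesgue_on (cylinder \<Omega>))
       (\<lambda>z. snd z powr (1 - \<alpha>) * (norm (weak_grad (cylinder \<Omega>) w z))\<^sup>2)}"

definition kappa :: "real \<Rightarrow> real" where
  "kappa \<alpha> = 2 powr (1 - \<alpha>) * Gamma (1 - \<alpha> / 2) / Gamma (\<alpha> / 2)"

definition weak_extension_solution ::
    "real \<Rightarrow> 'a::euclidean_space set \<Rightarrow> ('a \<Rightarrow> real) \<Rightarrow> ('a \<times> real \<Rightarrow> real) \<Rightarrow> bool" where
  "weak_extension_solution \<alpha> \<Omega> f w \<longleftrightarrow> w \<in> X0 \<alpha> \<Omega> \<and>
     (\<forall>\<phi>\<in>X0 \<alpha> \<Omega>. \<forall>v. has_trace \<Omega> \<phi> v \<longrightarrow>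
        integrable (lebesgue_on \<Omega>) (\<lambda>x. f x * v x) \<and>
        (LINT z|lebesgue_on (cylinder \<Omega>). snd z powr (1 - \<alpha>) *
            (weak_grad (cylinder \<Omega>) w z \<bullet> weak_grad (cylinder \<Omega>) \<phi> z))
          = kappa \<alpha> * (LINT x|lebesgue_on \<Omega>. f x * v x))"

text \<open>\<open>u\<close> is a weak solution of \<open>(-\<Delta>)\<^bsup>\<alpha>/2\<^esup> u = f\<close> in \<open>\<Omega>\<close>, \<open>u = 0\<close> on \<open>\<partial>\<Omega>\<close>; this notion is
  defined for data in \<open>L\<^bsup>2N/(N+\<alpha>)\<^esup>(\<Omega>)\<close>.\<close>

definition weak_solution ::
    "real \<Rightarrow> 'a::euclidean_space set \<Rightarrow> ('a \<Rightarrow> real) \<Rightarrow> ('a \<Rightarrow> real) \<Rightarrow> bool" where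
  "weak_solution \<alpha> \<Omega> f u \<longleftrightarrow>
     f \<in> Lp (2 * real DIM('a) / (real DIM('a) + \<alpha>)) \<Omega> \<and>
     (\<exists>w. weak_extension_solution \<alpha> \<Omega> f w \<and> has_trace \<Omega> w u)"

end

theory Submission
  imports Defs
begin

text \<open>The argument is a truncation method that needs no Sobolev embedding. Test the extension problem
  with \<open>\<gamma> \<circ> w\<close>, where \<open>\<gamma>\<close> is a smooth odd truncation that vanishes on \<open>[-k, k]\<close>, is bounded by \<open>h\<close>, and
  has size comparable to \<open>h\<close> outside \<open>[-k - h, k + h]\<close>: the weighted energy of \<open>\<gamma> \<circ> w\<close> is at most a
  constant times \<open>h\<close> times the integral of \<open>\<bar>f\<bar>\<close> over \<open>{\<bar>u\<bar> > k}\<close>, and also at most a constant times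
  the energy of \<open>w\<close>. Integrating the gradient along slanted segments of the half-space and using
  Cauchy--Schwarz gives \<open>\<parallel>v(\<cdot> + z) - v\<parallel>\<^sup>2 \<le> C \<bar>z\<bar>\<^bsup>\<alpha>\<^esup> E\<close> in \<open>L\<^sup>2\<close> for the trace \<open>v\<close> of a function of energy
  \<open>E\<close>. Averaging this over a ball of measure \<open>2 s\<close>, where \<open>s \<ge> \<bar>{\<bar>u\<bar> > k}\<bar>\<close>, yields
  \<open>\<bar>{\<bar>u\<bar> > k + h}\<bar> h\<^sup>2 \<le> C s\<^bsup>\<alpha>/N\<^esup> E\<close>. Hence the level at which the measure of the superlevel set drops
  from \<open>s\<close> to \<open>s / 2\<close> is reached after an increment at most \<open>C s\<^bsup>\<alpha>/N - 1\<^esup>\<close> times the integral of the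
  rearrangement of \<open>f\<close> over \<open>(0, s)\<close> if \<open>\<alpha> < N\<close>, and at most \<open>C s\<^bsup>(\<alpha>/N - 1)/2\<^esup>\<close> if \<open>\<alpha> > N\<close>. Over dyadic \<open>s\<close>
  these increments have a finite sum: in the first case it is controlled by the Lorentz norm of \<open>f\<close>,
  in the second it is a geometric series.\<close>

subsection \<open>Smooth functions\<close>

text \<open>Weak gradients, lateral boundary values and traces are accessible only through
  \<open>H1\<close> limits of test functions. This is why the truncation is smooth: composing with
  it turns the approximating test functions into test functions, so membership in \<open>X0\<close>,
  the trace and the chain rule pass to the composite along one sequence. The trace lives at height
  0, where an energy in the cylinder gives no direct control of horizontal increments. The segments
  therefore climb to height r = norm z, and Cauchy--Schwarz pays for the weight with the integral of
  y^(\<alpha>-1) over (0, r), which is r^\<alpha>/\<alpha> because \<alpha> > 0. The case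
  distinction is the sign of p = \<alpha>/N - 1. If the measure has not dropped below s/2 after an
  increment h, then (s/2) h^2 \<le> C s^(\<alpha>/N) E. The first bound of E is linear in h, so one
  factor h cancels and s^p remains. For p < 0 the sum of s^p over the dyadic s above \<tau> is
  dominated by its smallest s, hence by \<tau>^p, which produces exactly the weight of the Lorentz
  norm. For p > 0 the factor s^p decays by itself, and a bound of E that is uniform in the level is
  enough.\<close>

lemma C_k_imp_continuous: "C_k k f \<Longrightarrow> continuous_on UNIV f"
  by (cases k) (auto simp: continuous_on_eq_continuous_at intro: differentiable_imp_continuous_within)

lemma C_k_SucD: "C_k (Suc k) f \<Longrightarrow> C_k k f"
proof (induction k arbitrary: f)
  case 0
  then show ?case using C_k_imp_continuous[OF 0] by simp
next
  case (Suc k)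
  note * = Suc.prems[unfolded C_k.simps(2)[of "Suc k" f]]
  from Suc.IH * show ?case unfolding C_k.simps(2)[of k f] by blast
qed

lemma C_k_SucI:
  assumes "\<And>x. (f has_derivative f' x) (at x)" "\<And>b. b \<in> Basis \<Longrightarrow> C_k k (\<lambda>x. f' x b)"
  shows "C_k (Suc k) f"
proof -
  have "frechet_derivative f (at x) = f' x" for x
    using assms(1) by (rule frechet_derivative_at[symmetric])
  with assms show ?thesis by (auto simp: differentiable_def)
qed

lemma C_k_const: "C_k k (\<lambda>x. c)"
  by (induction k arbitrary: c) (simp, rule C_k_SucI[where f'="\<lambda>_ _. 0"], auto)

lemma C_k_add:
  assumes "C_k k f" "C_k k g" shows "C_k k (\<lambda>x. f x + g x)"
  using assms
proof (induction k arbitrary: f g)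
  case 0
  then show ?case by (simp add: continuous_on_add)
next
  case (Suc k)
  then show ?case
    by (intro C_k_SucI[where f'="\<lambda>x b. frechet_derivative f (at x) b + frechet_derivative g (at x) b"]
        has_derivative_add)
       (auto simp: frechet_derivative_works)
qed

lemma C_k_mult:
  assumes "C_k k f" "C_k k g" shows "C_k k (\<lambda>x. f x * g x)"
  using assms
proof (induction k arbitrary: f g)
  case 0
  then show ?case by (simp add: continuous_on_mult)
next
  case (Suc k)
  note SucD = C_k_SucD[OF Suc.prems(1)] C_k_SucD[OF Suc.prems(2)]
  from Suc show ?case
    by (intro C_k_SucI[where f'="\<lambda>x b. f x * frechet_derivative g (at x) b + frechet_derivative f (at x) b * g x"]
        C_k_add Suc.IH SucD has_derivative_mult)
       (auto simp: frechet_derivative_works)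
qed

text \<open>The chain rule yields the derivative of \<open>f\<close> times the derivative of
  \<open>g\<close> composed with the same \<open>f\<close>. The induction therefore varies only the
  outer function, while \<open>f\<close> merely loses an order by \<open>C_k_SucD\<close>.\<close>

lemma C_k_compose:
  fixes g :: "real \<Rightarrow> real"
  assumes "C_k k g" "C_k k f" shows "C_k k (\<lambda>x. g (f x))"
  using assms
proof (induction k arbitrary: g)
  case 0
  then show ?case using continuous_on_compose2[of UNIV g UNIV f] by simp
next
  case (Suc k)
  \<comment> \<open>A linear map on the reals is multiplication by its value at 1; this form
    exhibits the derivative as a product of two scalar functions.\<close>
  have g: "(g has_derivative (\<lambda>h. h * frechet_derivative g (at x) 1)) (at x)" for x
  proof -
    have d: "(g has_derivative frechet_derivative g (at x)) (at x)"
      using Suc.prems by (simp add: frechet_derivative_works)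
    have "frechet_derivative g (at x) h = h * frechet_derivative g (at x) 1" for h
      using linear_scale[OF has_derivative_linear[OF d], of h 1] by simp
    then have "frechet_derivative g (at x) = (\<lambda>h. h * frechet_derivative g (at x) 1)" ..
    with d show ?thesis by (rule subst[where P="\<lambda>D. (g has_derivative D) (at x)", rotated])
  qed
  have f: "(f has_derivative frechet_derivative f (at x)) (at x)" for x
    using Suc.prems by (simp add: frechet_derivative_works)
  show ?case
  proof (rule C_k_SucI)
    show "((\<lambda>x. g (f x)) has_derivative
        (\<lambda>h. frechet_derivative f (at x) h * frechet_derivative g (at (f x)) 1)) (at x)" for x
      by (rule has_derivative_compose[OF f g])
    show "C_k k (\<lambda>x. frechet_derivative f (at x) b * frechet_derivative g (at (f x)) 1)"
      if "b \<in> Basis" for b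
    proof (rule C_k_mult)
      show "C_k k (\<lambda>x. frechet_derivative f (at x) b)"
        using Suc.prems(2) that unfolding C_k.simps(2) by blast
      have "C_k k (\<lambda>x. frechet_derivative g (at x) 1)"
        using Suc.prems(1) unfolding C_k.simps(2) by simp
      from Suc.IH[OF this C_k_SucD[OF Suc.prems(2)]]
      show "C_k k (\<lambda>x. frechet_derivative g (at (f x)) 1)" .
    qed
  qed
qed

definition smooth :: "('a::euclidean_space \<Rightarrow> real) \<Rightarrow> bool" where
  "smooth f \<longleftrightarrow> (\<forall>k. C_k k f)"

lemma smooth_const: "smooth (\<lambda>x. c)"
  and smooth_add: "smooth f \<Longrightarrow> smooth g \<Longrightarrow> smooth (\<lambda>x. f x + g x)"
  and smooth_mult: "smooth f \<Longrightarrow> smooth g \<Longrightarrow> smooth (\<lambda>x. f x * g x)"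
  and smooth_compose: "smooth \<gamma> \<Longrightarrow> smooth f \<Longrightarrow> smooth (\<lambda>x. \<gamma> (f x))"
  by (auto simp: smooth_def intro: C_k_const C_k_add C_k_mult C_k_compose)

lemma smooth_inner: "smooth (\<lambda>x. x \<bullet> b)"
  unfolding smooth_def
proof
  show "C_k k (\<lambda>x. x \<bullet> b)" for k
  proof (cases k)
    case (Suc n)
    have "C_k (Suc n) (\<lambda>x. x \<bullet> b)"
      by (rule C_k_SucI[where f'="\<lambda>_ h. h \<bullet> b"])
         (auto intro: C_k_const bounded_linear_imp_has_derivative bounded_linear_inner_left)
    with Suc show ?thesis by blast
  qed (simp add: continuous_on_inner)
qed

lemma smooth_affine: "smooth (\<lambda>t::real. a * t + c)"
  using smooth_add[OF smooth_inner[of a] smooth_const[of c]] by (simp add: mult.commute)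

lemma smooth_prod: "finite A \<Longrightarrow> (\<And>i. i \<in> A \<Longrightarrow> smooth (f i)) \<Longrightarrow> smooth (\<lambda>x. \<Prod>i\<in>A. f i x)"
  by (induction A rule: finite_induct) (auto intro: smooth_const smooth_mult)

lemma smooth_Suc: "smooth f \<longleftrightarrow> (\<forall>k. C_k (Suc k) f)"
  unfolding smooth_def using C_k_SucD by blast

lemma smooth_frechet_derivative:
  "smooth f \<Longrightarrow> b \<in> Basis \<Longrightarrow> smooth (\<lambda>x. frechet_derivative f (at x) b)"
  unfolding smooth_Suc[of f] C_k.simps(2) smooth_def[of "\<lambda>x. frechet_derivative f (at x) b"] by blast

lemma smooth_continuous: "smooth f \<Longrightarrow> continuous_on A f"
  unfolding smooth_def using C_k_imp_continuous continuous_on_subset by blast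

lemma smooth_has_derivative:
  "smooth f \<Longrightarrow> (f has_derivative frechet_derivative f (at x)) (at x)"
  unfolding smooth_Suc C_k.simps(2) frechet_derivative_works by blast

lemma smooth_deriv:
  assumes "smooth (\<gamma> :: real \<Rightarrow> real)"
  shows "(\<gamma> has_real_derivative deriv \<gamma> t) (at t)" "smooth (deriv \<gamma>)"
proof -
  have d: "(\<gamma> has_real_derivative frechet_derivative \<gamma> (at t) 1) (at t)" for t
  proof -
    have d: "(\<gamma> has_derivative frechet_derivative \<gamma> (at t)) (at t)"
      by (rule smooth_has_derivative[OF assms])
    have "frechet_derivative \<gamma> (at t) h = frechet_derivative \<gamma> (at t) 1 * h" for h
      using linear_scale[OF has_derivative_linear[OF d], of h 1] by simp
    then have "frechet_derivative \<gamma> (at t) = (*) (frechet_derivative \<gamma> (at t) 1)" ..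
    with d show ?thesis unfolding has_field_derivative_def
      by (rule subst[where P="\<lambda>D. (\<gamma> has_derivative D) (at t)", rotated])
  qed
  then have e: "deriv \<gamma> = (\<lambda>t. frechet_derivative \<gamma> (at t) 1)"
    by (auto intro!: DERIV_imp_deriv)
  show "(\<gamma> has_real_derivative deriv \<gamma> t) (at t)" using d by (simp add: e)
  show "smooth (deriv \<gamma>)"
    unfolding e by (rule smooth_frechet_derivative[OF assms]) simp
qed

subsection \<open>The function \<open>exp (- 1 / t)\<close>\<close>

text \<open>A family closed under differentiation: deriving only changes the polynomial. Smoothness,
  including at 0, thus becomes an induction over the order with \<open>p\<close> arbitrary.\<close>

definition flat :: "real poly \<Rightarrow> real \<Rightarrow> real" where
  "flat p t = (if t > 0 then poly p (1 / t) * exp (- (1 / t)) else 0)"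

lemma poly_exp_tendsto_0: "((\<lambda>s. poly p s * exp (- s)) \<longlongrightarrow> (0::real)) at_top"
proof -
  have "((\<lambda>s::real. \<Sum>i\<le>degree p. coeff p i * (s ^ i / exp s)) \<longlongrightarrow> (\<Sum>i\<le>degree p. coeff p i * 0)) at_top"
    by (intro tendsto_sum tendsto_mult tendsto_const tendsto_power_div_exp_0)
  then show ?thesis
    by (simp add: poly_altdef sum_distrib_right exp_minus divide_inverse mult.assoc)
qed

lemma flat_tendsto_0: "((\<lambda>t. poly p (1 / t) * exp (- (1 / t))) \<longlongrightarrow> (0::real)) (at_right 0)"
proof -
  have "filterlim (\<lambda>t::real. 1 / t) at_top (at_right 0)"
    using filterlim_inverse_at_top_right by (simp add: inverse_eq_divide)
  from filterlim_compose[OF poly_exp_tendsto_0 this] show ?thesis .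
qed

text \<open>For t > 0 the derivative of p(1/t) exp(-1/t) is t^-2 (p - p')(1/t) exp(-1/t), and t^-2
  is the polynomial \<open>[:0, 0, 1:]\<close> at 1/t. Only t = 0 needs a limit.\<close>

lemma flat_has_derivative:
  "(flat p has_real_derivative flat ([:0, 0, 1:] * (p - pderiv p)) t) (at t)"
proof -
  consider "t < 0" | "t > 0" | "t = 0" by linarith
  then show ?thesis
  proof cases
    case 1
    have "((\<lambda>_. 0) has_real_derivative 0) (at t)" by simp
    then have "(flat p has_real_derivative 0) (at t)"
      by (rule has_field_derivative_transform_within_open[where S="{..<0}"]) (use 1 in \<open>auto simp: flat_def\<close>)
    then show ?thesis using 1 by (simp add: flat_def)
  next
    case 2
    have "((\<lambda>t. poly p (1 / t) * exp (- (1 / t))) has_real_derivative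
        (poly (pderiv p) (1 / t) * (- 1 / t\<^sup>2)) * exp (- (1 / t)) + poly p (1 / t) * (exp (- (1 / t)) * (1 / t\<^sup>2))) (at t)"
      using 2 by (auto intro!: derivative_eq_intros DERIV_chain2[OF poly_DERIV] simp: power2_eq_square)
    then have "(flat p has_real_derivative
        (poly (pderiv p) (1 / t) * (- 1 / t\<^sup>2)) * exp (- (1 / t)) + poly p (1 / t) * (exp (- (1 / t)) * (1 / t\<^sup>2))) (at t)"
      by (rule has_field_derivative_transform_within_open[where S="{0<..}"]) (use 2 in \<open>auto simp: flat_def\<close>)
    then show ?thesis using 2 by (simp add: flat_def power2_eq_square field_simps)
  next
    case 3
    \<comment> \<open>Dividing by \<open>h\<close> multiplies the polynomial in 1/h by its variable,
      so the right difference quotient has again the form treated in \<open>flat_tendsto_0\<close>.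
      The left one is identically 0.\<close>
    have "((\<lambda>h. (flat p (0 + h) - flat p 0) / h) \<longlongrightarrow> 0) (at_right 0)"
      by (rule Lim_transform_eventually[OF flat_tendsto_0[of "[:0, 1:] * p"]])
         (auto simp: flat_def eventually_at_right_less intro!: eventually_at_rightI[of 0 1])
    moreover have "((\<lambda>h. (flat p (0 + h) - flat p 0) / h) \<longlongrightarrow> 0) (at_left 0)"
      by (rule Lim_transform_eventually[OF tendsto_const])
         (auto simp: flat_def intro!: eventually_at_leftI[of "-1" 0])
    ultimately show ?thesis
      using 3 by (simp add: DERIV_def filterlim_at_split) (simp add: flat_def)
  qed
qed

lemma smooth_flat: "smooth (flat p)"
proof -
  have "C_k k (flat p)" for k
  proof (induction k arbitrary: p)
    case 0
    show ?case
      using flat_has_derivative[THEN DERIV_isCont] by (simp add: continuous_at_imp_continuous_on)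
  next
    case (Suc k)
    show ?case
      by (rule C_k_SucI[where f'="\<lambda>x. (*) (flat ([:0, 0, 1:] * (p - pderiv p)) x)"])
         (use flat_has_derivative Suc in \<open>auto simp: has_field_derivative_def\<close>)
  qed
  then show ?thesis by (simp add: smooth_def)
qed

text \<open>A smooth step that vanishes on the negative axis and tends to 1 at infinity without
  reaching it. In place of a plateau there is the lower bound exp(-1), its value at 1, which costs
  only a constant later.\<close>

definition estep :: "real \<Rightarrow> real" where "estep = flat 1"

lemma estep_eq: "estep t = (if t > 0 then exp (- (1 / t)) else 0)"
  by (simp add: estep_def flat_def)

lemma smooth_estep: "smooth estep"
  unfolding estep_def by (rule smooth_flat)

lemma estep_bounds: "0 \<le> estep t" "estep t \<le> 1" "t \<le> 0 \<Longrightarrow> estep t = 0"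
  by (auto simp: estep_eq)

lemma estep_ge: "1 \<le> t \<Longrightarrow> exp (- 1) \<le> estep t"
  by (auto simp: estep_eq)

lemma estep_has_derivative: "(estep has_real_derivative deriv estep t) (at t)"
  by (rule smooth_deriv[OF smooth_estep])

lemma deriv_estep_bounds: "0 \<le> deriv estep t" "deriv estep t \<le> 2"
proof -
  have "deriv estep t = flat ([:0, 0, 1:] * (1 - pderiv 1)) t"
    unfolding estep_def by (intro DERIV_imp_deriv flat_has_derivative)
  then have e: "deriv estep t = (if t > 0 then (1 / t)^2 * exp (- (1 / t)) else 0)"
    by (simp add: flat_def power2_eq_square)
  show "0 \<le> deriv estep t" by (simp add: e)
  have "(1 / t)^2 * exp (- (1 / t)) \<le> 2" if "t > 0"
  proof -
    \<comment> \<open>With x = 1/t the derivative is x^2 exp(-x), and x^2/2 is a term of the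
      exponential series; hence the bound 2.\<close>
    have "1 + 1 / t + (1 / t)^2 / 2 \<le> exp (1 / t)"
      using that by (intro exp_lower_Taylor_quadratic) auto
    then have "(1 / t)^2 \<le> 2 * exp (1 / t)" using divide_pos_pos[OF zero_less_one that] by linarith
    then have "(1 / t)^2 * exp (- (1 / t)) \<le> 2 * exp (1 / t) * exp (- (1 / t))"
      by (rule mult_right_mono) simp
    also have "\<dots> = 2 * exp (1 / t + - (1 / t))"
      by (simp only: exp_add mult.assoc)
    finally show ?thesis by simp
  qed
  then show "deriv estep t \<le> 2" by (simp add: e)
qed

subsection \<open>Gradients and integration by parts\<close>

definition grad :: "('a::euclidean_space \<Rightarrow> real) \<Rightarrow> 'a \<Rightarrow> 'a" where
  "grad f x = (\<Sum>b\<in>Basis. frechet_derivative f (at x) b *\<^sub>R b)"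

lemma grad_inner_Basis: "b \<in> Basis \<Longrightarrow> grad f x \<bullet> b = frechet_derivative f (at x) b"
  by (simp add: grad_def)

lemma smooth_has_derivative_grad:
  assumes "smooth f" shows "(f has_derivative (\<lambda>h. grad f x \<bullet> h)) (at x)"
proof -
  have d: "(f has_derivative frechet_derivative f (at x)) (at x)"
    by (rule smooth_has_derivative[OF assms])
  have "frechet_derivative f (at x) h = grad f x \<bullet> h" for h
  proof -
    have "frechet_derivative f (at x) (\<Sum>b\<in>Basis. (h \<bullet> b) *\<^sub>R b)
        = (\<Sum>b\<in>Basis. (h \<bullet> b) *\<^sub>R frechet_derivative f (at x) b)"
      using has_derivative_linear[OF d] by (simp add: linear_sum linear_scale)
    then have "frechet_derivative f (at x) h = (\<Sum>b\<in>Basis. (h \<bullet> b) *\<^sub>R frechet_derivative f (at x) b)"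
      by (simp only: euclidean_representation)
    then show ?thesis by (simp add: grad_def inner_sum_right inner_commute mult.commute)
  qed
  then have "frechet_derivative f (at x) = (\<lambda>h. grad f x \<bullet> h)" ..
  with d show ?thesis by (rule subst[where P="\<lambda>D. (f has_derivative D) (at x)", rotated])
qed

lemma grad_eqI:
  assumes "(f has_derivative (\<lambda>h. g \<bullet> h)) (at x)" shows "grad f x = g"
  unfolding grad_def frechet_derivative_at[OF assms, symmetric] by (rule euclidean_representation)

lemma smooth_continuous_grad: "smooth f \<Longrightarrow> continuous_on A (grad f)"
  unfolding grad_def[abs_def] by (intro continuous_intros smooth_continuous smooth_frechet_derivative)

lemma grad_eq_0:
  assumes "open S" "x \<in> S" "\<And>y. y \<in> S \<Longrightarrow> f y = 0" shows "grad f x = 0"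
proof (rule grad_eqI)
  have "((\<lambda>_. 0) has_derivative (\<lambda>h. 0 \<bullet> h)) (at x)" by simp
  then show "(f has_derivative (\<lambda>h. 0 \<bullet> h)) (at x)"
    by (rule has_derivative_transform_within_open[OF _ assms(1,2)]) (simp add: assms(3))
qed

lemma grad_eq_0_outside:
  "compact K \<Longrightarrow> (\<And>y. y \<notin> K \<Longrightarrow> f y = 0) \<Longrightarrow> x \<notin> K \<Longrightarrow> grad f x = 0"
  by (rule grad_eq_0[of "- K"]) (auto simp: compact_imp_closed open_Compl)

lemma grad_compose:
  assumes "smooth \<gamma>" "smooth f"
  shows "grad (\<lambda>x. \<gamma> (f x)) x = deriv \<gamma> (f x) *\<^sub>R grad f x"
proof (rule grad_eqI)
  have "(\<gamma> has_derivative (*) (deriv \<gamma> (f x))) (at (f x))"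
    using smooth_deriv(1)[OF assms(1)] by (simp add: has_field_derivative_def)
  from has_derivative_compose[OF smooth_has_derivative_grad[OF assms(2)] this]
  show "((\<lambda>x. \<gamma> (f x)) has_derivative (\<lambda>h. deriv \<gamma> (f x) *\<^sub>R grad f x \<bullet> h)) (at x)" by simp
qed

lemma grad_mult:
  assumes "smooth f" "smooth g"
  shows "grad (\<lambda>x. f x * g x) x = f x *\<^sub>R grad g x + g x *\<^sub>R grad f x"
proof (rule grad_eqI)
  from has_derivative_mult[OF smooth_has_derivative_grad[OF assms(1)] smooth_has_derivative_grad[OF assms(2)]]
  show "((\<lambda>x. f x * g x) has_derivative (\<lambda>h. (f x *\<^sub>R grad g x + g x *\<^sub>R grad f x) \<bullet> h)) (at x)"
    by (simp add: inner_add_left mult.commute)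
qed

lemma smooth_line_has_derivative:
  assumes "smooth g"
  shows "((\<lambda>s. g (x + s *\<^sub>R b)) has_real_derivative grad g (x + s *\<^sub>R b) \<bullet> b) (at s)"
proof -
  have "((\<lambda>s. x + s *\<^sub>R b) has_derivative (\<lambda>h. h *\<^sub>R b)) (at s)"
    by (auto intro!: derivative_eq_intros)
  from has_derivative_compose[OF this smooth_has_derivative_grad[OF assms]]
  show ?thesis
    unfolding has_field_derivative_def by (rule has_derivative_eq_rhs) (simp add: fun_eq_iff mult.commute)
qed

section \<open>Translation invariance and integration by parts\<close>

lemma integral_lborel_translation:
  fixes f :: "'a::euclidean_space \<Rightarrow> real"
  assumes "f \<in> borel_measurable borel"
  shows "integral\<^sup>L lborel (\<lambda>x. f (a + x)) = integral\<^sup>L lborel f"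
proof -
  have "integral\<^sup>L lborel f = integral\<^sup>L (distr lborel borel ((+) a)) f" by (simp add: lborel_distr_plus)
  also have "\<dots> = integral\<^sup>L lborel (\<lambda>x. f (a + x))" using assms by (subst integral_distr) auto
  finally show ?thesis ..
qed

lemma integrable_compact_support:
  fixes f :: "'a::euclidean_space \<Rightarrow> 'b::euclidean_space"
  assumes "compact K" "continuous_on UNIV f" "\<And>x. x \<notin> K \<Longrightarrow> f x = 0"
  shows "integrable lborel f"
proof -
  have "integrable lborel (\<lambda>x. indicator K x *\<^sub>R f x)"
    using assms(1,2) by (intro borel_integrable_compact) (auto intro: continuous_on_subset)
  also have "(\<lambda>x. indicator K x *\<^sub>R f x) = f" using assms(3) by (auto simp: indicator_def)
  finally show ?thesis .
qed

text \<open>Each difference quotient has integral \<open>0\<close> by translation invariance.\<close>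

lemma integral_grad_eq_0:
  fixes g :: "'a::euclidean_space \<Rightarrow> real"
  assumes g: "smooth g" and K: "compact K" and z: "\<And>x. x \<notin> K \<Longrightarrow> g x = 0"
  shows "(\<integral>x. grad g x \<bullet> b \<partial>lborel) = 0"
proof -
  define t where "t n = inverse (real (Suc n))" for n
  define q where "q n x = (g (x + t n *\<^sub>R b) - g x) / t n" for n x
  have t: "0 < t n" "t n \<le> 1" for n unfolding t_def by (auto simp: field_simps)
  have tl: "t \<longlonglongrightarrow> 0" unfolding t_def by (rule LIMSEQ_inverse_real_of_nat)
  have [measurable]: "g \<in> borel_measurable borel"
    by (intro borel_measurable_continuous_onI smooth_continuous g)
  have ig: "integrable lborel g" using K smooth_continuous[OF g] z by (rule integrable_compact_support)
  have "bounded (grad g ` K)"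
    by (intro compact_imp_bounded compact_continuous_image smooth_continuous_grad g K)
  then obtain M where M: "\<And>x. x \<in> K \<Longrightarrow> norm (grad g x) \<le> M" by (auto simp: bounded_iff)
  define M' where "M' = max M 0 * norm b"
  have M': "\<bar>grad g x \<bullet> b\<bar> \<le> M'" for x
  proof -
    have "norm (grad g x) \<le> max M 0"
      using M[of x] grad_eq_0_outside[of K g x] K z by (cases "x \<in> K") auto
    then show ?thesis unfolding M'_def
      by (intro order_trans[OF Cauchy_Schwarz_ineq2] mult_right_mono) auto
  qed
  have qb: "\<bar>q n x\<bar> \<le> M'" for n x
  proof -
    \<comment> \<open>The mean value theorem along the line bounds all difference quotients by the
      supremum of the directional derivative; this is the majorant for dominated
      convergence.\<close>
    obtain s where "g (x + t n *\<^sub>R b) - g (x + 0 *\<^sub>R b) = (t n - 0) * (grad g (x + s *\<^sub>R b) \<bullet> b)"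
      using MVT2[where f="\<lambda>s. g (x + s *\<^sub>R b)" and f'="\<lambda>s. grad g (x + s *\<^sub>R b) \<bullet> b",
          OF t(1)[of n] smooth_line_has_derivative[OF g]] by blast
    then have "q n x = grad g (x + s *\<^sub>R b) \<bullet> b" using t(1)[of n] by (simp add: q_def)
    then show ?thesis using M' by simp
  qed
  \<comment> \<open>As the step sizes are at most 1, one compact set, the sum of \<open>K\<close>
    and a ball of radius \<open>norm b\<close>, supports all the difference quotients.\<close>
  define L where "L = {x + y | x y. x \<in> K \<and> y \<in> cball 0 (norm b)}"
  have L: "compact L" unfolding L_def by (rule compact_sums[OF K compact_cball])
  have q0: "q n x = 0" if "x \<notin> L" for n x
  proof -
    have "x \<notin> K" using that unfolding L_def by force
    moreover have "x + t n *\<^sub>R b \<notin> K"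
    proof
      assume "x + t n *\<^sub>R b \<in> K"
      moreover have "- (t n *\<^sub>R b) \<in> cball 0 (norm b)" using t[of n] by (simp add: mult_left_le_one_le)
      ultimately have "(x + t n *\<^sub>R b) + - (t n *\<^sub>R b) \<in> L" unfolding L_def by blast
      then show False using that by simp
    qed
    ultimately show ?thesis by (simp add: q_def z)
  qed
  have "(\<lambda>n. \<integral>x. q n x \<partial>lborel) \<longlonglongrightarrow> (\<integral>x. grad g x \<bullet> b \<partial>lborel)"
  proof (rule integral_dominated_convergence)
    show "(\<lambda>x. grad g x \<bullet> b) \<in> borel_measurable lborel"
      using borel_measurable_continuous_onI[OF smooth_continuous_grad[OF g]] by simp
    show "q n \<in> borel_measurable lborel" for n unfolding q_def by measurable
    show "integrable lborel (\<lambda>x. indicator L x *\<^sub>R M')"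
      by (intro borel_integrable_compact L continuous_on_const)
    show "AE x in lborel. norm (q n x) \<le> indicator L x *\<^sub>R M'" for n
      using qb q0 by (intro AE_I2) (auto simp: indicator_def)
    show "AE x in lborel. (\<lambda>n. q n x) \<longlonglongrightarrow> grad g x \<bullet> b"
    proof (intro AE_I2)
      fix x
      have "((\<lambda>h. (g (x + (0 + h) *\<^sub>R b) - g (x + 0 *\<^sub>R b)) / h) \<longlongrightarrow> grad g (x + 0 *\<^sub>R b) \<bullet> b) (at 0)"
        using smooth_line_has_derivative[OF g, of x b 0] unfolding DERIV_def .
      then have l: "((\<lambda>h. (g (x + h *\<^sub>R b) - g x) / h) \<longlongrightarrow> grad g x \<bullet> b) (at 0)" by simp
      have "filterlim t (at 0) sequentially"
        using tl t(1) by (auto simp: filterlim_at intro!: always_eventually) (metis less_irrefl)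
      from filterlim_compose[OF l this] show "(\<lambda>n. q n x) \<longlonglongrightarrow> grad g x \<bullet> b" by (simp add: q_def)
    qed
  qed
  moreover have "(\<integral>x. q n x \<partial>lborel) = 0" for n
  proof -
    have i: "integrable lborel (\<lambda>x. g (x + t n *\<^sub>R b))"
    proof (rule integrable_compact_support[OF L])
      show "continuous_on UNIV (\<lambda>x. g (x + t n *\<^sub>R b))"
        by (rule continuous_on_compose2[OF smooth_continuous[OF g, of UNIV]]) (auto intro: continuous_intros)
      show "g (x + t n *\<^sub>R b) = 0" if "x \<notin> L" for x
      proof -
        have "x \<notin> K" using that unfolding L_def by force
        then show ?thesis using q0[OF that, of n] t(1)[of n] z by (simp add: q_def)
      qed
    qed
    have "(\<integral>x. q n x \<partial>lborel) = ((\<integral>x. g (x + t n *\<^sub>R b) \<partial>lborel) - (\<integral>x. g x \<partial>lborel)) / t n"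
      unfolding q_def using i ig by simp
    also have "(\<integral>x. g (x + t n *\<^sub>R b) \<partial>lborel) = (\<integral>x. g x \<partial>lborel)"
      using integral_lborel_translation[of g "t n *\<^sub>R b"] by (simp add: add.commute)
    finally show ?thesis by simp
  qed
  ultimately show ?thesis by (simp add: LIMSEQ_const_iff)
qed

lemma test_functionsE:
  assumes "\<eta> \<in> test_functions U"
  obtains K where "smooth \<eta>" "compact K" "K \<subseteq> U" "\<And>x. x \<notin> K \<Longrightarrow> \<eta> x = 0" "\<And>x. x \<notin> K \<Longrightarrow> grad \<eta> x = 0"
proof -
  from assms obtain K where "smooth \<eta>" "compact K" "K \<subseteq> U" and z: "\<And>x. x \<notin> K \<Longrightarrow> \<eta> x = 0"
    unfolding test_functions_def smooth_def by blast
  then show ?thesis using grad_eq_0_outside[OF \<open>compact K\<close> z] by (intro that) auto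
qed

lemma test_functionsI:
  "smooth \<eta> \<Longrightarrow> compact K \<Longrightarrow> K \<subseteq> U \<Longrightarrow> (\<And>x. x \<notin> K \<Longrightarrow> \<eta> x = 0) \<Longrightarrow> \<eta> \<in> test_functions U"
  unfolding test_functions_def smooth_def by blast

lemma integral_lebesgue_on_eq_lborel:
  fixes f :: "'a::euclidean_space \<Rightarrow> real"
  assumes "S \<in> sets lebesgue" "f \<in> borel_measurable borel" "\<And>x. x \<notin> S \<Longrightarrow> f x = 0"
  shows "integral\<^sup>L (lebesgue_on S) f = integral\<^sup>L lborel f"
proof -
  have "integral\<^sup>L (lebesgue_on S) f = integral\<^sup>L lebesgue (\<lambda>x. indicator S x *\<^sub>R f x)"
    using assms(1) by (simp add: integral_restrict_space)
  also have "(\<lambda>x. indicator S x *\<^sub>R f x) = f" using assms(3) by (force simp: indicator_def fun_eq_iff)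
  also have "integral\<^sup>L lebesgue f = integral\<^sup>L lborel f" using assms(2) by (simp add: integral_completion)
  finally show ?thesis .
qed

text \<open>The product of \<open>f\<close> and \<open>\<eta>\<close> has compact support although
  \<open>f\<close> need not, so the integral of its gradient is 0 and the product rule splits it.
  Since \<open>\<eta>\<close> vanishes outside \<open>U\<close>, both integrals can be taken over
  the whole space.\<close>

lemma integration_by_parts:
  assumes f: "smooth f" and \<eta>: "\<eta> \<in> test_functions U" and U: "open U" and b: "b \<in> Basis"
  shows "(LINT x|lebesgue_on U. f x * frechet_derivative \<eta> (at x) b)
           = - (LINT x|lebesgue_on U. (grad f x \<bullet> b) * \<eta> x)"
proof -
  obtain K where K: "smooth \<eta>" "compact K" "K \<subseteq> U" "\<And>x. x \<notin> K \<Longrightarrow> \<eta> x = 0" "\<And>x. x \<notin> K \<Longrightarrow> grad \<eta> x = 0"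
    by (rule test_functionsE[OF \<eta>]) blast
  have nU: "\<eta> x = 0" "grad \<eta> x = 0" if "x \<notin> U" for x using K(3-5) that by auto
  have c: "continuous_on UNIV (\<lambda>x. f x * (grad \<eta> x \<bullet> b))" "continuous_on UNIV (\<lambda>x. (grad f x \<bullet> b) * \<eta> x)"
    by (intro continuous_intros smooth_continuous smooth_continuous_grad f K)+
  have i: "integrable lborel (\<lambda>x. f x * (grad \<eta> x \<bullet> b))" "integrable lborel (\<lambda>x. (grad f x \<bullet> b) * \<eta> x)"
    by (rule integrable_compact_support[OF K(2)], use c K(4,5) in auto)+
  have "(LINT x|lebesgue_on U. f x * frechet_derivative \<eta> (at x) b) = (\<integral>x. f x * (grad \<eta> x \<bullet> b) \<partial>lborel)"
    unfolding grad_inner_Basis[OF b, symmetric] using nU U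
    by (intro integral_lebesgue_on_eq_lborel borel_measurable_continuous_onI c) auto
  moreover have "(LINT x|lebesgue_on U. (grad f x \<bullet> b) * \<eta> x) = (\<integral>x. (grad f x \<bullet> b) * \<eta> x \<partial>lborel)"
    using nU U by (intro integral_lebesgue_on_eq_lborel borel_measurable_continuous_onI c) auto
  moreover have "(\<integral>x. grad (\<lambda>x. f x * \<eta> x) x \<bullet> b \<partial>lborel) = 0"
    by (rule integral_grad_eq_0[OF smooth_mult[OF f K(1)] K(2)]) (simp add: K(4))
  then have "(\<integral>x. f x * (grad \<eta> x \<bullet> b) + \<eta> x * (grad f x \<bullet> b) \<partial>lborel) = 0"
    by (simp only: grad_mult[OF f K(1)] inner_add_left inner_scaleR_left)
  then have "(\<integral>x. f x * (grad \<eta> x \<bullet> b) + (grad f x \<bullet> b) * \<eta> x \<partial>lborel) = 0"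
    by (simp only: mult.commute[of "\<eta> _"])
  ultimately show ?thesis using i by simp
qed

subsection \<open>Uniqueness of weak gradients\<close>

lemma estep_scaled_tendsto: "(\<lambda>n. estep (real n * t)) \<longlonglongrightarrow> (if t > 0 then 1 else 0)"
proof (cases "t > 0")
  case True
  have "(\<lambda>n. exp (- ((1 / t) * (1 / real n)))) \<longlonglongrightarrow> exp (- ((1 / t) * 0))"
    by (intro tendsto_intros lim_1_over_n)
  moreover have "eventually (\<lambda>n. exp (- ((1 / t) * (1 / real n))) = estep (real n * t)) sequentially"
    using eventually_gt_at_top[of 0] by eventually_elim (use True in \<open>auto simp: estep_eq field_simps\<close>)
  ultimately have "(\<lambda>n. estep (real n * t)) \<longlonglongrightarrow> exp (- ((1 / t) * 0))"
    by (rule Lim_transform_eventually)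
  then show ?thesis using True by simp
next
  case False
  then have "estep (real n * t) = 0" for n by (intro estep_bounds(3)) (simp add: mult_nonneg_nonpos)
  then show ?thesis using False by simp
qed

text \<open>Smooth approximations from below of the indicator of the open box. The sharpness
  \<open>n\<close> leaves the support inside the same closed box, so a single compact set serves for
  all \<open>n\<close>.\<close>

definition box_bump :: "'a::euclidean_space \<Rightarrow> 'a \<Rightarrow> nat \<Rightarrow> 'a \<Rightarrow> real" where
  "box_bump a c n x = (\<Prod>b\<in>Basis. estep (real n * (x \<bullet> b - a \<bullet> b)) * estep (real n * (c \<bullet> b - x \<bullet> b)))"

lemma box_bump_zero: "x \<notin> box a c \<Longrightarrow> box_bump a c n x = 0"
  unfolding box_bump_def mem_box
proof (rule prod_zero[OF finite_Basis])
  assume "\<not> (\<forall>i\<in>Basis. a \<bullet> i < x \<bullet> i \<and> x \<bullet> i < c \<bullet> i)"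
  then obtain i where i: "i \<in> Basis" and "x \<bullet> i - a \<bullet> i \<le> 0 \<or> c \<bullet> i - x \<bullet> i \<le> 0" by force
  then have "real n * (x \<bullet> i - a \<bullet> i) \<le> 0 \<or> real n * (c \<bullet> i - x \<bullet> i) \<le> 0"
    by (meson mult_nonneg_nonpos of_nat_0_le_iff)
  then have "estep (real n * (x \<bullet> i - a \<bullet> i)) * estep (real n * (c \<bullet> i - x \<bullet> i)) = 0"
    using estep_bounds(3) by auto
  with i show "\<exists>i\<in>Basis. estep (real n * (x \<bullet> i - a \<bullet> i)) * estep (real n * (c \<bullet> i - x \<bullet> i)) = 0" ..
qed

lemma box_bump_bounds: "0 \<le> box_bump a c n x" "box_bump a c n x \<le> 1"
  unfolding box_bump_def
  by (auto intro!: prod_nonneg prod_le_1 mult_le_one simp: estep_bounds)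

lemma box_bump_tendsto: "(\<lambda>n. box_bump a c n x) \<longlonglongrightarrow> indicator (box a c) x"
proof -
  have "(\<lambda>n. box_bump a c n x) \<longlonglongrightarrow>
      (\<Prod>b\<in>Basis. (if x \<bullet> b - a \<bullet> b > 0 then 1 else 0) * (if c \<bullet> b - x \<bullet> b > 0 then 1 else 0))"
    unfolding box_bump_def by (intro tendsto_prod tendsto_mult estep_scaled_tendsto)
  also have "(\<Prod>b\<in>Basis. (if x \<bullet> b - a \<bullet> b > 0 then 1 else 0) * (if c \<bullet> b - x \<bullet> b > 0 then 1 else 0))
      = (indicator (box a c) x :: real)"
  proof (cases "x \<in> box a c")
    case True
    then show ?thesis by (simp add: mem_box)
  next
    case False
    then obtain b where "b \<in> Basis" "\<not> (a \<bullet> b < x \<bullet> b \<and> x \<bullet> b < c \<bullet> b)" by (auto simp: mem_box)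
    then show ?thesis using False by (subst prod_zero) auto
  qed
  finally show ?thesis .
qed

lemma smooth_box_bump: "smooth (box_bump a c n)"
proof -
  have "smooth (\<lambda>x. s * (x \<bullet> b) + t)" for s t :: real and b :: 'a
    by (intro smooth_add smooth_mult smooth_const smooth_inner)
  from this[of "real n" _ "- real n * (a \<bullet> _)"] this[of "- real n" _ "real n * (c \<bullet> _)"]
  have "smooth (\<lambda>x. real n * (x \<bullet> b - a \<bullet> b))" "smooth (\<lambda>x. real n * (c \<bullet> b - x \<bullet> b))" for b
    by (simp_all add: algebra_simps)
  then show ?thesis unfolding box_bump_def[abs_def]
    by (intro smooth_prod finite_Basis smooth_mult[OF smooth_compose[OF smooth_estep] smooth_compose[OF smooth_estep]])
qed

lemma box_bump_test: "cbox a c \<subseteq> U \<Longrightarrow> box_bump a c n \<in> test_functions U"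
  using box_subset_cbox[of a c]
  by (intro test_functionsI[of _ "cbox a c"] smooth_box_bump) (auto intro: box_bump_zero)

text \<open>The fundamental lemma of the calculus of variations. Box bumps and dominated convergence
  show that \<open>g\<close> has integral 0 over every closed box in \<open>U\<close>; Lebesgue
  differentiation then gives g = 0 almost everywhere on each box, and countably many boxes exhaust
  \<open>U\<close>.\<close>

lemma AE_zero_if_orthogonal_test:
  fixes g :: "'a::euclidean_space \<Rightarrow> real"
  assumes U: "open U" and g: "locally_integrable_on g U"
    and o: "\<And>\<psi>. \<psi> \<in> test_functions U \<Longrightarrow> (LINT x|lebesgue_on U. g x * \<psi> x) = 0"
  shows "AE x in lebesgue_on U. g x = 0"
proof -
  have gi: "integrable (lebesgue_on (cbox a c)) g" if "cbox a c \<subseteq> U" for a c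
    using g that by (simp add: locally_integrable_on_def)
  have box0: "integral (cbox a c) g = 0" if sub: "cbox a c \<subseteq> U" for a c
  proof -
    have g': "integrable lebesgue (\<lambda>x. indicator (cbox a c) x *\<^sub>R g x)"
      using gi[OF sub] by (simp add: integrable_restrict_space)
    have [measurable]: "(\<lambda>x. indicator (cbox a c) x *\<^sub>R g x) \<in> borel_measurable lebesgue"
      by (rule borel_measurable_integrable[OF g'])
    have [measurable]: "box a c \<in> sets lebesgue" by simp
    have [measurable]: "box_bump a c n \<in> borel_measurable lebesgue" for n
      using borel_measurable_continuous_onI[OF smooth_continuous[OF smooth_box_bump, of UNIV]]
      by (intro measurable_completion) simp
    have "(\<lambda>n. LINT x|lebesgue. (indicator (cbox a c) x *\<^sub>R g x) * box_bump a c n x)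
        \<longlonglongrightarrow> (LINT x|lebesgue. (indicator (cbox a c) x *\<^sub>R g x) * indicator (box a c) x)"
    proof (rule integral_dominated_convergence[OF _ _ integrable_norm[OF g']])
      show "AE x in lebesgue. (\<lambda>n. (indicator (cbox a c) x *\<^sub>R g x) * box_bump a c n x)
        \<longlonglongrightarrow> (indicator (cbox a c) x *\<^sub>R g x) * indicator (box a c) x"
        by (intro AE_I2 tendsto_mult tendsto_const box_bump_tendsto)
      show "AE x in lebesgue. norm ((indicator (cbox a c) x *\<^sub>R g x) * box_bump a c n x)
        \<le> norm (indicator (cbox a c) x *\<^sub>R g x)" for n
        using box_bump_bounds[of a c n] by (intro AE_I2) (simp add: abs_mult mult_right_le_one_le)
    qed measurable
    moreover have "(LINT x|lebesgue. (indicator (cbox a c) x *\<^sub>R g x) * box_bump a c n x) = 0" for n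
    proof -
      have "(LINT x|lebesgue. (indicator (cbox a c) x *\<^sub>R g x) * box_bump a c n x)
          = (LINT x|lebesgue. indicator U x *\<^sub>R (g x * box_bump a c n x))"
        using box_bump_zero[of _ a c n] box_subset_cbox[of a c] sub
        by (intro Bochner_Integration.integral_cong) (auto simp: indicator_def)
      also have "\<dots> = (LINT x|lebesgue_on U. g x * box_bump a c n x)"
        using U by (simp add: integral_restrict_space)
      also have "\<dots> = 0" by (rule o[OF box_bump_test[OF sub]])
      finally show ?thesis .
    qed
    ultimately have "(LINT x|lebesgue. (indicator (cbox a c) x *\<^sub>R g x) * indicator (box a c) x) = 0"
      by (simp add: LIMSEQ_const_iff)
    moreover have "(LINT x|lebesgue. (indicator (cbox a c) x *\<^sub>R g x) * indicator (box a c) x)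
        = (LINT x|lebesgue. indicator (cbox a c) x *\<^sub>R g x)"
    proof (rule integral_cong_AE)
      have "AE x in lebesgue. x \<notin> cbox a c - box a c"
        using negligible_frontier_interval[of a c]
        by (intro AE_not_in) (simp add: negligible_iff_null_sets)
      then show "AE x in lebesgue. (indicator (cbox a c) x *\<^sub>R g x) * indicator (box a c) x
          = indicator (cbox a c) x *\<^sub>R g x"
        by eventually_elim (auto simp: indicator_def)
    qed measurable
    moreover have "integral (cbox a c) g = (LINT x|lebesgue_on (cbox a c). g x)"
      by (rule lebesgue_integral_eq_integral[OF gi[OF sub], symmetric]) simp
    ultimately show ?thesis by (simp add: integral_restrict_space)
  qed
  have negl: "negligible {x \<in> cbox a c. g x \<noteq> 0}" if sub: "cbox a c \<subseteq> U" for a c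
  proof -
    \<comment> \<open>Extended by zero, the function has integral 0 over every box whatsoever,
      because the intersection of two boxes is a box (possibly empty) inside
      \<open>U\<close>.\<close>
    define g1 where "g1 x = (if x \<in> cbox a c then g x else 0)" for x
    have "\<exists>p q. cbox a c \<inter> cbox a' c' = cbox p q" for a' c' unfolding Int_interval by blast
    then have i: "g1 integrable_on cbox a' c'" "integral (cbox a' c') g1 = 0" for a' c'
    proof -
      obtain p q where pq: "cbox a c \<inter> cbox a' c' = cbox p q"
        using \<open>\<And>c' a'. \<exists>p q. cbox a c \<inter> cbox a' c' = cbox p q\<close> by blast
      then have s: "cbox p q \<subseteq> U" using sub by blast
      have "g integrable_on cbox p q"
        using gi[OF s] by (rule integrable_on_lebesgue_on) simp
      with box0[OF s] show "g1 integrable_on cbox a' c'" "integral (cbox a' c') g1 = 0"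
        unfolding g1_def integrable_restrict_Int Henstock_Kurzweil_Integration.integral_restrict_Int pq by auto
    qed
    \<comment> \<open>The Lebesgue differentiation theorem for boxes with corner \<open>x\<close>;
      all the averages are 0 here, so the value outside the exceptional set is 0.\<close>
    obtain N where N: "negligible N"
      "\<And>x e. \<lbrakk>x \<notin> N; 0 < e\<rbrakk> \<Longrightarrow> \<exists>d>0. \<forall>h. 0 < h \<and> h < d \<longrightarrow>
           norm (integral (cbox x (x + h *\<^sub>R One)) g1 /\<^sub>R h ^ DIM('a) - g1 x) < e"
      using integrable_ccontinuous_explicit[of g1] i(1) by metis
    have "g1 x = 0" if nN: "x \<notin> N" for x
    proof (rule ccontr)
      assume "g1 x \<noteq> 0"
      then obtain d where "d > 0" "\<And>h. 0 < h \<Longrightarrow> h < d \<Longrightarrow>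
           norm (integral (cbox x (x + h *\<^sub>R One)) g1 /\<^sub>R h ^ DIM('a) - g1 x) < \<bar>g1 x\<bar>"
        using N(2)[OF nN, of "\<bar>g1 x\<bar>"] by auto
      from this(2)[of "d / 2"] this(1) show False by (simp add: i(2))
    qed
    then have "{x \<in> cbox a c. g x \<noteq> 0} \<subseteq> N" unfolding g1_def by force
    then show ?thesis by (rule negligible_subset[OF N(1)])
  qed
  obtain \<D> where D: "countable \<D>" "\<D> \<subseteq> Pow U" "\<And>X. X \<in> \<D> \<Longrightarrow> \<exists>a b. X = cbox a b" "\<Union>\<D> = U"
    by (rule open_countable_Union_open_cbox[OF U]) blast
  have "negligible (\<Union>X\<in>\<D>. {x \<in> X. g x \<noteq> 0})"
    using D negl by (intro negligible_countable_Union) (auto, blast)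
  also have "(\<Union>X\<in>\<D>. {x \<in> X. g x \<noteq> 0}) = {x \<in> U. g x \<noteq> 0}" using D(4) by blast
  finally have "{x \<in> U. g x \<noteq> 0} \<in> null_sets lebesgue" by (simp add: negligible_iff_null_sets)
  then have "AE x in lebesgue. x \<in> U \<longrightarrow> g x = 0" by (rule AE_I') auto
  then show ?thesis using U by (simp add: AE_restrict_space_iff)
qed

lemma locally_integrable_on_diff:
  "locally_integrable_on f U \<Longrightarrow> locally_integrable_on g U \<Longrightarrow> locally_integrable_on (\<lambda>x. f x - g x) U"
  by (simp add: locally_integrable_on_def)

lemma integrable_locally_integrable_mult_test:
  fixes g :: "'a::euclidean_space \<Rightarrow> real"
  assumes U: "open U" and g: "locally_integrable_on g U" and \<psi>: "continuous_on UNIV \<psi>"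
    and K: "compact K" "K \<subseteq> U" "\<And>x. x \<notin> K \<Longrightarrow> \<psi> x = 0"
  shows "integrable (lebesgue_on U) (\<lambda>x. g x * \<psi> x)"
proof -
  have "bounded (\<psi> ` K)" using K(1) \<psi> by (intro compact_imp_bounded compact_continuous_image) (auto intro: continuous_on_subset)
  then obtain M where M: "\<And>x. x \<in> K \<Longrightarrow> \<bar>\<psi> x\<bar> \<le> M" by (auto simp: bounded_iff)
  have gK: "integrable lebesgue (\<lambda>x. indicator K x *\<^sub>R g x)"
    using g K by (simp add: locally_integrable_on_def integrable_restrict_space compact_imp_closed)
  have [measurable]: "\<psi> \<in> borel_measurable lebesgue"
    using borel_measurable_continuous_onI[OF \<psi>] by (intro measurable_completion) simp
  have "integrable lebesgue (\<lambda>x. (indicator K x *\<^sub>R g x) * \<psi> x)"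
  proof (rule Bochner_Integration.integrable_bound[OF integrable_mult_left[OF gK, of M]])
    show "(\<lambda>x. (indicator K x *\<^sub>R g x) * \<psi> x) \<in> borel_measurable lebesgue"
      using borel_measurable_integrable[OF gK] by measurable
    show "AE x in lebesgue. norm ((indicator K x *\<^sub>R g x) * \<psi> x) \<le> norm ((indicator K x *\<^sub>R g x) * M)"
      using M by (intro AE_I2) (force simp: indicator_def abs_mult intro!: mult_left_mono)
  qed
  also have "(\<lambda>x. (indicator K x *\<^sub>R g x) * \<psi> x) = (\<lambda>x. indicator U x *\<^sub>R (g x * \<psi> x))"
    using K by (force simp: indicator_def fun_eq_iff)
  finally show ?thesis using U by (simp add: integrable_restrict_space)
qed

text \<open>\<open>weak_grad\<close> is an arbitrary choice; uniqueness is what allows it to be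
  replaced by any gradient that has been computed explicitly. The difference of two gradients is
  orthogonal to all test functions in each coordinate.\<close>

lemma weak_gradient_AE_unique:
  fixes U :: "'a::euclidean_space set"
  assumes U: "open U" and 1: "has_weak_gradient U w G" and 2: "has_weak_gradient U w H"
  shows "AE x in lebesgue_on U. G x = H x"
proof -
  have "AE x in lebesgue_on U. G x \<bullet> b - H x \<bullet> b = 0" if b: "b \<in> Basis" for b
  proof (rule AE_zero_if_orthogonal_test[OF U])
    have l: "locally_integrable_on (\<lambda>x. G x \<bullet> b) U" "locally_integrable_on (\<lambda>x. H x \<bullet> b) U"
      using 1 2 by (auto simp: has_weak_gradient_def locally_integrable_on_def)
    then show "locally_integrable_on (\<lambda>x. G x \<bullet> b - H x \<bullet> b) U"
      by (rule locally_integrable_on_diff)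
    fix \<psi> assume \<psi>: "\<psi> \<in> test_functions U"
    obtain K where K: "smooth \<psi>" "compact K" "K \<subseteq> U" "\<And>x. x \<notin> K \<Longrightarrow> \<psi> x = 0"
      by (rule test_functionsE[OF \<psi>]) blast
    have "(LINT x|lebesgue_on U. (G x \<bullet> b) * \<psi> x) = (LINT x|lebesgue_on U. (H x \<bullet> b) * \<psi> x)"
    proof -
      have "(LINT x|lebesgue_on U. w x * frechet_derivative \<psi> (at x) b) = - (LINT x|lebesgue_on U. (G x \<bullet> b) * \<psi> x)"
        using 1 \<psi> b unfolding has_weak_gradient_def by blast
      moreover have "(LINT x|lebesgue_on U. w x * frechet_derivative \<psi> (at x) b) = - (LINT x|lebesgue_on U. (H x \<bullet> b) * \<psi> x)"
        using 2 \<psi> b unfolding has_weak_gradient_def by blast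
      ultimately show ?thesis by simp
    qed
    moreover have "integrable (lebesgue_on U) (\<lambda>x. (G x \<bullet> b) * \<psi> x)" "integrable (lebesgue_on U) (\<lambda>x. (H x \<bullet> b) * \<psi> x)"
      by (simp_all add: integrable_locally_integrable_mult_test[OF U _ smooth_continuous[OF K(1)] K(2-4)] l)
    ultimately show "(LINT x|lebesgue_on U. (G x \<bullet> b - H x \<bullet> b) * \<psi> x) = 0"
      by (simp add: left_diff_distrib)
  qed
  then have "AE x in lebesgue_on U. \<forall>b\<in>Basis. G x \<bullet> b - H x \<bullet> b = 0"
    by (simp add: AE_finite_allI)
  then show ?thesis by eventually_elim (simp add: euclidean_eq_iff[where 'a='a])
qed

subsection \<open>Square integrable functions\<close>

lemma Lp2_iff: "g \<in> Lp 2 U \<longleftrightarrow> g \<in> borel_measurable (lebesgue_on U) \<and> integrable (lebesgue_on U) (\<lambda>x. (norm (g x))\<^sup>2)"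
proof -
  have "norm (g x) powr 2 = (norm (g x))\<^sup>2" for x by simp
  then show ?thesis unfolding Lp_def by simp
qed

lemma integrable_sq_bound:
  fixes f :: "'a \<Rightarrow> 'b::euclidean_space" and g h :: "'a \<Rightarrow> real"
  assumes "f \<in> borel_measurable M" "integrable M g" "\<And>x. (norm (f x))\<^sup>2 \<le> g x"
  shows "integrable M (\<lambda>x. (norm (f x))\<^sup>2)"
proof (rule Bochner_Integration.integrable_bound[OF assms(2)])
  show "(\<lambda>x. (norm (f x))\<^sup>2) \<in> borel_measurable M" using assms(1) by measurable
  show "AE x in M. norm ((norm (f x))\<^sup>2) \<le> norm (g x)"
  proof (intro AE_I2)
    show "norm ((norm (f x))\<^sup>2) \<le> norm (g x)" for x
      using assms(3)[of x] by simp
  qed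
qed

lemma norm_add_sq_le:
  fixes a b :: "'b::real_inner"
  shows "(norm (a + b))\<^sup>2 \<le> 2 * (norm a)\<^sup>2 + 2 * (norm b)\<^sup>2"
proof -
  have "(norm (a + b))\<^sup>2 \<le> (norm a + norm b)\<^sup>2" by (intro power_mono norm_triangle_ineq) auto
  also have "\<dots> \<le> 2 * (norm a)\<^sup>2 + 2 * (norm b)\<^sup>2"
    using sum_squares_bound[of "norm a" "norm b"] by (simp add: power2_sum)
  finally show ?thesis .
qed

lemma norm_diff_sq_le:
  fixes a b :: "'b::real_inner"
  shows "(norm (a - b))\<^sup>2 \<le> 2 * (norm a)\<^sup>2 + 2 * (norm b)\<^sup>2"
  using norm_add_sq_le[of a "- b"] by simp

lemma integrable_sq_diff:
  fixes f g :: "'a \<Rightarrow> 'b::euclidean_space"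
  assumes [measurable]: "f \<in> borel_measurable M" "g \<in> borel_measurable M"
    and "integrable M (\<lambda>x. (norm (f x))\<^sup>2)" "integrable M (\<lambda>x. (norm (g x))\<^sup>2)"
  shows "integrable M (\<lambda>x. (norm (f x - g x))\<^sup>2)"
  by (rule integrable_sq_bound[where g="\<lambda>x. 2 * (norm (f x))\<^sup>2 + 2 * (norm (g x))\<^sup>2"])
     (use assms norm_diff_sq_le in auto)

lemma integrable_mult_sq:
  fixes f g :: "'a \<Rightarrow> real"
  assumes [measurable]: "f \<in> borel_measurable M" "g \<in> borel_measurable M"
    and "integrable M (\<lambda>x. (f x)\<^sup>2)" "integrable M (\<lambda>x. (g x)\<^sup>2)"
  shows "integrable M (\<lambda>x. f x * g x)"
proof (rule Bochner_Integration.integrable_bound)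
  show "integrable M (\<lambda>x. (f x)\<^sup>2 + (g x)\<^sup>2)" using assms by simp
  show "AE x in M. norm (f x * g x) \<le> norm ((f x)\<^sup>2 + (g x)\<^sup>2)"
  proof (intro AE_I2)
    fix x
    have "2 * (\<bar>f x\<bar> * \<bar>g x\<bar>) \<le> (f x)\<^sup>2 + (g x)\<^sup>2"
      using sum_squares_bound[of "\<bar>f x\<bar>" "\<bar>g x\<bar>"] by (simp add: mult.assoc)
    moreover have "0 \<le> \<bar>f x\<bar> * \<bar>g x\<bar>" by simp
    moreover have "norm (f x * g x) = \<bar>f x\<bar> * \<bar>g x\<bar>" by (simp add: abs_mult)
    ultimately show "norm (f x * g x) \<le> norm ((f x)\<^sup>2 + (g x)\<^sup>2)" unfolding real_norm_def by linarith
  qed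
qed measurable

lemma Cauchy_Schwarz_integral:
  fixes f g :: "'a \<Rightarrow> real"
  assumes [measurable]: "f \<in> borel_measurable M" "g \<in> borel_measurable M"
    and f: "integrable M (\<lambda>x. (f x)\<^sup>2)" and g: "integrable M (\<lambda>x. (g x)\<^sup>2)"
  shows "(\<integral>x. f x * g x \<partial>M)\<^sup>2 \<le> (\<integral>x. (f x)\<^sup>2 \<partial>M) * (\<integral>x. (g x)\<^sup>2 \<partial>M)"
proof -
  have i: "integrable M (\<lambda>x. f x * g x)" by (rule integrable_mult_sq) (use assms in auto)
  have "ennreal ((\<integral>x. f x * g x \<partial>M)\<^sup>2) = (ennreal (norm (\<integral>x. f x * g x \<partial>M)))\<^sup>2"
    by (simp add: ennreal_power)
  also have "\<dots> \<le> (\<integral>\<^sup>+x. norm (f x * g x) \<partial>M)\<^sup>2"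
    by (intro power_mono integral_norm_bound_ennreal i) auto
  also have "\<dots> = (\<integral>\<^sup>+x. ennreal \<bar>f x\<bar> * ennreal \<bar>g x\<bar> \<partial>M)\<^sup>2" by (simp add: abs_mult ennreal_mult)
  also have "\<dots> \<le> (\<integral>\<^sup>+x. (ennreal \<bar>f x\<bar>)\<^sup>2 \<partial>M) * (\<integral>\<^sup>+x. (ennreal \<bar>g x\<bar>)\<^sup>2 \<partial>M)"
    by (intro Cauchy_Schwarz_nn_integral) measurable
  also have "\<dots> = ennreal (\<integral>x. (f x)\<^sup>2 \<partial>M) * ennreal (\<integral>x. (g x)\<^sup>2 \<partial>M)"
    using f g by (simp add: ennreal_power nn_integral_eq_integral)
  also have "\<dots> = ennreal ((\<integral>x. (f x)\<^sup>2 \<partial>M) * (\<integral>x. (g x)\<^sup>2 \<partial>M))"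
    by (rule ennreal_mult[symmetric]) auto
  finally show ?thesis by (subst (asm) ennreal_le_iff) auto
qed

text \<open>Cauchy--Schwarz: pairing with a fixed square integrable function is continuous in the
  L^2 norm. This carries integration by parts over to limits of test functions.\<close>

lemma tendsto_integral_mult:
  fixes f :: "nat \<Rightarrow> 'a \<Rightarrow> real" and F g :: "'a \<Rightarrow> real"
  assumes [measurable]: "\<And>n. f n \<in> borel_measurable M" "F \<in> borel_measurable M" "g \<in> borel_measurable M"
    and f: "\<And>n. integrable M (\<lambda>x. (f n x)\<^sup>2)" and F: "integrable M (\<lambda>x. (F x)\<^sup>2)"
    and g: "integrable M (\<lambda>x. (g x)\<^sup>2)"
    and l: "(\<lambda>n. \<integral>x. (F x - f n x)\<^sup>2 \<partial>M) \<longlonglongrightarrow> 0"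
  shows "(\<lambda>n. \<integral>x. f n x * g x \<partial>M) \<longlonglongrightarrow> (\<integral>x. F x * g x \<partial>M)"
proof -
  have d: "integrable M (\<lambda>x. (F x - f n x)\<^sup>2)" for n
    using integrable_sq_diff[of F M "f n"] f F by simp
  have "(\<lambda>n. (\<integral>x. (F x - f n x)\<^sup>2 \<partial>M) * (\<integral>x. (g x)\<^sup>2 \<partial>M)) \<longlonglongrightarrow> 0"
    using tendsto_mult_right[OF l] by simp
  then have "(\<lambda>n. (\<integral>x. (F x - f n x) * g x \<partial>M)\<^sup>2) \<longlonglongrightarrow> 0"
    by (rule tendsto_sandwich[OF _ _ tendsto_const, rotated 2])
       (auto intro!: always_eventually Cauchy_Schwarz_integral d g)
  then have "(\<lambda>n. \<integral>x. (F x - f n x) * g x \<partial>M) \<longlonglongrightarrow> 0" by simp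
  moreover have "(\<integral>x. (F x - f n x) * g x \<partial>M) = (\<integral>x. F x * g x \<partial>M) - (\<integral>x. f n x * g x \<partial>M)" for n
    unfolding left_diff_distrib
    by (intro Bochner_Integration.integral_diff integrable_mult_sq f F g) measurable
  ultimately have "(\<lambda>n. (\<integral>x. F x * g x \<partial>M) - (\<integral>x. f n x * g x \<partial>M)) \<longlonglongrightarrow> 0" by simp
  from tendsto_diff[OF tendsto_const[of "\<integral>x. F x * g x \<partial>M"] this] show ?thesis by simp
qed

lemma integrable_lebesgue_on_subset:
  fixes f :: "'a::euclidean_space \<Rightarrow> 'b::euclidean_space"
  assumes "integrable (lebesgue_on U) f" "K \<subseteq> U" "K \<in> sets lebesgue" "U \<in> sets lebesgue"
  shows "integrable (lebesgue_on K) f"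
proof -
  have "integrable lebesgue (\<lambda>x. indicator K x *\<^sub>R (indicator U x *\<^sub>R f x))"
    by (rule integrable_mult_indicator[OF assms(3)]) (use assms(1,4) in \<open>simp add: integrable_restrict_space\<close>)
  also have "(\<lambda>x. indicator K x *\<^sub>R (indicator U x *\<^sub>R f x)) = (\<lambda>x. indicator K x *\<^sub>R f x)"
    using assms(2) by (auto simp: indicator_def fun_eq_iff)
  finally show ?thesis using assms by (simp add: integrable_restrict_space)
qed

text \<open>A compact set has finite measure, so constants are integrable on it and the pointwise
  bound of the norm by 1 plus its square is enough.\<close>

lemma locally_integrable_on_L2:
  fixes g :: "'a::euclidean_space \<Rightarrow> 'b::euclidean_space"
  assumes "g \<in> Lp 2 U" and U: "open U" shows "locally_integrable_on g U"
  unfolding locally_integrable_on_def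
proof (intro allI impI)
  fix K assume K: "compact K" "K \<subseteq> U"
  have m: "g \<in> borel_measurable (lebesgue_on U)" and i: "integrable (lebesgue_on U) (\<lambda>x. (norm (g x))\<^sup>2)"
    using assms(1) by (simp_all add: Lp2_iff)
  have Ks: "K \<in> sets lebesgue" using K(1) by (simp add: compact_imp_closed)
  have mK: "g \<in> borel_measurable (lebesgue_on K)"
    using measurable_restrict_mono[OF m K(2)] .
  have iK: "integrable (lebesgue_on K) (\<lambda>x. (norm (g x))\<^sup>2)"
    by (rule integrable_lebesgue_on_subset[OF i]) (use K U Ks in auto)
  interpret finite_measure "lebesgue_on K"
    by (intro finite_measure_lebesgue_on lmeasurable_compact K)
  show "integrable (lebesgue_on K) g"
  proof (rule Bochner_Integration.integrable_bound)
    show "integrable (lebesgue_on K) (\<lambda>x. 1 + (norm (g x))\<^sup>2)" using iK by simp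
    show "AE x in lebesgue_on K. norm (g x) \<le> norm (1 + (norm (g x))\<^sup>2)"
    proof (intro AE_I2)
      fix x
      have "2 * norm (g x) \<le> (norm (g x))\<^sup>2 + 1" using sum_squares_bound[of "norm (g x)" 1] by simp
      then show "norm (g x) \<le> norm (1 + (norm (g x))\<^sup>2)"
        unfolding real_norm_def using norm_ge_zero[of "g x"] by linarith
    qed
  qed (rule mK)
qed

lemma continuous_borel_measurable_lebesgue_on:
  fixes f :: "'a::euclidean_space \<Rightarrow> 'b::euclidean_space"
  shows "continuous_on UNIV f \<Longrightarrow> f \<in> borel_measurable (lebesgue_on U)"
  by (intro measurable_restrict_space1 measurable_completion) (simp add: borel_measurable_continuous_onI)

lemma compact_support_L2:
  fixes f :: "'a::euclidean_space \<Rightarrow> 'b::euclidean_space"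
  assumes "compact K" "continuous_on UNIV f" "\<And>x. x \<notin> K \<Longrightarrow> f x = 0" and U: "open U"
  shows "f \<in> Lp 2 U"
proof -
  have "integrable lborel (\<lambda>x. (norm (f x))\<^sup>2)"
    by (rule integrable_compact_support[OF assms(1)]) (use assms in \<open>auto intro!: continuous_intros\<close>)
  then have "integrable lebesgue (\<lambda>x. (norm (f x))\<^sup>2)"
    by (subst integrable_completion) (auto dest: borel_measurable_integrable)
  then have "integrable (lebesgue_on U) (\<lambda>x. (norm (f x))\<^sup>2)"
    using integrable_mult_indicator[of U lebesgue "\<lambda>x. (norm (f x))\<^sup>2"] U by (simp add: integrable_restrict_space)
  then show ?thesis
    using continuous_borel_measurable_lebesgue_on[OF assms(2)] by (simp add: Lp2_iff)
qed

lemma test_functions_L2: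
  assumes "\<psi> \<in> test_functions V" "open U"
  shows "\<psi> \<in> Lp 2 U" "grad \<psi> \<in> Lp 2 U" "b \<in> Basis \<Longrightarrow> (\<lambda>x. frechet_derivative \<psi> (at x) b) \<in> Lp 2 U"
proof -
  obtain K where K: "smooth \<psi>" "compact K" "\<And>x. x \<notin> K \<Longrightarrow> \<psi> x = 0" "\<And>x. x \<notin> K \<Longrightarrow> grad \<psi> x = 0"
    by (rule test_functionsE[OF assms(1)]) blast
  note c = smooth_continuous[OF K(1)] smooth_continuous_grad[OF K(1)]
  show "\<psi> \<in> Lp 2 U" by (rule compact_support_L2[OF K(2) c(1) K(3) assms(2)])
  show "grad \<psi> \<in> Lp 2 U" by (rule compact_support_L2[OF K(2) c(2) K(4) assms(2)])
  show "(\<lambda>x. frechet_derivative \<psi> (at x) b) \<in> Lp 2 U" if b: "b \<in> Basis"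
    by (rule compact_support_L2[OF K(2) smooth_continuous[OF smooth_frechet_derivative[OF K(1) b]] _ assms(2)])
       (simp add: grad_inner_Basis[OF b, symmetric] K(4))
qed

subsection \<open>Approximation in \<open>H\<^sup>1\<close>\<close>

text \<open>The limit \<open>W\<close> of the gradients is kept as an explicit candidate, so that
  convergence can be established before \<open>W\<close> is known to be the weak gradient. The
  approximating functions are test functions on the whole space and need not vanish on the boundary
  of \<open>U\<close>.\<close>

definition H1_approx ::
    "'a::euclidean_space set \<Rightarrow> (nat \<Rightarrow> 'a \<Rightarrow> real) \<Rightarrow> ('a \<Rightarrow> real) \<Rightarrow> ('a \<Rightarrow> 'a) \<Rightarrow> bool" where
  "H1_approx U \<psi> w W \<longleftrightarrow> w \<in> Lp 2 U \<and> W \<in> Lp 2 U \<and> (\<forall>k. \<psi> k \<in> test_functions UNIV) \<and>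
     (\<lambda>k. LINT x|lebesgue_on U. (w x - \<psi> k x)\<^sup>2) \<longlonglongrightarrow> 0 \<and>
     (\<lambda>k. LINT x|lebesgue_on U. (norm (W x - grad (\<psi> k) x))\<^sup>2) \<longlonglongrightarrow> 0"

text \<open>The weak gradient is a closed operator: for smooth functions the identity is integration
  by parts, and both of its sides are continuous under L^2 convergence of the functions and of their
  gradients.\<close>

lemma H1_approx_weak_gradient:
  fixes U :: "'a::euclidean_space set"
  assumes U: "open U" and a: "H1_approx U \<psi> w W"
  shows "has_weak_gradient U w W"
proof -
  let ?M = "lebesgue_on U"
  have w: "w \<in> Lp 2 U" and W: "W \<in> Lp 2 U" and \<psi>: "\<And>k. \<psi> k \<in> test_functions UNIV"
    and l: "(\<lambda>k. LINT x|lebesgue_on U. (w x - \<psi> k x)\<^sup>2) \<longlonglongrightarrow> 0"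
      "(\<lambda>k. LINT x|lebesgue_on U. (norm (W x - grad (\<psi> k) x))\<^sup>2) \<longlonglongrightarrow> 0"
    using a by (auto simp: H1_approx_def)
  have sm: "smooth (\<psi> k)" for k by (rule test_functionsE[OF \<psi>[of k]]) blast
  note L2 = test_functions_L2[OF \<psi> U, unfolded Lp2_iff]
  have "(LINT x|?M. w x * frechet_derivative \<eta> (at x) b) = - (LINT x|?M. (W x \<bullet> b) * \<eta> x)"
    if \<eta>: "\<eta> \<in> test_functions U" and b: "b \<in> Basis" for \<eta> b
  proof -
    note e = test_functions_L2[OF \<eta> U, unfolded Lp2_iff]
    have inner_sq: "(x \<bullet> b)\<^sup>2 \<le> (norm x)\<^sup>2" for x
      using Basis_le_norm[OF b, of x] by (metis abs_ge_zero power2_abs power_mono)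
    have "(\<lambda>k. LINT x|?M. \<psi> k x * frechet_derivative \<eta> (at x) b) \<longlonglongrightarrow> (LINT x|?M. w x * frechet_derivative \<eta> (at x) b)"
      by (rule tendsto_integral_mult) (use w L2 e b l in \<open>auto simp: Lp2_iff\<close>)
    moreover have "(\<lambda>k. LINT x|?M. (grad (\<psi> k) x \<bullet> b) * \<eta> x) \<longlonglongrightarrow> (LINT x|?M. (W x \<bullet> b) * \<eta> x)"
    proof (rule tendsto_integral_mult)
      have mW [measurable]: "W \<in> borel_measurable ?M" and mg [measurable]: "grad (\<psi> n) \<in> borel_measurable ?M" for n
        using W L2 by (auto simp: Lp2_iff)
      have i: "integrable ?M (\<lambda>x. (norm (W x - grad (\<psi> n) x))\<^sup>2)" for n
        by (rule integrable_sq_diff) (use W L2 in \<open>auto simp: Lp2_iff\<close>)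
      show "(\<lambda>x. W x \<bullet> b) \<in> borel_measurable ?M" "(\<lambda>x. grad (\<psi> n) x \<bullet> b) \<in> borel_measurable ?M" for n
        by measurable
      show "integrable ?M (\<lambda>x. (W x \<bullet> b)\<^sup>2)" "integrable ?M (\<lambda>x. (grad (\<psi> n) x \<bullet> b)\<^sup>2)" for n
        using integrable_sq_bound[of "\<lambda>x. W x \<bullet> b" ?M "\<lambda>x. (norm (W x))\<^sup>2"]
          integrable_sq_bound[of "\<lambda>x. grad (\<psi> n) x \<bullet> b" ?M "\<lambda>x. (norm (grad (\<psi> n) x))\<^sup>2"] W L2 inner_sq
        by (auto simp: Lp2_iff)
      have i2: "integrable ?M (\<lambda>x. ((W x - grad (\<psi> n) x) \<bullet> b)\<^sup>2)" for n
        using integrable_sq_bound[of "\<lambda>x. (W x - grad (\<psi> n) x) \<bullet> b" ?M, OF _ i[of n]] inner_sq by simp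
      show "(\<lambda>n. LINT x|?M. (W x \<bullet> b - grad (\<psi> n) x \<bullet> b)\<^sup>2) \<longlonglongrightarrow> 0"
        by (rule tendsto_sandwich[OF _ _ tendsto_const l(2)])
           (use inner_sq in \<open>auto intro!: always_eventually integral_mono i i2 simp: inner_diff_left[symmetric]\<close>)
    qed (use e in auto)
    moreover have "(LINT x|?M. \<psi> k x * frechet_derivative \<eta> (at x) b) = - (LINT x|?M. (grad (\<psi> k) x \<bullet> b) * \<eta> x)" for k
      by (rule integration_by_parts[OF sm \<eta> U b])
    ultimately show ?thesis
      using LIMSEQ_unique[OF _ tendsto_minus] by simp
  qed
  then show ?thesis
    unfolding has_weak_gradient_def using locally_integrable_on_L2[OF w U] locally_integrable_on_L2[OF W U] by blast
qed

section \<open>Replacing the chosen weak gradient by an explicit one\<close>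

lemma borel_measurable_lebesgue_on_AE:
  fixes f g :: "'a::euclidean_space \<Rightarrow> 'b::euclidean_space"
  assumes f: "f \<in> borel_measurable (lebesgue_on U)" and ae: "AE x in lebesgue_on U. f x = g x"
    and U: "U \<in> sets lebesgue"
  shows "g \<in> borel_measurable (lebesgue_on U)"
proof -
  have "(\<lambda>x. indicator U x *\<^sub>R f x) \<in> borel_measurable lebesgue"
    using f U by (simp add: borel_measurable_restrict_space_iff)
  moreover have "AE x in lebesgue. indicator U x *\<^sub>R f x = indicator U x *\<^sub>R g x"
    using ae U by (simp add: AE_restrict_space_iff) (auto elim!: eventually_mono simp: indicator_def)
  ultimately have "(\<lambda>x. indicator U x *\<^sub>R g x) \<in> borel_measurable lebesgue"
    by (rule borel_measurable_AE)
  then show ?thesis using U by (simp add: borel_measurable_restrict_space_iff)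
qed

lemma Lp2_cong_AE:
  fixes f g :: "'a::euclidean_space \<Rightarrow> 'b::euclidean_space"
  assumes f: "f \<in> Lp 2 U" and ae: "AE x in lebesgue_on U. f x = g x" and U: "U \<in> sets lebesgue"
  shows "g \<in> Lp 2 U"
proof -
  have m: "f \<in> borel_measurable (lebesgue_on U)" and i: "integrable (lebesgue_on U) (\<lambda>x. (norm (f x))\<^sup>2)"
    using f by (simp_all add: Lp2_iff)
  have mg: "g \<in> borel_measurable (lebesgue_on U)" by (rule borel_measurable_lebesgue_on_AE[OF m ae U])
  have "integrable (lebesgue_on U) (\<lambda>x. (norm (g x))\<^sup>2)"
  proof (subst integrable_cong_AE)
    show "AE x in lebesgue_on U. (norm (g x))\<^sup>2 = (norm (f x))\<^sup>2" using ae by eventually_elim simp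
  qed (use m mg i in auto)
  with mg show ?thesis by (simp add: Lp2_iff)
qed

lemma Lp2_diff:
  fixes f g :: "'a::euclidean_space \<Rightarrow> 'b::euclidean_space"
  shows "f \<in> Lp 2 U \<Longrightarrow> g \<in> Lp 2 U \<Longrightarrow> (\<lambda>x. f x - g x) \<in> Lp 2 U"
  by (auto simp: Lp2_iff intro: integrable_sq_diff)

lemma has_weak_gradient_diff:
  fixes U :: "'a::euclidean_space set"
  assumes U: "open U" and 1: "has_weak_gradient U w W" and 2: "has_weak_gradient U v V"
  shows "has_weak_gradient U (\<lambda>x. w x - v x) (\<lambda>x. W x - V x)"
  unfolding has_weak_gradient_def
proof (intro conjI ballI)
  have l: "locally_integrable_on w U" "locally_integrable_on v U" "locally_integrable_on W U" "locally_integrable_on V U"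
    using 1 2 by (auto simp: has_weak_gradient_def)
  then show "locally_integrable_on (\<lambda>x. w x - v x) U" "locally_integrable_on (\<lambda>x. W x - V x) U"
    by (auto intro: locally_integrable_on_diff simp: locally_integrable_on_def)
  fix \<eta> b assume \<eta>: "\<eta> \<in> test_functions U" and b: "b \<in> (Basis :: 'a set)"
  obtain K where K: "smooth \<eta>" "compact K" "K \<subseteq> U" "\<And>x. x \<notin> K \<Longrightarrow> \<eta> x = 0" "\<And>x. x \<notin> K \<Longrightarrow> grad \<eta> x = 0"
    by (rule test_functionsE[OF \<eta>]) blast
  have d0: "frechet_derivative \<eta> (at x) b = 0" if "x \<notin> K" for x
    using K(5)[OF that] by (simp add: grad_inner_Basis[OF b, symmetric])
  have lb: "locally_integrable_on (\<lambda>x. W x \<bullet> b) U" "locally_integrable_on (\<lambda>x. V x \<bullet> b) U"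
    using l by (auto simp: locally_integrable_on_def)
  note c = smooth_continuous[OF K(1), of UNIV] smooth_continuous[OF smooth_frechet_derivative[OF K(1) b], of UNIV]
  note i1 = integrable_locally_integrable_mult_test[OF U _ c(1) K(2-4)]
  note i2 = integrable_locally_integrable_mult_test[OF U _ c(2) K(2,3) d0]
  have e1: "(LINT x|lebesgue_on U. w x * frechet_derivative \<eta> (at x) b) = - (LINT x|lebesgue_on U. (W x \<bullet> b) * \<eta> x)"
    using 1 \<eta> b unfolding has_weak_gradient_def by blast
  have e2: "(LINT x|lebesgue_on U. v x * frechet_derivative \<eta> (at x) b) = - (LINT x|lebesgue_on U. (V x \<bullet> b) * \<eta> x)"
    using 2 \<eta> b unfolding has_weak_gradient_def by blast
  show "(LINT x|lebesgue_on U. (w x - v x) * frechet_derivative \<eta> (at x) b)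
      = - (LINT x|lebesgue_on U. ((W x - V x) \<bullet> b) * \<eta> x)"
    unfolding inner_diff_left left_diff_distrib
    using i1[OF lb(1)] i1[OF lb(2)] i2[OF l(1)] i2[OF l(2)] e1 e2
    by (simp add: Bochner_Integration.integral_diff)
qed

lemma test_functions_weak_gradient:
  assumes \<psi>: "\<psi> \<in> test_functions V" and U: "open U"
  shows "has_weak_gradient U \<psi> (grad \<psi>)"
proof -
  have "smooth \<psi>" by (rule test_functionsE[OF \<psi>]) blast
  then show ?thesis unfolding has_weak_gradient_def
    by (intro conjI ballI locally_integrable_on_L2[OF test_functions_L2(1)[OF \<psi> U] U]
        locally_integrable_on_L2[OF test_functions_L2(2)[OF \<psi> U] U] integration_by_parts[OF _ _ U])
qed

lemma H1I:
  fixes U :: "'a::euclidean_space set"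
  assumes U: "open U" and w: "w \<in> Lp 2 U" and W: "W \<in> Lp 2 U" and g: "has_weak_gradient U w W"
  shows "w \<in> H1 U" "AE x in lebesgue_on U. weak_grad U w x = W x"
    "H1_norm U w = sqrt ((LINT x|lebesgue_on U. (w x)\<^sup>2) + (LINT x|lebesgue_on U. (norm (W x))\<^sup>2))"
proof -
  have h: "has_weak_gradient U w (weak_grad U w)" unfolding weak_grad_def by (rule someI[of "has_weak_gradient U w", OF g])
  show ae: "AE x in lebesgue_on U. weak_grad U w x = W x" by (rule weak_gradient_AE_unique[OF U h g])
  have "AE x in lebesgue_on U. W x = weak_grad U w x" using ae by eventually_elim simp
  from Lp2_cong_AE[OF W this] U have L: "weak_grad U w \<in> Lp 2 U" by simp
  with w g show "w \<in> H1 U" unfolding H1_def by blast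
  have "(LINT x|lebesgue_on U. (norm (weak_grad U w x))\<^sup>2) = (LINT x|lebesgue_on U. (norm (W x))\<^sup>2)"
  proof (rule integral_cong_AE)
    show "AE x in lebesgue_on U. (norm (weak_grad U w x))\<^sup>2 = (norm (W x))\<^sup>2"
      using ae by eventually_elim simp
  qed (use L W in \<open>auto simp: Lp2_iff\<close>)
  then show "H1_norm U w = sqrt ((LINT x|lebesgue_on U. (w x)\<^sup>2) + (LINT x|lebesgue_on U. (norm (W x))\<^sup>2))"
    by (simp add: H1_norm_def)
qed

lemma H1D:
  assumes "w \<in> H1 U"
  shows "w \<in> Lp 2 U" "weak_grad U w \<in> Lp 2 U" "has_weak_gradient U w (weak_grad U w)"
  using assms unfolding H1_def weak_grad_def by (auto intro: someI[of "has_weak_gradient U w"])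

text \<open>By definition the left side contains \<open>weak_grad\<close> of a difference, which is
  an unrelated choice; linearity of the weak gradient relation together with uniqueness identifies
  it with the difference of the gradients.\<close>

lemma H1_norm_diff_test:
  assumes U: "open U" and w: "w \<in> Lp 2 U" and W: "W \<in> Lp 2 U" and g: "has_weak_gradient U w W"
    and \<psi>: "\<psi> \<in> test_functions V"
  shows "H1_norm U (\<lambda>x. w x - \<psi> x)
    = sqrt ((LINT x|lebesgue_on U. (w x - \<psi> x)\<^sup>2) + (LINT x|lebesgue_on U. (norm (W x - grad \<psi> x))\<^sup>2))"
  by (rule H1I(3)[OF U]) (intro Lp2_diff w W test_functions_L2[OF \<psi> U]
      has_weak_gradient_diff[OF U g test_functions_weak_gradient[OF \<psi> U]])+

lemma test_functions_mono: "U \<subseteq> V \<Longrightarrow> test_functions U \<subseteq> test_functions V"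
  unfolding test_functions_def by blast

lemma H1_approxI:
  assumes U: "open U" and w: "w \<in> H1 U" and \<psi>: "\<And>k. \<psi> k \<in> test_functions V"
    and l: "(\<lambda>k. H1_norm U (\<lambda>x. w x - \<psi> k x)) \<longlonglongrightarrow> 0"
  shows "H1_approx U \<psi> w (weak_grad U w)"
proof -
  define a b where "a k = (LINT x|lebesgue_on U. (w x - \<psi> k x)\<^sup>2)"
    and "b k = (LINT x|lebesgue_on U. (norm (weak_grad U w x - grad (\<psi> k) x))\<^sup>2)" for k
  have nn: "0 \<le> a k" "0 \<le> b k" for k unfolding a_def b_def by auto
  have "(\<lambda>k. (sqrt (a k + b k))\<^sup>2) \<longlonglongrightarrow> 0\<^sup>2"
    using l unfolding H1_norm_diff_test[OF U H1D[OF w] \<psi>] a_def b_def by (rule tendsto_power)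
  then have s: "(\<lambda>k. a k + b k) \<longlonglongrightarrow> 0" using nn by (simp add: add_nonneg_nonneg)
  have "a \<longlonglongrightarrow> 0" "b \<longlonglongrightarrow> 0"
    by (rule tendsto_sandwich[OF _ _ tendsto_const s]; use nn in \<open>auto intro!: always_eventually\<close>)+
  moreover have "\<psi> k \<in> test_functions UNIV" for k using \<psi>[of k] test_functions_mono[of V UNIV] by auto
  ultimately show ?thesis using H1D[OF w] unfolding H1_approx_def a_def b_def by blast
qed

lemma H1_approx_norm:
  assumes U: "open U" and a: "H1_approx U \<psi> w W"
  shows "(\<lambda>k. H1_norm U (\<lambda>x. w x - \<psi> k x)) \<longlonglongrightarrow> 0"
proof -
  have "w \<in> Lp 2 U" "W \<in> Lp 2 U" and \<psi>: "\<And>k. \<psi> k \<in> test_functions UNIV"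
    and l: "(\<lambda>k. LINT x|lebesgue_on U. (w x - \<psi> k x)\<^sup>2) \<longlonglongrightarrow> 0"
      "(\<lambda>k. LINT x|lebesgue_on U. (norm (W x - grad (\<psi> k) x))\<^sup>2) \<longlonglongrightarrow> 0"
    using a by (auto simp: H1_approx_def)
  note e = H1_norm_diff_test[OF U this(1,2) H1_approx_weak_gradient[OF U a] \<psi>]
  show ?thesis unfolding e
    using tendsto_real_sqrt[OF tendsto_add[OF l]] by simp
qed

section \<open>Composition with smooth functions of bounded derivative\<close>

lemma test_functions_compose:
  assumes "smooth \<gamma>" "\<gamma> 0 = 0" "\<psi> \<in> test_functions V"
  shows "(\<lambda>x. \<gamma> (\<psi> x)) \<in> test_functions V"
proof -
  obtain K where K: "smooth \<psi>" "compact K" "K \<subseteq> V" "\<And>x. x \<notin> K \<Longrightarrow> \<psi> x = 0"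
    by (rule test_functionsE[OF assms(3)]) blast
  show ?thesis
    by (rule test_functionsI[OF smooth_compose[OF assms(1) K(1)] K(2,3)]) (simp add: K(4) assms(2))
qed

lemma bounded_deriv_lipschitz:
  fixes \<gamma> :: "real \<Rightarrow> real"
  assumes "smooth \<gamma>" and M: "\<And>t. \<bar>deriv \<gamma> t\<bar> \<le> M"
  shows "\<bar>\<gamma> s - \<gamma> t\<bar> \<le> M * \<bar>s - t\<bar>"
  using field_differentiable_bound[of UNIV \<gamma> "deriv \<gamma>" M s t] smooth_deriv(1)[OF assms(1)] M
  by (auto simp: has_field_derivative_at_within)

lemma Lp2_compose:
  fixes \<gamma> :: "real \<Rightarrow> real"
  assumes \<gamma>: "smooth \<gamma>" "\<gamma> 0 = 0" and M: "\<And>t. \<bar>deriv \<gamma> t\<bar> \<le> M" and w: "w \<in> Lp 2 U"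
  shows "(\<lambda>x. \<gamma> (w x)) \<in> Lp 2 U"
proof -
  have m [measurable]: "w \<in> borel_measurable (lebesgue_on U)" and i: "integrable (lebesgue_on U) (\<lambda>x. (w x)\<^sup>2)"
    using w by (simp_all add: Lp2_iff)
  have g [measurable]: "\<gamma> \<in> borel_measurable borel"
    by (intro borel_measurable_continuous_onI smooth_continuous \<gamma>)
  have b: "(\<gamma> t)\<^sup>2 \<le> M\<^sup>2 * t\<^sup>2" for t
  proof -
    have "\<bar>\<gamma> t\<bar> \<le> M * \<bar>t\<bar>" using bounded_deriv_lipschitz[OF \<gamma>(1) M, of t 0] \<gamma>(2) by simp
    then have "\<bar>\<gamma> t\<bar>\<^sup>2 \<le> (M * \<bar>t\<bar>)\<^sup>2" by (intro power_mono) auto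
    then show ?thesis by (simp add: power_mult_distrib)
  qed
  have "integrable (lebesgue_on U) (\<lambda>x. (norm (\<gamma> (w x)))\<^sup>2)"
    by (rule integrable_sq_bound[where g="\<lambda>x. M\<^sup>2 * (w x)\<^sup>2"]) (use i b in auto)
  then show ?thesis by (simp add: Lp2_iff)
qed

lemma L2_compose_tendsto:
  fixes \<gamma> :: "real \<Rightarrow> real"
  assumes \<gamma>: "smooth \<gamma>" and M: "\<And>t. \<bar>deriv \<gamma> t\<bar> \<le> M"
    and f [measurable]: "F \<in> borel_measurable N" "\<And>k. f k \<in> borel_measurable N"
    and i: "\<And>k. integrable N (\<lambda>x. (F x - f k x)\<^sup>2)"
    and l: "(\<lambda>k. \<integral>x. (F x - f k x)\<^sup>2 \<partial>N) \<longlonglongrightarrow> 0"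
  shows "(\<lambda>k. \<integral>x. (\<gamma> (F x) - \<gamma> (f k x))\<^sup>2 \<partial>N) \<longlonglongrightarrow> 0"
proof -
  have g [measurable]: "\<gamma> \<in> borel_measurable borel"
    by (intro borel_measurable_continuous_onI smooth_continuous \<gamma>)
  have b: "(\<gamma> s - \<gamma> t)\<^sup>2 \<le> M\<^sup>2 * (s - t)\<^sup>2" for s t
  proof -
    have "\<bar>\<gamma> s - \<gamma> t\<bar>\<^sup>2 \<le> (M * \<bar>s - t\<bar>)\<^sup>2"
      using bounded_deriv_lipschitz[OF \<gamma> M] by (intro power_mono) auto
    then show ?thesis by (simp add: power_mult_distrib)
  qed
  have i': "integrable N (\<lambda>x. (\<gamma> (F x) - \<gamma> (f k x))\<^sup>2)" for k
    using integrable_sq_bound[of "\<lambda>x. \<gamma> (F x) - \<gamma> (f k x)" N "\<lambda>x. M\<^sup>2 * (F x - f k x)\<^sup>2"] i[of k] b by simp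
  have "(\<lambda>k. M\<^sup>2 * (\<integral>x. (F x - f k x)\<^sup>2 \<partial>N)) \<longlonglongrightarrow> 0"
    using tendsto_mult_left[OF l] by simp
  then show ?thesis
  proof (rule tendsto_sandwich[OF _ _ tendsto_const, rotated 2])
    have "(\<integral>x. (\<gamma> (F x) - \<gamma> (f k x))\<^sup>2 \<partial>N) \<le> (\<integral>x. M\<^sup>2 * (F x - f k x)\<^sup>2 \<partial>N)" for k
      by (intro integral_mono i') (use i b in auto)
    then show "\<forall>\<^sub>F k in sequentially. (\<integral>x. (\<gamma> (F x) - \<gamma> (f k x))\<^sup>2 \<partial>N) \<le> M\<^sup>2 * (\<integral>x. (F x - f k x)\<^sup>2 \<partial>N)"
      by simp
  qed simp
qed

text \<open>The passage to a subsequence makes \<open>\<psi> k\<close> converge almost everywhere, as needed for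
  \<open>deriv \<gamma> (\<psi> k) \<longlonglongrightarrow> deriv \<gamma> w\<close>.\<close>

lemma H1_approx_compose:
  fixes \<gamma> :: "real \<Rightarrow> real"
  assumes U: "open U" and a: "H1_approx U \<psi> w W"
    and \<gamma>: "smooth \<gamma>" "\<gamma> 0 = 0" and M: "\<And>t. \<bar>deriv \<gamma> t\<bar> \<le> M"
  obtains r where "strict_mono r"
    "H1_approx U (\<lambda>k x. \<gamma> (\<psi> (r k) x)) (\<lambda>x. \<gamma> (w x)) (\<lambda>x. deriv \<gamma> (w x) *\<^sub>R W x)"
proof -
  let ?M = "lebesgue_on U"
  have w: "w \<in> Lp 2 U" and W: "W \<in> Lp 2 U" and \<psi>: "\<And>k. \<psi> k \<in> test_functions UNIV"
    and l: "(\<lambda>k. LINT x|?M. (w x - \<psi> k x)\<^sup>2) \<longlonglongrightarrow> 0"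
      "(\<lambda>k. LINT x|?M. (norm (W x - grad (\<psi> k) x))\<^sup>2) \<longlonglongrightarrow> 0"
    using a by (auto simp: H1_approx_def)
  note \<psi>2 = test_functions_L2[OF \<psi> U]
  have [measurable]: "w \<in> borel_measurable ?M" "W \<in> borel_measurable ?M"
    "\<psi> k \<in> borel_measurable ?M" "grad (\<psi> k) \<in> borel_measurable ?M" for k
    using w W \<psi>2 by (auto simp: Lp2_iff)
  have [measurable]: "\<gamma> \<in> borel_measurable borel" "deriv \<gamma> \<in> borel_measurable borel"
    by (intro borel_measurable_continuous_onI smooth_continuous \<gamma> smooth_deriv(2))+
  have sm: "smooth (\<psi> k)" for k by (rule test_functionsE[OF \<psi>[of k]]) blast
  have i1: "integrable ?M (\<lambda>x. (w x - \<psi> k x)\<^sup>2)" for k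
    using Lp2_diff[OF w \<psi>2(1)[of k]] by (simp add: Lp2_iff)
  have i2: "integrable ?M (\<lambda>x. (norm (W x - grad (\<psi> k) x))\<^sup>2)" for k
    using Lp2_diff[OF W \<psi>2(2)[of k]] by (simp add: Lp2_iff)
  have iW: "integrable ?M (\<lambda>x. (norm (W x))\<^sup>2)" using W by (simp add: Lp2_iff)
  obtain r where r: "strict_mono r" and ae: "AE x in ?M. (\<lambda>k. (w x - \<psi> (r k) x)\<^sup>2) \<longlonglongrightarrow> 0"
    using tendsto_L1_AE_subseq[of ?M "\<lambda>k x. (w x - \<psi> k x)\<^sup>2"] i1 l(1) by auto
  have ae': "AE x in ?M. (\<lambda>k. \<psi> (r k) x) \<longlonglongrightarrow> w x"
    using ae
  proof eventually_elim
    fix x assume "(\<lambda>k. (w x - \<psi> (r k) x)\<^sup>2) \<longlonglongrightarrow> 0"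
    then have "(\<lambda>k. w x - \<psi> (r k) x) \<longlonglongrightarrow> 0" by simp
    from tendsto_diff[OF tendsto_const[of "w x"] this] show "(\<lambda>k. \<psi> (r k) x) \<longlonglongrightarrow> w x" by simp
  qed
  have D: "(\<lambda>x. deriv \<gamma> (w x) *\<^sub>R W x) \<in> Lp 2 U"
  proof -
    have "integrable ?M (\<lambda>x. (norm (deriv \<gamma> (w x) *\<^sub>R W x))\<^sup>2)"
    proof (rule integrable_sq_bound[where g="\<lambda>x. M\<^sup>2 * (norm (W x))\<^sup>2"])
      show "(norm (deriv \<gamma> (w x) *\<^sub>R W x))\<^sup>2 \<le> M\<^sup>2 * (norm (W x))\<^sup>2" for x
        using power_mono[OF M[of "w x"], of 2] by (simp add: power_mult_distrib mult_right_mono)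
    qed (use iW in auto)
    then show ?thesis by (simp add: Lp2_iff)
  qed
  have lr1: "(\<lambda>k. LINT x|?M. (w x - \<psi> (r k) x)\<^sup>2) \<longlonglongrightarrow> 0"
    and lr2: "(\<lambda>k. LINT x|?M. (norm (W x - grad (\<psi> (r k)) x))\<^sup>2) \<longlonglongrightarrow> 0"
    using LIMSEQ_subseq_LIMSEQ[OF l(1) r] LIMSEQ_subseq_LIMSEQ[OF l(2) r] by (simp_all add: o_def)
  have dM: "(deriv \<gamma> p - deriv \<gamma> q)\<^sup>2 * (norm y)\<^sup>2 \<le> (2 * M)\<^sup>2 * (norm y)\<^sup>2" for p q and y :: 'a
  proof -
    have "\<bar>deriv \<gamma> p - deriv \<gamma> q\<bar> \<le> 2 * M" using M[of p] M[of q] by linarith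
    from power_mono[OF this, of 2] show ?thesis by (intro mult_right_mono) auto
  qed
  \<comment> \<open>The bounded difference of derivatives multiplies the fixed function
    \<open>W\<close>, so the squared norm of \<open>W\<close> times a constant is an integrable
    majorant.\<close>
  have lim: "(\<lambda>k. LINT x|?M. (deriv \<gamma> (w x) - deriv \<gamma> (\<psi> (r k) x))\<^sup>2 * (norm (W x))\<^sup>2) \<longlonglongrightarrow> (LINT x|?M. 0)"
  proof (rule integral_dominated_convergence[where w="\<lambda>x. (2 * M)\<^sup>2 * (norm (W x))\<^sup>2"])
    show "AE x in ?M. (\<lambda>k. (deriv \<gamma> (w x) - deriv \<gamma> (\<psi> (r k) x))\<^sup>2 * (norm (W x))\<^sup>2) \<longlonglongrightarrow> 0"
      using ae'
    proof eventually_elim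
      fix x assume t: "(\<lambda>k. \<psi> (r k) x) \<longlonglongrightarrow> w x"
      have "isCont (deriv \<gamma>) (w x)"
        using smooth_continuous[OF smooth_deriv(2)[OF \<gamma>(1)], of UNIV] by (simp add: continuous_on_eq_continuous_at)
      from isCont_tendsto_compose[OF this t]
      have "(\<lambda>k. deriv \<gamma> (w x) - deriv \<gamma> (\<psi> (r k) x)) \<longlonglongrightarrow> deriv \<gamma> (w x) - deriv \<gamma> (w x)"
        by (intro tendsto_diff tendsto_const)
      then have "(\<lambda>k. (deriv \<gamma> (w x) - deriv \<gamma> (\<psi> (r k) x))\<^sup>2 * (norm (W x))\<^sup>2) \<longlonglongrightarrow> (deriv \<gamma> (w x) - deriv \<gamma> (w x))\<^sup>2 * (norm (W x))\<^sup>2"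
        by (intro tendsto_mult tendsto_power tendsto_const)
      then show "(\<lambda>k. (deriv \<gamma> (w x) - deriv \<gamma> (\<psi> (r k) x))\<^sup>2 * (norm (W x))\<^sup>2) \<longlonglongrightarrow> 0" by simp
    qed
    show "AE x in ?M. norm ((deriv \<gamma> (w x) - deriv \<gamma> (\<psi> (r k) x))\<^sup>2 * (norm (W x))\<^sup>2) \<le> (2 * M)\<^sup>2 * (norm (W x))\<^sup>2" for k
      by (intro AE_I2) (use dM in simp)
    show "integrable ?M (\<lambda>x. (2 * M)\<^sup>2 * (norm (W x))\<^sup>2)" using iW by simp
  qed measurable
  have gr: "grad (\<lambda>x. \<gamma> (\<psi> k x)) = (\<lambda>x. deriv \<gamma> (\<psi> k x) *\<^sub>R grad (\<psi> k) x)" for k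
    using grad_compose[OF \<gamma>(1) sm] by blast
  \<comment> \<open>Adding and subtracting \<open>deriv \<gamma> (\<psi> k x)\<close> times
    \<open>W\<close> separates the two limits: one term has a varying factor on the fixed
    \<open>W\<close> and needs convergence almost everywhere, the other has a bounded factor on a
    difference of gradients that tends to 0 in L^2.\<close>
  have bd: "(norm (deriv \<gamma> (w x) *\<^sub>R W x - deriv \<gamma> (\<psi> k x) *\<^sub>R grad (\<psi> k) x))\<^sup>2
      \<le> 2 * ((deriv \<gamma> (w x) - deriv \<gamma> (\<psi> k x))\<^sup>2 * (norm (W x))\<^sup>2) + 2 * M\<^sup>2 * (norm (W x - grad (\<psi> k) x))\<^sup>2" for k x
  proof -
    have "deriv \<gamma> (w x) *\<^sub>R W x - deriv \<gamma> (\<psi> k x) *\<^sub>R grad (\<psi> k) x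
      = (deriv \<gamma> (w x) - deriv \<gamma> (\<psi> k x)) *\<^sub>R W x + deriv \<gamma> (\<psi> k x) *\<^sub>R (W x - grad (\<psi> k) x)"
      by (simp add: scaleR_left_diff_distrib scaleR_right_diff_distrib)
    then have "(norm (deriv \<gamma> (w x) *\<^sub>R W x - deriv \<gamma> (\<psi> k x) *\<^sub>R grad (\<psi> k) x))\<^sup>2
      \<le> 2 * (norm ((deriv \<gamma> (w x) - deriv \<gamma> (\<psi> k x)) *\<^sub>R W x))\<^sup>2 + 2 * (norm (deriv \<gamma> (\<psi> k x) *\<^sub>R (W x - grad (\<psi> k) x)))\<^sup>2"
      using norm_add_sq_le by metis
    also have "\<dots> = 2 * ((deriv \<gamma> (w x) - deriv \<gamma> (\<psi> k x))\<^sup>2 * (norm (W x))\<^sup>2) + 2 * ((deriv \<gamma> (\<psi> k x))\<^sup>2 * (norm (W x - grad (\<psi> k) x))\<^sup>2)"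
      by (simp add: power_mult_distrib)
    also have "(deriv \<gamma> (\<psi> k x))\<^sup>2 \<le> M\<^sup>2" using power_mono[OF M[of "\<psi> k x"], of 2] by simp
    finally show ?thesis by (simp add: mult_right_mono)
  qed
  have i3: "integrable ?M (\<lambda>x. (deriv \<gamma> (w x) - deriv \<gamma> (\<psi> k x))\<^sup>2 * (norm (W x))\<^sup>2)" for k
  proof (rule Bochner_Integration.integrable_bound)
    show "integrable ?M (\<lambda>x. (2 * M)\<^sup>2 * (norm (W x))\<^sup>2)" using iW by simp
    show "AE x in ?M. norm ((deriv \<gamma> (w x) - deriv \<gamma> (\<psi> k x))\<^sup>2 * (norm (W x))\<^sup>2) \<le> norm ((2 * M)\<^sup>2 * (norm (W x))\<^sup>2)"
      by (intro AE_I2) (use dM in simp)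
  qed measurable
  have "(\<lambda>k. LINT x|?M. (norm (deriv \<gamma> (w x) *\<^sub>R W x - grad (\<lambda>x. \<gamma> (\<psi> (r k) x)) x))\<^sup>2) \<longlonglongrightarrow> 0"
  proof (rule tendsto_sandwich[OF _ _ tendsto_const])
    have "(\<lambda>k. 2 * (LINT x|?M. (deriv \<gamma> (w x) - deriv \<gamma> (\<psi> (r k) x))\<^sup>2 * (norm (W x))\<^sup>2)
        + 2 * M\<^sup>2 * (LINT x|?M. (norm (W x - grad (\<psi> (r k)) x))\<^sup>2)) \<longlonglongrightarrow> 2 * (LINT x|?M. 0) + 2 * M\<^sup>2 * 0"
      by (intro tendsto_add tendsto_mult tendsto_const lim lr2)
    then show "(\<lambda>k. 2 * (LINT x|?M. (deriv \<gamma> (w x) - deriv \<gamma> (\<psi> (r k) x))\<^sup>2 * (norm (W x))\<^sup>2)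
        + 2 * M\<^sup>2 * (LINT x|?M. (norm (W x - grad (\<psi> (r k)) x))\<^sup>2)) \<longlonglongrightarrow> 0" by simp
    have "(LINT x|?M. (norm (deriv \<gamma> (w x) *\<^sub>R W x - grad (\<lambda>x. \<gamma> (\<psi> (r k) x)) x))\<^sup>2)
      \<le> (LINT x|?M. 2 * ((deriv \<gamma> (w x) - deriv \<gamma> (\<psi> (r k) x))\<^sup>2 * (norm (W x))\<^sup>2)
            + 2 * M\<^sup>2 * (norm (W x - grad (\<psi> (r k)) x))\<^sup>2)" for k
      unfolding gr
    proof (rule integral_mono)
      show i4: "integrable ?M (\<lambda>x. 2 * ((deriv \<gamma> (w x) - deriv \<gamma> (\<psi> (r k) x))\<^sup>2 * (norm (W x))\<^sup>2)
            + 2 * M\<^sup>2 * (norm (W x - grad (\<psi> (r k)) x))\<^sup>2)"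
        using i2[of "r k"] i3[of "r k"] by simp
      show "integrable ?M (\<lambda>x. (norm (deriv \<gamma> (w x) *\<^sub>R W x - deriv \<gamma> (\<psi> (r k) x) *\<^sub>R grad (\<psi> (r k)) x))\<^sup>2)"
        by (rule integrable_sq_bound[OF _ i4 bd]) measurable
    qed (rule bd)
    also have "\<dots> k = 2 * (LINT x|?M. (deriv \<gamma> (w x) - deriv \<gamma> (\<psi> (r k) x))\<^sup>2 * (norm (W x))\<^sup>2)
        + 2 * M\<^sup>2 * (LINT x|?M. (norm (W x - grad (\<psi> (r k)) x))\<^sup>2)" for k
      using i2[of "r k"] i3[of "r k"] by simp
    finally show "\<forall>\<^sub>F k in sequentially. (LINT x|?M. (norm (deriv \<gamma> (w x) *\<^sub>R W x - grad (\<lambda>x. \<gamma> (\<psi> (r k) x)) x))\<^sup>2)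
      \<le> 2 * (LINT x|?M. (deriv \<gamma> (w x) - deriv \<gamma> (\<psi> (r k) x))\<^sup>2 * (norm (W x))\<^sup>2)
        + 2 * M\<^sup>2 * (LINT x|?M. (norm (W x - grad (\<psi> (r k)) x))\<^sup>2)" by simp
  qed simp
  moreover have "(\<lambda>k. LINT x|?M. (\<gamma> (w x) - \<gamma> (\<psi> (r k) x))\<^sup>2) \<longlonglongrightarrow> 0"
    by (rule L2_compose_tendsto[OF \<gamma>(1) M _ _ _ lr1]) (use i1 in auto)
  moreover have "(\<lambda>x. \<gamma> (\<psi> (r k) x)) \<in> test_functions UNIV" for k
    by (rule test_functions_compose[OF \<gamma> \<psi>])
  ultimately have "H1_approx U (\<lambda>k x. \<gamma> (\<psi> (r k) x)) (\<lambda>x. \<gamma> (w x)) (\<lambda>x. deriv \<gamma> (w x) *\<^sub>R W x)"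
    using D Lp2_compose[OF \<gamma> M w] unfolding H1_approx_def by blast
  with r show thesis by (rule that)
qed

section \<open>Truncated solutions as admissible test functions\<close>

lemma open_cylinder: "open \<Omega> \<Longrightarrow> open (cylinder \<Omega>)"
  unfolding cylinder_def by (intro open_Times) auto

text \<open>Since \<open>\<gamma>\<close> is smooth with \<gamma>(0) = 0, the composites of the
  approximating functions are again test functions on \<Omega> times the real line, and restriction
  to height 0 commutes with \<open>\<gamma>\<close>. The bound \<open>M\<close> keeps the weighted
  energy finite.\<close>

lemma X0_compose:
  fixes \<gamma> :: "real \<Rightarrow> real"
  assumes \<Omega>: "open \<Omega>" and w: "w \<in> X0 \<alpha> \<Omega>" and u: "has_trace \<Omega> w u"
    and \<gamma>: "smooth \<gamma>" "\<gamma> 0 = 0" and M: "\<And>t. \<bar>deriv \<gamma> t\<bar> \<le> M"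
  shows "(\<lambda>z. \<gamma> (w z)) \<in> X0 \<alpha> \<Omega>" "has_trace \<Omega> (\<lambda>z. \<gamma> (w z)) (\<lambda>x. \<gamma> (u x))"
    "AE z in lebesgue_on (cylinder \<Omega>).
       weak_grad (cylinder \<Omega>) (\<lambda>z. \<gamma> (w z)) z = deriv \<gamma> (w z) *\<^sub>R weak_grad (cylinder \<Omega>) w z"
proof -
  let ?U = "cylinder \<Omega>" and ?M = "lebesgue_on (cylinder \<Omega>)"
  let ?v = "\<lambda>z. \<gamma> (w z)" and ?W = "weak_grad (cylinder \<Omega>) w"
  have U: "open ?U" by (rule open_cylinder[OF \<Omega>])
  have wH: "w \<in> H1 ?U" and wX: "integrable ?M (\<lambda>z. snd z powr (1 - \<alpha>) * (norm (?W z))\<^sup>2)"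
    using w by (auto simp: X0_def)
  \<comment> \<open>This sequence is taken from \<open>has_trace\<close>: its composites witness the
    trace and the lateral vanishing simultaneously, whereas a sequence from
    \<open>vanishes_laterally\<close> would carry no information about traces.\<close>
  obtain \<psi> where \<psi>: "\<And>k::nat. \<psi> k \<in> test_functions (\<Omega> \<times> UNIV)"
    and l: "(\<lambda>k. H1_norm ?U (\<lambda>z. w z - \<psi> k z)) \<longlonglongrightarrow> 0"
    and t: "(\<lambda>k. LINT x|lebesgue_on \<Omega>. (u x - \<psi> k (x, 0))\<^sup>2) \<longlonglongrightarrow> 0"
    and u2: "u \<in> Lp 2 \<Omega>"
    using u unfolding has_trace_def by blast
  have a: "H1_approx ?U \<psi> w ?W" by (rule H1_approxI[OF U wH \<psi> l])
  obtain r where r: "strict_mono r"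
    and ar: "H1_approx ?U (\<lambda>k z. \<gamma> (\<psi> (r k) z)) ?v (\<lambda>z. deriv \<gamma> (w z) *\<^sub>R ?W z)"
    by (rule H1_approx_compose[OF U a \<gamma> M])
  have v2: "?v \<in> Lp 2 ?U" and D2: "(\<lambda>z. deriv \<gamma> (w z) *\<^sub>R ?W z) \<in> Lp 2 ?U"
    using ar by (auto simp: H1_approx_def)
  note h = H1I[OF U v2 D2 H1_approx_weak_gradient[OF U ar]]
  show ae: "AE z in ?M. weak_grad ?U ?v z = deriv \<gamma> (w z) *\<^sub>R ?W z" by (rule h(2))
  have test: "(\<lambda>z. \<gamma> (\<psi> (r k) z)) \<in> test_functions (\<Omega> \<times> UNIV)" for k
    by (rule test_functions_compose[OF \<gamma> \<psi>])
  have lv: "(\<lambda>k. H1_norm ?U (\<lambda>z. ?v z - \<gamma> (\<psi> (r k) z))) \<longlonglongrightarrow> 0"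
    by (rule H1_approx_norm[OF U ar])
  have [measurable]: "?W \<in> borel_measurable ?M" "weak_grad ?U ?v \<in> borel_measurable ?M"
    using H1D(2)[OF wH] H1D(2)[OF h(1)] by (auto simp: Lp2_iff)
  have [measurable]: "snd \<in> borel_measurable ?M"
    by (rule continuous_borel_measurable_lebesgue_on) (intro continuous_intros)
  have iX: "integrable ?M (\<lambda>z. snd z powr (1 - \<alpha>) * (norm (weak_grad ?U ?v z))\<^sup>2)"
  proof (rule Bochner_Integration.integrable_bound)
    show "integrable ?M (\<lambda>z. M\<^sup>2 * (snd z powr (1 - \<alpha>) * (norm (?W z))\<^sup>2))" using wX by simp
    show "AE z in ?M. norm (snd z powr (1 - \<alpha>) * (norm (weak_grad ?U ?v z))\<^sup>2)
        \<le> norm (M\<^sup>2 * (snd z powr (1 - \<alpha>) * (norm (?W z))\<^sup>2))"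
      using ae
    proof eventually_elim
      fix z assume e: "weak_grad ?U ?v z = deriv \<gamma> (w z) *\<^sub>R ?W z"
      have "(norm (weak_grad ?U ?v z))\<^sup>2 \<le> M\<^sup>2 * (norm (?W z))\<^sup>2"
        using power_mono[OF M[of "w z"], of 2] by (simp add: e power_mult_distrib mult_right_mono)
      from mult_left_mono[OF this, of "snd z powr (1 - \<alpha>)"]
      show "norm (snd z powr (1 - \<alpha>) * (norm (weak_grad ?U ?v z))\<^sup>2)
        \<le> norm (M\<^sup>2 * (snd z powr (1 - \<alpha>) * (norm (?W z))\<^sup>2))"
        by (simp add: abs_mult mult.left_commute)
    qed
  qed measurable
  have "vanishes_laterally \<Omega> ?v"
    unfolding vanishes_laterally_def
    by (intro exI[of _ "\<lambda>k z. \<gamma> (\<psi> (r k) z)"] conjI allI test lv)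
  with h(1) iX show "?v \<in> X0 \<alpha> \<Omega>" by (simp add: X0_def)
  have c0: "continuous_on UNIV (\<lambda>x. \<psi> k (x, 0))" for k
  proof -
    have "smooth (\<psi> k)" by (rule test_functionsE[OF \<psi>[of k]]) blast
    from smooth_continuous[OF this, of UNIV] show ?thesis
      by (rule continuous_on_compose2) (auto intro!: continuous_intros)
  qed
  have t2: "(\<lambda>x. \<psi> k (x, 0)) \<in> Lp 2 \<Omega>" for k
  proof -
    obtain K where K: "compact K" "\<And>z. z \<notin> K \<Longrightarrow> \<psi> k z = 0"
      by (rule test_functionsE[OF \<psi>[of k]]) blast
    have "compact (fst ` K)" by (intro compact_continuous_image K continuous_intros)
    then show ?thesis
      by (rule compact_support_L2[OF _ c0 _ \<Omega>]) (use K(2) in force)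
  qed
  have tr: "(\<lambda>k. LINT x|lebesgue_on \<Omega>. (u x - \<psi> (r k) (x, 0))\<^sup>2) \<longlonglongrightarrow> 0"
    using LIMSEQ_subseq_LIMSEQ[OF t r] by (simp add: o_def)
  have "(\<lambda>k. LINT x|lebesgue_on \<Omega>. (\<gamma> (u x) - \<gamma> (\<psi> (r k) (x, 0)))\<^sup>2) \<longlonglongrightarrow> 0"
    by (rule L2_compose_tendsto[OF \<gamma>(1) M _ _ _ tr]) (use u2 t2 Lp2_diff[OF u2 t2] in \<open>auto simp: Lp2_iff\<close>)
  then show "has_trace \<Omega> ?v (\<lambda>x. \<gamma> (u x))"
    unfolding has_trace_def
    by (intro exI[of _ "\<lambda>k z. \<gamma> (\<psi> (r k) z)"] conjI allI test lv h(1) Lp2_compose[OF \<gamma> M u2])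
qed

subsection \<open>Translation estimate for traces\<close>

lemma ennreal_add_sq_le: "(a + b)\<^sup>2 \<le> 2 * a\<^sup>2 + 2 * (b::ennreal)\<^sup>2"
proof (cases a)
  case (real r)
  show ?thesis
  proof (cases b)
    case s: (real s)
    have "(a + b)\<^sup>2 = ennreal ((r + s)\<^sup>2)" using real s by (simp add: ennreal_power flip: ennreal_plus)
    also have "\<dots> \<le> ennreal (2 * r\<^sup>2 + 2 * s\<^sup>2)"
      using norm_add_sq_le[of r s] by (intro ennreal_leI) simp
    also have "\<dots> = 2 * a\<^sup>2 + 2 * b\<^sup>2"
      using real s by (simp add: ennreal_power ennreal_mult)
    finally show ?thesis .
  qed (simp add: power2_eq_square)
qed (simp add: power2_eq_square)

lemma nn_integral_translation:
  fixes f :: "'a::euclidean_space \<Rightarrow> ennreal"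
  assumes "f \<in> borel_measurable borel"
  shows "(\<integral>\<^sup>+x. f (x + a) \<partial>lborel) = (\<integral>\<^sup>+x. f x \<partial>lborel)"
proof -
  have "(\<integral>\<^sup>+x. f x \<partial>lborel) = (\<integral>\<^sup>+x. f x \<partial>distr lborel borel ((+) a))" by (simp add: lborel_distr_plus)
  also have "\<dots> = (\<integral>\<^sup>+x. f (a + x) \<partial>lborel)" using assms by (subst nn_integral_distr) auto
  finally show ?thesis by (simp add: add.commute)
qed

text \<open>At a fixed height the shear is a horizontal translation, so Tonelli's theorem reduces
  the claim to translation invariance.\<close>

lemma nn_integral_shear:
  fixes H :: "'a::euclidean_space \<times> real \<Rightarrow> ennreal"
  assumes H [measurable]: "H \<in> borel_measurable borel"
  shows "(\<integral>\<^sup>+x. \<integral>\<^sup>+y. H (x + y *\<^sub>R e, y) \<partial>lborel \<partial>lborel) = (\<integral>\<^sup>+p. H p \<partial>lborel)"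
proof -
  have m1: "(\<lambda>p. (fst p + snd p *\<^sub>R e, snd p)) \<in> borel_measurable borel"
    by (intro borel_measurable_continuous_onI continuous_intros)
  have m: "(\<lambda>p. H (fst p + snd p *\<^sub>R e, snd p)) \<in> borel_measurable (lborel \<Otimes>\<^sub>M lborel)"
    using measurable_compose[OF m1 H] by (simp add: lborel_prod)
  have H': "H \<in> borel_measurable (lborel \<Otimes>\<^sub>M lborel)" by (simp add: lborel_prod)
  have Hy: "(\<lambda>x. H (x, y)) \<in> borel_measurable borel" for y
    by (rule measurable_compose[OF _ H]) (intro borel_measurable_continuous_onI continuous_intros)
  have "(\<integral>\<^sup>+x. \<integral>\<^sup>+y. H (x + y *\<^sub>R e, y) \<partial>lborel \<partial>lborel) = (\<integral>\<^sup>+y. \<integral>\<^sup>+x. H (x + y *\<^sub>R e, y) \<partial>lborel \<partial>lborel)"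
    using lborel_pair.Fubini[OF m] by simp
  also have "\<dots> = (\<integral>\<^sup>+y. \<integral>\<^sup>+x. H (x, y) \<partial>lborel \<partial>lborel)"
    by (intro nn_integral_cong nn_integral_translation[of "\<lambda>x. H (x, _)"] Hy)
  also have "\<dots> = (\<integral>\<^sup>+p. H p \<partial>lborel)"
    using lborel_pair.nn_integral_snd[OF H'] by (simp add: lborel_prod)
  finally show ?thesis .
qed

text \<open>The integral over the segment from (x, 0) to (x + r e, r), parametrised by height rather
  than by arc length. With values in \<open>ennreal\<close> it is defined for every
  \<open>x\<close>, even where it is infinite.\<close>

definition slanted :: "real \<Rightarrow> 'a::euclidean_space \<Rightarrow> ('a \<times> real \<Rightarrow> real) \<Rightarrow> 'a \<Rightarrow> ennreal" where
  "slanted r e g x = (\<integral>\<^sup>+y. indicator {0<..<r} y * ennreal (g (x + y *\<^sub>R e, y)) \<partial>lborel)"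

lemma measurable_slanted_line:
  fixes g :: "'a::euclidean_space \<times> real \<Rightarrow> real"
  assumes g: "g \<in> borel_measurable borel"
  shows "(\<lambda>y. g (x + y *\<^sub>R e, y)) \<in> borel_measurable borel"
  by (rule measurable_compose[OF _ g]) (intro borel_measurable_continuous_onI continuous_intros)

lemma measurable_slanted:
  fixes g :: "'a::euclidean_space \<times> real \<Rightarrow> real"
  assumes g: "g \<in> borel_measurable borel"
  shows "slanted r e g \<in> borel_measurable borel"
proof -
  have m1: "(\<lambda>p. (fst p + snd p *\<^sub>R e, snd p)) \<in> borel_measurable borel"
    by (intro borel_measurable_continuous_onI continuous_intros)
  have 1: "(\<lambda>p. g (fst p + snd p *\<^sub>R e, snd p)) \<in> borel_measurable (borel \<Otimes>\<^sub>M lborel)"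
  proof -
    have "sets (borel \<Otimes>\<^sub>M (lborel :: real measure)) = sets (borel :: ('a \<times> real) measure)"
      unfolding borel_prod[symmetric] by (intro sets_pair_measure_cong) auto
    then show ?thesis using measurable_compose[OF m1 g] by (simp cong: measurable_cong_sets)
  qed
  have "(\<lambda>p. indicator {0<..<r} (snd p) * ennreal (g (fst p + snd p *\<^sub>R e, snd p))) \<in> borel_measurable (borel \<Otimes>\<^sub>M lborel)"
    using 1 by measurable
  from lborel.borel_measurable_nn_integral_fst[OF this]
  show ?thesis by (simp add: slanted_def[abs_def])
qed

lemma slanted_add:
  fixes g h :: "'a::euclidean_space \<times> real \<Rightarrow> real"
  assumes "g \<in> borel_measurable borel" "h \<in> borel_measurable borel" "\<And>p. 0 \<le> g p" "\<And>p. 0 \<le> h p"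
  shows "slanted r e (\<lambda>p. g p + h p) x = slanted r e g x + slanted r e h x"
proof -
  note [measurable] = measurable_slanted_line[OF assms(1), of x e] measurable_slanted_line[OF assms(2), of x e]
  show ?thesis unfolding slanted_def
    by (subst nn_integral_add[symmetric]) (auto simp: assms distrib_left ennreal_plus)
qed

lemma slanted_mono: "(\<And>p. g p \<le> h p) \<Longrightarrow> slanted r e g x \<le> slanted r e h x"
  unfolding slanted_def by (intro nn_integral_mono mult_left_mono ennreal_leI) auto

text \<open>Cauchy--Schwarz with the weights \<open>y powr (a - 1)\<close> and \<open>y powr (1 - a)\<close>, the former being
  integrable at \<open>0\<close>.\<close>

lemma slanted_L2:
  fixes g :: "'a::euclidean_space \<times> real \<Rightarrow> real"
  assumes g [measurable]: "g \<in> borel_measurable borel" and g0: "\<And>p. 0 \<le> g p" and a: "0 < a" and r: "0 < r"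
  shows "(\<integral>\<^sup>+x. (slanted r e g x)\<^sup>2 \<partial>lborel)
    \<le> ennreal (r powr a / a) * (\<integral>\<^sup>+p. indicator {0<..<r} (snd p) * ennreal (snd p powr (1 - a) * (g p)\<^sup>2) \<partial>lborel)"
proof -
  define H :: "'a \<times> real \<Rightarrow> ennreal"
    where "H p = indicator {0<..<r} (snd p) * ennreal (snd p powr (1 - a) * (g p)\<^sup>2)" for p
  have [measurable]: "(snd :: 'a \<times> real \<Rightarrow> real) \<in> borel_measurable borel"
    by (intro borel_measurable_continuous_onI continuous_intros)
  have H [measurable]: "H \<in> borel_measurable borel" unfolding H_def by measurable
  have b: "(slanted r e g x)\<^sup>2 \<le> ennreal (r powr a / a) * (\<integral>\<^sup>+y. H (x + y *\<^sub>R e, y) \<partial>lborel)" for x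
  proof -
    define p q :: "real \<Rightarrow> ennreal"
      where "p y = indicator {0<..<r} y * ennreal (y powr ((a - 1) / 2))"
        and "q y = indicator {0<..<r} y * ennreal (y powr ((1 - a) / 2) * g (x + y *\<^sub>R e, y))" for y
    note [measurable] = measurable_slanted_line[OF g, of x e]
    have pq: "indicator {0<..<r} y * ennreal (g (x + y *\<^sub>R e, y)) = p y * q y" for y
    proof (cases "y \<in> {0<..<r}")
      case True
      then have "y powr ((a - 1) / 2) * y powr ((1 - a) / 2) = 1"
        by (simp add: diff_divide_distrib flip: powr_add)
      then have "y powr ((a - 1) / 2) * (y powr ((1 - a) / 2) * g (x + y *\<^sub>R e, y)) = g (x + y *\<^sub>R e, y)"
        by (simp add: mult.assoc[symmetric])
      then show ?thesis using True g0 by (simp add: p_def q_def flip: ennreal_mult)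
    qed (simp add: p_def q_def)
    have p2: "(p y)\<^sup>2 = ennreal (y powr (a - 1)) * indicator {0<..<r} y" for y
      by (cases "y \<in> {0<..<r}") (auto simp: p_def ennreal_power power2_eq_square simp flip: powr_add ennreal_mult)
    have q2: "(q y)\<^sup>2 = H (x + y *\<^sub>R e, y)" for y
    proof (cases "y \<in> {0<..<r}")
      case True
      have "(y powr ((1 - a) / 2))\<^sup>2 = y powr (1 - a)" by (simp add: power2_eq_square flip: powr_add)
      then show ?thesis using True g0 by (simp add: q_def H_def ennreal_power power_mult_distrib)
    qed (simp add: q_def H_def)
    have "(\<integral>\<^sup>+y. ennreal (y powr (a - 1)) * indicator {0<..<r} y \<partial>lborel)
        \<le> (\<integral>\<^sup>+y. ennreal (y powr (a - 1)) * indicator {0..r} y \<partial>lborel)"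
      by (intro nn_integral_mono) (auto simp: indicator_def)
    also have "\<dots> = ennreal (r powr (a - 1 + 1) / (a - 1 + 1))"
      by (rule nn_integral_has_integral_lebesgue'[OF _ has_integral_powr_from_0]) (use a r in auto)
    finally have P: "(\<integral>\<^sup>+y. (p y)\<^sup>2 \<partial>lborel) \<le> ennreal (r powr a / a)" by (simp add: p2)
    have "(slanted r e g x)\<^sup>2 = (\<integral>\<^sup>+y. p y * q y \<partial>lborel)\<^sup>2" by (simp add: slanted_def pq)
    also have "\<dots> \<le> (\<integral>\<^sup>+y. (p y)\<^sup>2 \<partial>lborel) * (\<integral>\<^sup>+y. (q y)\<^sup>2 \<partial>lborel)"
      by (rule Cauchy_Schwarz_nn_integral) (unfold p_def q_def, measurable)
    also have "\<dots> \<le> ennreal (r powr a / a) * (\<integral>\<^sup>+y. H (x + y *\<^sub>R e, y) \<partial>lborel)"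
      unfolding q2 by (rule mult_right_mono[OF P]) simp
    finally show ?thesis .
  qed
  have m1: "(\<lambda>p. (fst p + snd p *\<^sub>R e, snd p)) \<in> borel_measurable borel"
    by (intro borel_measurable_continuous_onI continuous_intros)
  have m: "(\<lambda>x. \<integral>\<^sup>+y. H (x + y *\<^sub>R e, y) \<partial>lborel) \<in> borel_measurable lborel"
  proof -
    have "(\<lambda>p. H (fst p + snd p *\<^sub>R e, snd p)) \<in> borel_measurable (lborel \<Otimes>\<^sub>M lborel)"
      using measurable_compose[OF m1 H] by (simp add: lborel_prod)
    from lborel.borel_measurable_nn_integral_fst[OF this] show ?thesis by simp
  qed
  have "(\<integral>\<^sup>+x. (slanted r e g x)\<^sup>2 \<partial>lborel)
      \<le> (\<integral>\<^sup>+x. ennreal (r powr a / a) * (\<integral>\<^sup>+y. H (x + y *\<^sub>R e, y) \<partial>lborel) \<partial>lborel)"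
    by (intro nn_integral_mono b)
  also have "\<dots> = ennreal (r powr a / a) * (\<integral>\<^sup>+p. H p \<partial>lborel)"
    by (simp add: nn_integral_cmult[OF m] nn_integral_shear[OF H])
  finally show ?thesis unfolding H_def .
qed

text \<open>The fundamental theorem of calculus along the segment. Its direction (e, 1) has norm at
  most 2, which is the factor on the right.\<close>

lemma slanted_difference:
  fixes \<psi> :: "'a::euclidean_space \<times> real \<Rightarrow> real"
  assumes \<psi>: "smooth \<psi>" and r: "0 < r" and e: "norm e \<le> 1"
  shows "ennreal \<bar>\<psi> (x, 0) - \<psi> (x + r *\<^sub>R e, r)\<bar> \<le> 2 * slanted r e (\<lambda>p. norm (grad \<psi> p)) x"
proof -
  have d: "((\<lambda>y. \<psi> (x + y *\<^sub>R e, y)) has_real_derivative grad \<psi> (x + y *\<^sub>R e, y) \<bullet> (e, 1)) (at y)" for y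
    using smooth_line_has_derivative[OF \<psi>, of "(x, 0)" "(e, 1)" y] by simp
  have c: "isCont (\<lambda>y. grad \<psi> (x + y *\<^sub>R e, y) \<bullet> (e, 1)) y" for y
  proof -
    have "continuous_on UNIV (\<lambda>y. grad \<psi> (x + y *\<^sub>R e, y))"
      by (rule continuous_on_compose2[OF smooth_continuous_grad[OF \<psi>, of UNIV]]) (auto intro!: continuous_intros)
    then have "continuous_on UNIV (\<lambda>y. grad \<psi> (x + y *\<^sub>R e, y) \<bullet> (e, 1))" by (intro continuous_intros)
    then show ?thesis by (simp add: continuous_on_eq_continuous_at)
  qed
  have "has_bochner_integral lborel (\<lambda>y. (grad \<psi> (x + y *\<^sub>R e, y) \<bullet> (e, 1)) * indicator {0..r} y)
      (\<psi> (x + r *\<^sub>R e, r) - \<psi> (x + 0 *\<^sub>R e, 0))"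
    by (rule has_bochner_integral_FTC_Icc_real) (use r d c in auto)
  from has_bochner_integral_norm_bound[OF this]
  have "ennreal (norm (\<psi> (x + r *\<^sub>R e, r) - \<psi> (x + 0 *\<^sub>R e, 0)))
      \<le> (\<integral>\<^sup>+y. ennreal (norm ((grad \<psi> (x + y *\<^sub>R e, y) \<bullet> (e, 1)) * indicator {0..r} y)) \<partial>lborel)" .
  also have "\<dots> \<le> (\<integral>\<^sup>+y. 2 * (indicator {0<..<r} y * ennreal (norm (grad \<psi> (x + y *\<^sub>R e, y)))) \<partial>lborel)"
  proof (rule nn_integral_mono_AE)
    have n: "norm (e, 1::real) \<le> 2"
      using norm_Pair_le[of e "1::real"] e by simp
    have ip: "\<bar>g \<bullet> (e, 1)\<bar> \<le> 2 * norm g" for g :: "'a \<times> real"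
      using Cauchy_Schwarz_ineq2[of g "(e, 1)"] mult_left_mono[OF n, of "norm g"] by (simp add: mult.commute)
    \<comment> \<open>The fundamental theorem uses the closed interval and \<open>slanted\<close>
      the open one; the two endpoints form a null set.\<close>
    show "AE y in lborel. ennreal (norm ((grad \<psi> (x + y *\<^sub>R e, y) \<bullet> (e, 1)) * indicator {0..r} y))
        \<le> 2 * (indicator {0<..<r} y * ennreal (norm (grad \<psi> (x + y *\<^sub>R e, y))))"
      using AE_lborel_singleton[of 0] AE_lborel_singleton[of r]
    proof eventually_elim
      fix y assume y: "y \<noteq> 0" "y \<noteq> r"
      show "ennreal (norm ((grad \<psi> (x + y *\<^sub>R e, y) \<bullet> (e, 1)) * indicator {0..r} y))
        \<le> 2 * (indicator {0<..<r} y * ennreal (norm (grad \<psi> (x + y *\<^sub>R e, y))))"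
      proof (cases "y \<in> {0<..<r}")
        case True
        have "ennreal \<bar>grad \<psi> (x + y *\<^sub>R e, y) \<bullet> (e, 1)\<bar> \<le> ennreal (2 * norm (grad \<psi> (x + y *\<^sub>R e, y)))"
          by (intro ennreal_leI ip)
        then show ?thesis using True by (simp add: ennreal_mult)
      qed (use y in auto)
    qed
  qed
  also have "\<dots> = 2 * slanted r e (\<lambda>p. norm (grad \<psi> p)) x"
  proof -
    have "(\<lambda>p. norm (grad \<psi> p)) \<in> borel_measurable borel"
      by (intro borel_measurable_continuous_onI continuous_intros smooth_continuous_grad \<psi>)
    note [measurable] = measurable_slanted_line[OF this, of x e]
    show ?thesis unfolding slanted_def by (subst nn_integral_cmult[symmetric]) auto
  qed
  finally show ?thesis by (simp add: abs_minus_commute)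
qed

lemma lebesgue_nonneg_ex_borel:
  fixes f :: "'a::euclidean_space \<Rightarrow> real"
  assumes "f \<in> borel_measurable lebesgue" "\<And>x. 0 \<le> f x"
  obtains g where "g \<in> borel_measurable borel" "\<And>x. 0 \<le> g x" "AE x in lborel. f x = g x"
proof -
  obtain g where g: "g \<in> borel_measurable lborel" "AE x in lborel. f x = g x"
    using completion_ex_borel_measurable_real[OF assms(1)] by blast
  show ?thesis
  proof (rule that[of "\<lambda>x. \<bar>g x\<bar>"])
    show "AE x in lborel. f x = \<bar>g x\<bar>" using g(2) by eventually_elim (metis assms(2) abs_of_nonneg)
  qed (use g(1) in auto)
qed

lemma slanted_split:
  fixes \<psi> :: "'a::euclidean_space \<times> real \<Rightarrow> real"
  assumes \<psi>: "smooth \<psi>" and r: "0 < r" and e: "norm e \<le> 1"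
    and g: "g \<in> borel_measurable borel" "\<And>p. 0 \<le> g p"
    and d: "d \<in> borel_measurable borel" "\<And>p. 0 \<le> d p"
    and gd: "\<And>p. norm (grad \<psi> p) \<le> g p + d p"
  shows "ennreal \<bar>\<psi> (x, 0) - \<psi> (x + r *\<^sub>R e, r)\<bar> \<le> 2 * slanted r e g x + 2 * slanted r e d x"
proof -
  have "ennreal \<bar>\<psi> (x, 0) - \<psi> (x + r *\<^sub>R e, r)\<bar> \<le> 2 * slanted r e (\<lambda>p. norm (grad \<psi> p)) x"
    by (rule slanted_difference[OF \<psi> r e])
  also have "\<dots> \<le> 2 * slanted r e (\<lambda>p. g p + d p) x"
    by (intro mult_left_mono slanted_mono gd) simp
  also have "\<dots> = 2 * slanted r e g x + 2 * slanted r e d x"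
    by (simp add: slanted_add[OF g(1) d(1) g(2) d(2)] distrib_left)
  finally show ?thesis .
qed

text \<open>The values at \<open>(x, 0)\<close> and \<open>(x + z, 0)\<close> are both compared with the value at \<open>(x + z / 2, norm z)\<close>
  along the connecting segments. The part \<open>d\<close> of the gradient, which tends to \<open>0\<close> in the application,
  is measured without weight because the approximation in \<open>H\<^sup>1\<close> is unweighted.\<close>

lemma translation_estimate_smooth:
  fixes \<psi> :: "'a::euclidean_space \<times> real \<Rightarrow> real"
  assumes \<psi>: "smooth \<psi>" and \<alpha>: "0 < \<alpha>"
    and v [measurable]: "v \<in> borel_measurable borel"
    and g: "g \<in> borel_measurable borel" "\<And>p. 0 \<le> g p"
    and d: "d \<in> borel_measurable borel" "\<And>p. 0 \<le> d p"
    and gd: "\<And>p. norm (grad \<psi> p) \<le> g p + d p" and z: "z \<noteq> 0"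
  defines "r \<equiv> norm z"
  shows "(\<integral>\<^sup>+x. ennreal ((v (x + z) - v x)\<^sup>2) \<partial>lborel)
    \<le> 8 * (\<integral>\<^sup>+x. ennreal ((v x - \<psi> (x, 0))\<^sup>2) \<partial>lborel)
      + 64 * (ennreal (r powr \<alpha> / \<alpha>)
          * (\<integral>\<^sup>+p. indicator {0<..<r} (snd p) * ennreal (snd p powr (1 - \<alpha>) * (g p)\<^sup>2) \<partial>lborel))
      + 64 * (ennreal r * (\<integral>\<^sup>+p. indicator {0<..<r} (snd p) * ennreal ((d p)\<^sup>2) \<partial>lborel))"
proof -
  \<comment> \<open>This choice makes r e = z/2, so the segment from (x, 0) in direction
    \<open>e\<close> and the one from (x + z, 0) in direction \<open>- e\<close> end at the same
    point of height \<open>r\<close>.\<close>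
  define e where "e = (1 / (2 * r)) *\<^sub>R z"
  have r: "0 < r" using z by (simp add: r_def)
  have re: "r *\<^sub>R e = (1 / 2) *\<^sub>R z" and ne: "norm e \<le> 1" "norm (- e) \<le> 1"
    using r by (auto simp: e_def r_def)
  have \<psi>0: "continuous_on UNIV (\<lambda>x. \<psi> (x, 0))"
    by (rule continuous_on_compose2[OF smooth_continuous[OF \<psi>, of UNIV]]) (auto intro!: continuous_intros)
  then have [measurable]: "(\<lambda>x. \<psi> (x, 0)) \<in> borel_measurable borel" by (rule borel_measurable_continuous_onI)
  define \<delta> where "\<delta> x = ennreal \<bar>v x - \<psi> (x, 0)\<bar>" for x
  have [measurable]: "\<delta> \<in> borel_measurable borel" unfolding \<delta>_def by measurable
  define S1 S2 T1 T2 where "S1 = slanted r e g" and "S2 = slanted r (- e) g"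
    and "T1 = slanted r e d" and "T2 = slanted r (- e) d"
  have [measurable]: "S1 \<in> borel_measurable borel" "S2 \<in> borel_measurable borel"
    "T1 \<in> borel_measurable borel" "T2 \<in> borel_measurable borel"
    unfolding S1_def S2_def T1_def T2_def by (intro measurable_slanted g d)+
  \<comment> \<open>The constants come from repeated use of (a + b)^2 \<le> 2 a^2 + 2 b^2 and from
    the squared factor 2 of \<open>slanted_split\<close>. After integration, translation invariance
    pairs the terms, turning 4 into 8 and 32 into 64.\<close>
  have pw: "ennreal ((v (x + z) - v x)\<^sup>2)
      \<le> 4 * (\<delta> (x + z))\<^sup>2 + 4 * (\<delta> x)\<^sup>2
        + (32 * (S1 x)\<^sup>2 + 32 * (S2 (x + z))\<^sup>2 + 32 * (T1 x)\<^sup>2 + 32 * (T2 (x + z))\<^sup>2)" for x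
  proof -
    have mid: "x + z + r *\<^sub>R (- e) = x + r *\<^sub>R e"
    proof -
      have "z = r *\<^sub>R e + r *\<^sub>R e" unfolding re by (simp flip: scaleR_add_left)
      then show ?thesis by (simp add: algebra_simps)
    qed
    define m where "m = \<psi> (x + r *\<^sub>R e, r)"
    have 1: "ennreal \<bar>\<psi> (x, 0) - m\<bar> \<le> 2 * S1 x + 2 * T1 x"
      unfolding m_def S1_def T1_def by (rule slanted_split[OF \<psi> r ne(1) g d gd])
    have 2: "ennreal \<bar>\<psi> (x + z, 0) - m\<bar> \<le> 2 * S2 (x + z) + 2 * T2 (x + z)"
      unfolding m_def S2_def T2_def mid[symmetric] by (rule slanted_split[OF \<psi> r ne(2) g d gd])
    have "\<bar>v (x + z) - v x\<bar> \<le> (\<bar>v (x + z) - \<psi> (x + z, 0)\<bar> + \<bar>v x - \<psi> (x, 0)\<bar>)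
        + (\<bar>\<psi> (x, 0) - m\<bar> + \<bar>\<psi> (x + z, 0) - m\<bar>)" by linarith
    then have "ennreal \<bar>v (x + z) - v x\<bar> \<le> ennreal ((\<bar>v (x + z) - \<psi> (x + z, 0)\<bar> + \<bar>v x - \<psi> (x, 0)\<bar>)
        + (\<bar>\<psi> (x, 0) - m\<bar> + \<bar>\<psi> (x + z, 0) - m\<bar>))" by (rule ennreal_leI)
    also have "\<dots> = (\<delta> (x + z) + \<delta> x) + (ennreal \<bar>\<psi> (x, 0) - m\<bar> + ennreal \<bar>\<psi> (x + z, 0) - m\<bar>)"
      by (simp add: \<delta>_def)
    also have "\<dots> \<le> (\<delta> (x + z) + \<delta> x) + ((2 * S1 x + 2 * T1 x) + (2 * S2 (x + z) + 2 * T2 (x + z)))"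
      by (intro add_left_mono add_mono 1 2)
    also have "\<dots> = (\<delta> (x + z) + \<delta> x) + 2 * ((S1 x + S2 (x + z)) + (T1 x + T2 (x + z)))"
      by (simp add: distrib_left ac_simps)
    finally have "(ennreal \<bar>v (x + z) - v x\<bar>)\<^sup>2
      \<le> ((\<delta> (x + z) + \<delta> x) + 2 * ((S1 x + S2 (x + z)) + (T1 x + T2 (x + z))))\<^sup>2"
      by (intro power_mono) auto
    also have "\<dots> \<le> 2 * (\<delta> (x + z) + \<delta> x)\<^sup>2 + 2 * (2 * ((S1 x + S2 (x + z)) + (T1 x + T2 (x + z))))\<^sup>2"
      by (rule ennreal_add_sq_le)
    also have "\<dots> = 2 * (\<delta> (x + z) + \<delta> x)\<^sup>2 + 8 * ((S1 x + S2 (x + z)) + (T1 x + T2 (x + z)))\<^sup>2"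
    proof -
      have "2 * (2 * X)\<^sup>2 = 8 * X\<^sup>2" for X :: ennreal
        by (simp add: power_mult_distrib mult.assoc[symmetric])
      then show ?thesis by (simp only:)
    qed
    also have "\<dots> \<le> 2 * (2 * (\<delta> (x + z))\<^sup>2 + 2 * (\<delta> x)\<^sup>2)
        + 8 * (2 * (2 * (S1 x)\<^sup>2 + 2 * (S2 (x + z))\<^sup>2) + 2 * (2 * (T1 x)\<^sup>2 + 2 * (T2 (x + z))\<^sup>2))"
      by (intro add_mono mult_left_mono ennreal_add_sq_le order_trans[OF ennreal_add_sq_le]) auto
    also have "\<dots> = 4 * (\<delta> (x + z))\<^sup>2 + 4 * (\<delta> x)\<^sup>2
        + (32 * (S1 x)\<^sup>2 + 32 * (S2 (x + z))\<^sup>2 + 32 * (T1 x)\<^sup>2 + 32 * (T2 (x + z))\<^sup>2)"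
      by (simp add: distrib_left mult.assoc[symmetric] add.assoc)
    finally show ?thesis by (simp add: ennreal_power)
  qed
  have tr: "(\<integral>\<^sup>+x. (f (x + z))\<^sup>2 \<partial>lborel) = (\<integral>\<^sup>+x. (f x)\<^sup>2 \<partial>lborel)"
    if [measurable]: "f \<in> borel_measurable borel" for f :: "'a \<Rightarrow> ennreal"
    by (rule nn_integral_translation[of "\<lambda>x. (f x)\<^sup>2"]) measurable
  have L: "(\<integral>\<^sup>+x. (slanted r e' g x)\<^sup>2 \<partial>lborel)
      \<le> ennreal (r powr \<alpha> / \<alpha>) * (\<integral>\<^sup>+p. indicator {0<..<r} (snd p) * ennreal (snd p powr (1 - \<alpha>) * (g p)\<^sup>2) \<partial>lborel)" for e'
    by (rule slanted_L2[OF g \<alpha> r])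
  \<comment> \<open>The unweighted bound is the case a = 1 of \<open>slanted_L2\<close>: the weight
    is y^0 = 1 for y > 0, and r^1/1 = r.\<close>
  have M: "(\<integral>\<^sup>+x. (slanted r e' d x)\<^sup>2 \<partial>lborel)
      \<le> ennreal r * (\<integral>\<^sup>+p. indicator {0<..<r} (snd p) * ennreal ((d p)\<^sup>2) \<partial>lborel)" for e'
  proof -
    have "(\<integral>\<^sup>+x. (slanted r e' d x)\<^sup>2 \<partial>lborel)
      \<le> ennreal (r powr 1 / 1) * (\<integral>\<^sup>+p. indicator {0<..<r} (snd p) * ennreal (snd p powr (1 - 1) * (d p)\<^sup>2) \<partial>lborel)"
      by (rule slanted_L2[OF d _ r]) simp
    also have "\<dots> = ennreal r * (\<integral>\<^sup>+p. indicator {0<..<r} (snd p) * ennreal ((d p)\<^sup>2) \<partial>lborel)"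
    proof -
      have "indicator {0<..<r} (snd p) * ennreal (snd p powr (1 - 1) * (d p)\<^sup>2)
          = indicator {0<..<r} (snd p) * ennreal ((d p)\<^sup>2)" for p
        by (cases "snd p \<in> {0<..<r}") auto
      then show ?thesis using r by (simp only:) simp
    qed
    finally show ?thesis .
  qed
  have "(\<integral>\<^sup>+x. ennreal ((v (x + z) - v x)\<^sup>2) \<partial>lborel)
      \<le> (\<integral>\<^sup>+x. 4 * (\<delta> (x + z))\<^sup>2 + 4 * (\<delta> x)\<^sup>2
        + (32 * (S1 x)\<^sup>2 + 32 * (S2 (x + z))\<^sup>2 + 32 * (T1 x)\<^sup>2 + 32 * (T2 (x + z))\<^sup>2) \<partial>lborel)"
    by (intro nn_integral_mono pw)
  also have "\<dots> = 4 * (\<integral>\<^sup>+x. (\<delta> (x + z))\<^sup>2 \<partial>lborel) + 4 * (\<integral>\<^sup>+x. (\<delta> x)\<^sup>2 \<partial>lborel)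
        + (32 * (\<integral>\<^sup>+x. (S1 x)\<^sup>2 \<partial>lborel) + 32 * (\<integral>\<^sup>+x. (S2 (x + z))\<^sup>2 \<partial>lborel)
          + 32 * (\<integral>\<^sup>+x. (T1 x)\<^sup>2 \<partial>lborel) + 32 * (\<integral>\<^sup>+x. (T2 (x + z))\<^sup>2 \<partial>lborel))"
    by (simp add: nn_integral_add nn_integral_cmult)
  also have "\<dots> = 8 * (\<integral>\<^sup>+x. (\<delta> x)\<^sup>2 \<partial>lborel)
        + (32 * (\<integral>\<^sup>+x. (S1 x)\<^sup>2 \<partial>lborel) + 32 * (\<integral>\<^sup>+x. (S2 x)\<^sup>2 \<partial>lborel))
          + (32 * (\<integral>\<^sup>+x. (T1 x)\<^sup>2 \<partial>lborel) + 32 * (\<integral>\<^sup>+x. (T2 x)\<^sup>2 \<partial>lborel))"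
    by (simp add: tr add.assoc flip: distrib_right)
  also have "\<dots> \<le> 8 * (\<integral>\<^sup>+x. (\<delta> x)\<^sup>2 \<partial>lborel)
      + (32 * (ennreal (r powr \<alpha> / \<alpha>) * (\<integral>\<^sup>+p. indicator {0<..<r} (snd p) * ennreal (snd p powr (1 - \<alpha>) * (g p)\<^sup>2) \<partial>lborel))
       + 32 * (ennreal (r powr \<alpha> / \<alpha>) * (\<integral>\<^sup>+p. indicator {0<..<r} (snd p) * ennreal (snd p powr (1 - \<alpha>) * (g p)\<^sup>2) \<partial>lborel)))
      + (32 * (ennreal r * (\<integral>\<^sup>+p. indicator {0<..<r} (snd p) * ennreal ((d p)\<^sup>2) \<partial>lborel))
       + 32 * (ennreal r * (\<integral>\<^sup>+p. indicator {0<..<r} (snd p) * ennreal ((d p)\<^sup>2) \<partial>lborel)))"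
    unfolding S1_def S2_def T1_def T2_def by (intro add_mono mult_left_mono L M order_refl) auto
  also have "\<dots> = 8 * (\<integral>\<^sup>+x. (\<delta> x)\<^sup>2 \<partial>lborel)
      + 64 * (ennreal (r powr \<alpha> / \<alpha>) * (\<integral>\<^sup>+p. indicator {0<..<r} (snd p) * ennreal (snd p powr (1 - \<alpha>) * (g p)\<^sup>2) \<partial>lborel))
      + 64 * (ennreal r * (\<integral>\<^sup>+p. indicator {0<..<r} (snd p) * ennreal ((d p)\<^sup>2) \<partial>lborel))"
    by (simp flip: distrib_right)
  finally show ?thesis by (simp add: \<delta>_def ennreal_power)
qed

section \<open>From smooth functions to traces of functions with finite energy\<close>

lemma nn_integral_lebesgue_on:
  fixes f :: "'a::euclidean_space \<Rightarrow> ennreal"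
  assumes "U \<in> sets lebesgue"
  shows "(\<integral>\<^sup>+x. f x \<partial>lebesgue_on U) = (\<integral>\<^sup>+x. indicator U x * f x \<partial>lborel)"
  using assms by (simp add: nn_integral_restrict_space nn_integral_completion mult.commute)

lemma AE_lebesgue_on_iff:
  assumes "U \<in> sets lebesgue"
  shows "(AE x in lebesgue_on U. P x) \<longleftrightarrow> (AE x in lborel. x \<in> U \<longrightarrow> P x)"
  using assms by (simp add: AE_restrict_space_iff AE_completion_iff)

definition energy :: "real \<Rightarrow> 'a::euclidean_space set \<Rightarrow> ('a \<times> real \<Rightarrow> real) \<Rightarrow> ennreal" where
  "energy \<alpha> \<Omega> w = (\<integral>\<^sup>+z. ennreal (snd z powr (1 - \<alpha>) * (norm (weak_grad (cylinder \<Omega>) w z))\<^sup>2)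
     \<partial>lebesgue_on (cylinder \<Omega>))"

text \<open>The smooth estimate is applied to the functions that define the trace, with a common
  main part \<open>g\<close> of their gradients, and the error terms vanish in the limit.
  \<open>v\<close> is a Borel version of the trace extended by zero, so translates leaving \<Omega>
  cause no difficulty.\<close>

lemma translation_estimate:
  assumes \<Omega>: "open \<Omega>" and \<alpha>: "0 < \<alpha>" and tr: "has_trace \<Omega> w u"
    and v [measurable]: "v \<in> borel_measurable borel"
    and vu: "AE x in lebesgue_on \<Omega>. v x = u x" and v0: "\<And>x. x \<notin> \<Omega> \<Longrightarrow> v x = 0"
  shows "(\<integral>\<^sup>+x. ennreal ((v (x + z) - v x)\<^sup>2) \<partial>lborel) \<le> 64 * (ennreal (norm z powr \<alpha> / \<alpha>) * energy \<alpha> \<Omega> w)"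
proof (cases "z = 0")
  case True
  then show ?thesis by simp
next
  case False
  let ?U = "cylinder \<Omega>" and ?W = "weak_grad (cylinder \<Omega>) w"
  define r where "r = norm z"
  have U: "open ?U" and Us: "?U \<in> sets lebesgue" and \<Omega>s: "\<Omega> \<in> sets lebesgue"
    using open_cylinder[OF \<Omega>] \<Omega> by auto
  have wH: "w \<in> H1 ?U" and u2: "u \<in> Lp 2 \<Omega>" using tr by (auto simp: has_trace_def)
  obtain \<psi> where \<psi>: "\<And>k::nat. \<psi> k \<in> test_functions (\<Omega> \<times> UNIV)"
    and l: "(\<lambda>k. H1_norm ?U (\<lambda>z. w z - \<psi> k z)) \<longlonglongrightarrow> 0"
    and t: "(\<lambda>k. LINT x|lebesgue_on \<Omega>. (u x - \<psi> k (x, 0))\<^sup>2) \<longlonglongrightarrow> 0"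
    using tr unfolding has_trace_def by blast
  have a: "H1_approx ?U \<psi> w ?W" by (rule H1_approxI[OF U wH \<psi> l])
  have W2: "?W \<in> Lp 2 ?U" by (rule H1D(2)[OF wH])
  have sm: "smooth (\<psi> k)" for k by (rule test_functionsE[OF \<psi>[of k]]) blast
  define n where "n p = norm (indicator ?U p *\<^sub>R ?W p)" for p
  have "n \<in> borel_measurable lebesgue"
  proof -
    have [measurable]: "(\<lambda>p. indicator ?U p *\<^sub>R ?W p) \<in> borel_measurable lebesgue"
      using W2 Us by (simp add: Lp2_iff borel_measurable_restrict_space_iff)
    show ?thesis unfolding n_def by measurable
  qed
  \<comment> \<open>Integration along individual segments needs a Borel function, whereas the norm
    of a weak gradient is only Lebesgue measurable.\<close>
  then obtain g where g: "g \<in> borel_measurable borel" "\<And>p. 0 \<le> g p" and ng: "AE p in lborel. n p = g p"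
    by (rule lebesgue_nonneg_ex_borel) (auto simp: n_def)
  \<comment> \<open>The excess over \<open>g\<close>, so that the gradient of
    \<open>\<psi> k\<close> is dominated by \<open>g\<close> plus \<open>d k\<close> at every point:
    a bound holding only almost everywhere would be useless on a single segment. On the cylinder the
    excess is at most the gradient error almost everywhere.\<close>
  define d where "d k p = max 0 (norm (grad (\<psi> k) p) - g p)" for k p
  have gm [measurable]: "grad (\<psi> k) \<in> borel_measurable borel" for k
    by (intro borel_measurable_continuous_onI smooth_continuous_grad sm)
  have d: "d k \<in> borel_measurable borel" "0 \<le> d k p" "norm (grad (\<psi> k) p) \<le> g p + d k p" for k p
    using g(1) unfolding d_def by auto
  have grad0: "grad (\<psi> k) p = 0" if "fst p \<notin> \<Omega>" for k p
  proof -
    obtain K where "K \<subseteq> \<Omega> \<times> UNIV" "\<And>z. z \<notin> K \<Longrightarrow> grad (\<psi> k) z = 0"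
      by (rule test_functionsE[OF \<psi>[of k]]) blast
    with that show ?thesis by (metis mem_Times_iff subsetD)
  qed
  define A where "A k = (LINT x|lebesgue_on \<Omega>. (u x - \<psi> k (x, 0))\<^sup>2)" for k
  define B where "B k = (LINT p|lebesgue_on ?U. (norm (?W p - grad (\<psi> k) p))\<^sup>2)" for k
  have Bl: "B \<longlonglongrightarrow> 0" using a unfolding H1_approx_def B_def by blast
  have Al: "A \<longlonglongrightarrow> 0" using t unfolding A_def .
  have \<psi>z: "\<psi> k (x, 0) = 0" if "x \<notin> \<Omega>" for k x
  proof -
    obtain K where "K \<subseteq> \<Omega> \<times> UNIV" "\<And>z. z \<notin> K \<Longrightarrow> \<psi> k z = 0"
      by (rule test_functionsE[OF \<psi>[of k]]) blast
    with that show ?thesis by (metis mem_Sigma_iff subsetD)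
  qed
  have \<psi>t: "(\<lambda>x. \<psi> k (x, 0)) \<in> Lp 2 \<Omega>" for k
  proof -
    obtain K where K: "compact K" "\<And>z. z \<notin> K \<Longrightarrow> \<psi> k z = 0"
      by (rule test_functionsE[OF \<psi>[of k]]) blast
    have "compact (fst ` K)" by (intro compact_continuous_image K continuous_intros)
    moreover have "continuous_on UNIV (\<lambda>x. \<psi> k (x, 0))"
      by (rule continuous_on_compose2[OF smooth_continuous[OF sm, of UNIV]]) (auto intro!: continuous_intros)
    ultimately show ?thesis
      by (rule compact_support_L2[OF _ _ _ \<Omega>]) (use K(2) in force)
  qed
  have Ak: "(\<integral>\<^sup>+x. ennreal ((v x - \<psi> k (x, 0))\<^sup>2) \<partial>lborel) = ennreal (A k)" for k
  proof -
    have "(\<integral>\<^sup>+x. ennreal ((v x - \<psi> k (x, 0))\<^sup>2) \<partial>lborel) = (\<integral>\<^sup>+x. indicator \<Omega> x * ennreal ((u x - \<psi> k (x, 0))\<^sup>2) \<partial>lborel)"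
    proof (rule nn_integral_cong_AE)
      show "AE x in lborel. ennreal ((v x - \<psi> k (x, 0))\<^sup>2) = indicator \<Omega> x * ennreal ((u x - \<psi> k (x, 0))\<^sup>2)"
        using vu unfolding AE_lebesgue_on_iff[OF \<Omega>s]
        by eventually_elim (auto simp: indicator_def v0 \<psi>z)
    qed
    also have "\<dots> = (\<integral>\<^sup>+x. ennreal ((u x - \<psi> k (x, 0))\<^sup>2) \<partial>lebesgue_on \<Omega>)"
      by (rule nn_integral_lebesgue_on[OF \<Omega>s, symmetric])
    also have "\<dots> = ennreal (A k)" unfolding A_def
      using Lp2_diff[OF u2 \<psi>t[of k]] by (intro nn_integral_eq_integral) (auto simp: Lp2_iff)
    finally show ?thesis .
  qed
  have Bk: "(\<integral>\<^sup>+p. indicator {0<..<r} (snd p) * ennreal ((d k p)\<^sup>2) \<partial>lborel) \<le> ennreal (B k)" for k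
  proof -
    have "(\<integral>\<^sup>+p. indicator {0<..<r} (snd p) * ennreal ((d k p)\<^sup>2) \<partial>lborel)
      \<le> (\<integral>\<^sup>+p. indicator ?U p * ennreal ((norm (?W p - grad (\<psi> k) p))\<^sup>2) \<partial>lborel)"
    proof (rule nn_integral_mono_AE)
      show "AE p in lborel. indicator {0<..<r} (snd p) * ennreal ((d k p)\<^sup>2)
          \<le> indicator ?U p * ennreal ((norm (?W p - grad (\<psi> k) p))\<^sup>2)"
        using ng
      proof eventually_elim
        fix p assume e: "n p = g p"
        show "indicator {0<..<r} (snd p) * ennreal ((d k p)\<^sup>2)
          \<le> indicator ?U p * ennreal ((norm (?W p - grad (\<psi> k) p))\<^sup>2)"
        proof (cases "p \<in> ?U")
          case True
          then have "g p = norm (?W p)" using e by (simp add: n_def)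
          then have "d k p \<le> norm (?W p - grad (\<psi> k) p)"
            unfolding d_def using norm_triangle_ineq2[of "grad (\<psi> k) p" "?W p"] by (simp add: norm_minus_commute)
          then have "ennreal ((d k p)\<^sup>2) \<le> ennreal ((norm (?W p - grad (\<psi> k) p))\<^sup>2)"
            by (intro ennreal_leI power_mono d)
          then show ?thesis using True by (simp add: indicator_def)
        next
          case False
          \<comment> \<open>At a height in (0, r), a point outside the cylinder lies over the
            complement of \<Omega>, where the gradient of \<open>\<psi> k\<close> is 0 and the
            excess with it.\<close>
          then have "snd p \<notin> {0<..<r} \<or> d k p = 0"
            using grad0[of p k] g(2)[of p] by (cases p) (auto simp: cylinder_def d_def)
          then show ?thesis by auto
        qed
      qed
    qed
    also have "\<dots> = (\<integral>\<^sup>+p. ennreal ((norm (?W p - grad (\<psi> k) p))\<^sup>2) \<partial>lebesgue_on ?U)"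
      by (rule nn_integral_lebesgue_on[OF Us, symmetric])
    also have "\<dots> = ennreal (B k)" unfolding B_def
      using Lp2_diff[OF W2 test_functions_L2(2)[OF \<psi>[of k] U]]
      by (intro nn_integral_eq_integral) (auto simp: Lp2_iff)
    finally show ?thesis .
  qed
  have E: "(\<integral>\<^sup>+p. indicator {0<..<r} (snd p) * ennreal (snd p powr (1 - \<alpha>) * (g p)\<^sup>2) \<partial>lborel) \<le> energy \<alpha> \<Omega> w"
  proof -
    have "(\<integral>\<^sup>+p. indicator {0<..<r} (snd p) * ennreal (snd p powr (1 - \<alpha>) * (g p)\<^sup>2) \<partial>lborel)
      \<le> (\<integral>\<^sup>+p. indicator ?U p * ennreal (snd p powr (1 - \<alpha>) * (norm (?W p))\<^sup>2) \<partial>lborel)"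
    proof (rule nn_integral_mono_AE)
      show "AE p in lborel. indicator {0<..<r} (snd p) * ennreal (snd p powr (1 - \<alpha>) * (g p)\<^sup>2)
          \<le> indicator ?U p * ennreal (snd p powr (1 - \<alpha>) * (norm (?W p))\<^sup>2)"
        using ng
      proof eventually_elim
        fix p assume "n p = g p"
        then have "g p = (if p \<in> ?U then norm (?W p) else 0)" by (auto simp: n_def)
        then show "indicator {0<..<r} (snd p) * ennreal (snd p powr (1 - \<alpha>) * (g p)\<^sup>2)
          \<le> indicator ?U p * ennreal (snd p powr (1 - \<alpha>) * (norm (?W p))\<^sup>2)"
          by (auto simp: indicator_def)
      qed
    qed
    also have "\<dots> = energy \<alpha> \<Omega> w"
      unfolding energy_def by (rule nn_integral_lebesgue_on[OF Us, symmetric])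
    finally show ?thesis .
  qed
  define C where "C = 64 * (ennreal (r powr \<alpha> / \<alpha>) * energy \<alpha> \<Omega> w)"
  have AB: "0 \<le> A k" "0 \<le> B k" for k unfolding A_def B_def by auto
  have bound: "(\<integral>\<^sup>+x. ennreal ((v (x + z) - v x)\<^sup>2) \<partial>lborel) \<le> ennreal (8 * A k + 64 * (r * B k)) + C" for k
  proof -
    have "(\<integral>\<^sup>+x. ennreal ((v (x + z) - v x)\<^sup>2) \<partial>lborel)
    \<le> 8 * (\<integral>\<^sup>+x. ennreal ((v x - \<psi> k (x, 0))\<^sup>2) \<partial>lborel)
      + 64 * (ennreal (r powr \<alpha> / \<alpha>)
          * (\<integral>\<^sup>+p. indicator {0<..<r} (snd p) * ennreal (snd p powr (1 - \<alpha>) * (g p)\<^sup>2) \<partial>lborel))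
      + 64 * (ennreal r * (\<integral>\<^sup>+p. indicator {0<..<r} (snd p) * ennreal ((d k p)\<^sup>2) \<partial>lborel))"
      unfolding r_def by (rule translation_estimate_smooth[OF sm \<alpha> v g d False])
    also have "\<dots> \<le> 8 * ennreal (A k) + C + 64 * (ennreal r * ennreal (B k))"
      unfolding C_def Ak by (intro add_mono mult_left_mono Bk E order_refl) auto
    also have "\<dots> = ennreal (8 * A k + 64 * (r * B k)) + C"
      using AB[of k] by (simp add: r_def ennreal_mult ac_simps)
    finally show ?thesis .
  qed
  have "(\<lambda>k. 8 * A k + 64 * (r * B k)) \<longlonglongrightarrow> 8 * 0 + 64 * (r * 0)"
    by (intro tendsto_intros Al Bl)
  then have "(\<lambda>k. ennreal (8 * A k + 64 * (r * B k)) + C) \<longlonglongrightarrow> ennreal 0 + C"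
    by (intro tendsto_add tendsto_const tendsto_ennrealI) simp
  from LIMSEQ_le_const[OF this] bound
  have "(\<integral>\<^sup>+x. ennreal ((v (x + z) - v x)\<^sup>2) \<partial>lborel) \<le> ennreal 0 + C" by blast
  then show ?thesis by (simp add: C_def r_def)
qed

subsection \<open>Superlevel sets\<close>

text \<open>A ball of measure \<open>2 * s\<close> around a point of \<open>S1\<close> meets the complement of \<open>S0\<close> in a set of
  measure at least \<open>s\<close>, so averaging the translation estimate over the ball bounds the jump of
  \<open>v\<close> between \<open>S1\<close> and the complement of \<open>S0\<close>.\<close>

lemma level_set_estimate:
  fixes v :: "'a::euclidean_space \<Rightarrow> real"
  assumes v [measurable]: "v \<in> borel_measurable borel"
    and S [measurable]: "S0 \<in> sets borel" "S1 \<in> sets borel"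
    and tr: "\<And>z. (\<integral>\<^sup>+x. ennreal ((v (x + z) - v x)\<^sup>2) \<partial>lborel) \<le> K * ennreal (norm z powr \<alpha>)"
    and \<alpha>: "0 < \<alpha>" and v0: "\<And>x. x \<notin> S0 \<Longrightarrow> v x = 0" and v1: "\<And>x. x \<in> S1 \<Longrightarrow> c \<le> \<bar>v x\<bar>" and c: "0 \<le> c"
    and s: "0 < s" "emeasure lborel S0 \<le> ennreal s"
    and \<rho>: "emeasure lborel (ball 0 \<rho> :: 'a set) = ennreal (2 * s)" "0 < \<rho>"
  shows "emeasure lborel S1 * ennreal (c\<^sup>2) \<le> 2 * (K * ennreal (\<rho> powr \<alpha>))"
proof -
  let ?B = "ball 0 \<rho> :: 'a set"
  have madd: "(\<lambda>p::'a \<times> 'a. fst p + snd p) \<in> borel_measurable borel"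
    by (intro borel_measurable_continuous_onI continuous_intros)
  have mv: "(\<lambda>p::'a \<times> 'a. v (fst p + snd p)) \<in> borel_measurable (lborel \<Otimes>\<^sub>M lborel)"
    using measurable_compose[OF madd v] by (simp add: lborel_prod)
  define J :: "'a \<times> 'a \<Rightarrow> ennreal"
    where "J p = indicator ?B (snd p) * ennreal ((v (fst p + snd p) - v (fst p))\<^sup>2)" for p
  have J: "J \<in> borel_measurable (lborel \<Otimes>\<^sub>M lborel)"
  proof -
    have [measurable]: "?B \<in> sets borel" by simp
    have [measurable]: "(\<lambda>p::'a \<times> 'a. v (fst p + snd p) - v (fst p)) \<in> borel_measurable (lborel \<Otimes>\<^sub>M lborel)"
      by (intro borel_measurable_diff mv measurable_compose[OF measurable_fst]) simp
    show ?thesis unfolding J_def by measurable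
  qed
  have inner: "indicator S1 x * (ennreal (c\<^sup>2) * ennreal s) \<le> (\<integral>\<^sup>+z. J (x, z) \<partial>lborel)" for x
  proof (cases "x \<in> S1")
    case True
    define T where "T = {z. z + x \<in> S0}"
    have "(\<lambda>z. z + x) \<in> borel_measurable borel" by measurable
    from measurable_sets[OF this S(1)] have T [measurable]: "T \<in> sets borel"
      by (simp add: T_def vimage_def)
    have "emeasure lborel T = (\<integral>\<^sup>+z. indicator S0 (z + x) \<partial>lborel)"
    proof -
      have "indicator S0 (z + x) = (indicator T z :: ennreal)" for z by (simp add: T_def indicator_def)
      then show ?thesis by simp
    qed
    also have "\<dots> = emeasure lborel S0" by (subst nn_integral_translation) auto
    finally have eT: "emeasure lborel T \<le> ennreal s" using s(2) by simp
    have "ennreal (2 * s) \<le> emeasure lborel (?B - T) + emeasure lborel T"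
      unfolding \<rho>(1)[symmetric]
      by (rule order_trans[OF emeasure_mono[of _ "(?B - T) \<union> T"] emeasure_subadditive]) auto
    also have "\<dots> \<le> emeasure lborel (?B - T) + ennreal s" by (intro add_left_mono eT)
    finally have "ennreal s + ennreal s \<le> emeasure lborel (?B - T) + ennreal s"
      using s(1) by (simp flip: ennreal_plus)
    then have es: "ennreal s \<le> emeasure lborel (?B - T)"
      by (simp add: ennreal_add_left_cancel_le add.commute)
    have "indicator S1 x * (ennreal (c\<^sup>2) * ennreal s) \<le> ennreal (c\<^sup>2) * emeasure lborel (?B - T)"
      using es True by (simp add: mult_left_mono)
    also have "\<dots> = (\<integral>\<^sup>+z. ennreal (c\<^sup>2) * indicator (?B - T) z \<partial>lborel)"
      by (subst nn_integral_cmult_indicator) auto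
    also have "\<dots> \<le> (\<integral>\<^sup>+z. J (x, z) \<partial>lborel)"
    proof (intro nn_integral_mono)
      fix z
      show "ennreal (c\<^sup>2) * indicator (?B - T) z \<le> J (x, z)"
      proof (cases "z \<in> ?B - T")
        case z: True
        then have "v (x + z) = 0" by (intro v0) (simp add: T_def add.commute)
        moreover have "c\<^sup>2 \<le> (v x)\<^sup>2" using power_mono[OF v1[OF True] c, of 2] by simp
        ultimately show ?thesis using z by (simp add: J_def ennreal_leI)
      qed simp
    qed
    finally show ?thesis .
  qed simp
  have "ennreal (c\<^sup>2) * ennreal s * emeasure lborel S1 = (\<integral>\<^sup>+x. (ennreal (c\<^sup>2) * ennreal s) * indicator S1 x \<partial>lborel)"
    by (subst nn_integral_cmult_indicator) auto
  also have "\<dots> \<le> (\<integral>\<^sup>+x. \<integral>\<^sup>+z. J (x, z) \<partial>lborel \<partial>lborel)"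
    using inner by (intro nn_integral_mono) (simp add: mult.commute)
  also have "\<dots> = (\<integral>\<^sup>+z. \<integral>\<^sup>+x. J (x, z) \<partial>lborel \<partial>lborel)"
    by (rule lborel_pair.Fubini[OF J, symmetric])
  also have "\<dots> \<le> (\<integral>\<^sup>+z. (K * ennreal (\<rho> powr \<alpha>)) * indicator ?B z \<partial>lborel)"
  proof (intro nn_integral_mono)
    fix z
    show "(\<integral>\<^sup>+x. J (x, z) \<partial>lborel) \<le> K * ennreal (\<rho> powr \<alpha>) * indicator ?B z"
    proof (cases "z \<in> ?B")
      case True
      have "(\<integral>\<^sup>+x. J (x, z) \<partial>lborel) = (\<integral>\<^sup>+x. ennreal ((v (x + z) - v x)\<^sup>2) \<partial>lborel)"
        using True by (simp add: J_def)
      also have "\<dots> \<le> K * ennreal (norm z powr \<alpha>)" by (rule tr)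
      also have "\<dots> \<le> K * ennreal (\<rho> powr \<alpha>)"
        using True \<alpha> by (intro mult_left_mono ennreal_leI powr_mono2) auto
      finally show ?thesis using True by simp
    qed (simp add: J_def)
  qed
  \<comment> \<open>The factor 2 of the conclusion is the ratio of the measure 2 s of the ball to
    the lower bound s used in \<open>inner\<close>.\<close>
  also have "\<dots> = K * ennreal (\<rho> powr \<alpha>) * ennreal (2 * s)"
    by (subst nn_integral_cmult_indicator) (auto simp: \<rho>(1))
  also have "\<dots> = ennreal s * (2 * (K * ennreal (\<rho> powr \<alpha>)))"
    using s(1) by (simp add: ennreal_mult ac_simps)
  finally have "ennreal s * (emeasure lborel S1 * ennreal (c\<^sup>2)) \<le> ennreal s * (2 * (K * ennreal (\<rho> powr \<alpha>)))"
    by (simp add: ac_simps)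
  then show ?thesis using s(1) by (subst (asm) ennreal_mult_le_mult_iff) auto
qed

section \<open>Smooth truncations and their energy\<close>

definition trunc :: "real \<Rightarrow> real \<Rightarrow> real \<Rightarrow> real" where
  "trunc k h t = h * (estep ((t - k) / h) - estep ((- t - k) / h))"

lemma smooth_trunc: "smooth (trunc k h)"
proof -
  have "smooth (\<lambda>t. h * estep (1 / h * t + - (k / h)) + - h * estep (- (1 / h) * t + - (k / h)))"
    by (rule smooth_add[OF smooth_mult[OF smooth_const smooth_compose[OF smooth_estep smooth_affine]]
          smooth_mult[OF smooth_const smooth_compose[OF smooth_estep smooth_affine]]])
  also have "(\<lambda>t. h * estep (1 / h * t + - (k / h)) + - h * estep (- (1 / h) * t + - (k / h))) = trunc k h"
    by (auto simp: trunc_def fun_eq_iff right_diff_distrib diff_divide_distrib)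
  finally show ?thesis .
qed

text \<open>Height and width of the truncation both scale with \<open>h\<close>, so the factors h
  and 1/h cancel and the bound is independent of the level and of \<open>h\<close>: each of the two
  steps contributes at most 2.\<close>

lemma deriv_trunc_bounds:
  assumes "0 < h"
  shows "0 \<le> deriv (trunc k h) t" "deriv (trunc k h) t \<le> 4"
proof -
  have "((\<lambda>t. estep ((t - k) / h)) has_real_derivative deriv estep ((t - k) / h) * (1 / h)) (at t)"
    by (rule DERIV_chain2[OF estep_has_derivative]) (use assms in \<open>auto intro!: derivative_eq_intros\<close>)
  moreover have "((\<lambda>t. estep ((- t - k) / h)) has_real_derivative deriv estep ((- t - k) / h) * (- 1 / h)) (at t)"
    by (rule DERIV_chain2[OF estep_has_derivative]) (use assms in \<open>auto intro!: derivative_eq_intros\<close>)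
  ultimately have "(trunc k h has_real_derivative h * (deriv estep ((t - k) / h) * (1 / h) - deriv estep ((- t - k) / h) * (- 1 / h))) (at t)"
    unfolding trunc_def[abs_def] by (intro DERIV_cmult DERIV_diff)
  then have "deriv (trunc k h) t = deriv estep ((t - k) / h) + deriv estep ((- t - k) / h)"
    using assms by (simp add: DERIV_imp_deriv distrib_left)
  then show "0 \<le> deriv (trunc k h) t" "deriv (trunc k h) t \<le> 4"
    using deriv_estep_bounds[of "(t - k) / h"] deriv_estep_bounds[of "(- t - k) / h"] by auto
qed

lemma trunc_bounds:
  assumes h: "0 < h" and k: "0 \<le> k"
  shows "\<bar>trunc k h t\<bar> \<le> h" "\<bar>t\<bar> \<le> k \<Longrightarrow> trunc k h t = 0" "k + h \<le> \<bar>t\<bar> \<Longrightarrow> h * exp (- 1) \<le> \<bar>trunc k h t\<bar>"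
proof -
  let ?a = "estep ((t - k) / h)" and ?b = "estep ((- t - k) / h)"
  have "\<bar>?a - ?b\<bar> \<le> 1"
    using estep_bounds(1,2)[of "(t - k) / h"] estep_bounds(1,2)[of "(- t - k) / h"] by linarith
  from mult_left_mono[OF this, of h] h show "\<bar>trunc k h t\<bar> \<le> h" by (simp add: trunc_def abs_mult)
  show "trunc k h t = 0" if "\<bar>t\<bar> \<le> k"
    using that h by (simp add: trunc_def estep_bounds(3) divide_nonpos_pos)
  show "h * exp (- 1) \<le> \<bar>trunc k h t\<bar>" if kt: "k + h \<le> \<bar>t\<bar>"
  proof -
    have "exp (- 1) \<le> \<bar>?a - ?b\<bar>"
    proof (cases "0 \<le> t")
      case True
      then have "?b = 0" using h k by (intro estep_bounds(3)) (simp add: divide_nonpos_pos)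
      moreover have "exp (- 1) \<le> ?a" using True kt h by (intro estep_ge) (simp add: field_simps)
      ultimately show ?thesis by simp
    next
      case False
      then have "?a = 0" using h k by (intro estep_bounds(3)) (simp add: divide_nonpos_pos)
      moreover have "exp (- 1) \<le> ?b" using False kt h by (intro estep_ge) (simp add: field_simps)
      ultimately show ?thesis by simp
    qed
    from mult_left_mono[OF this, of h] h show ?thesis by (simp add: trunc_def abs_mult)
  qed
qed

lemma X0_energy_finite: "w \<in> X0 \<alpha> \<Omega> \<Longrightarrow> energy \<alpha> \<Omega> w < \<infinity>"
  unfolding X0_def energy_def by (auto simp: integrable_iff_bounded)

text \<open>Testing the equation with \<open>\<gamma> \<circ> w\<close>; since \<open>\<gamma>' \<ge> 0\<close>, the resulting integral dominates the
  energy of \<open>\<gamma> \<circ> w\<close>.\<close>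

lemma energy_trunc:
  assumes \<Omega>: "open \<Omega>" and sol: "weak_extension_solution \<alpha> \<Omega> f w" and u: "has_trace \<Omega> w u"
    and f [measurable]: "f \<in> borel_measurable (lebesgue_on \<Omega>)" and h: "0 < h" and k: "0 \<le> k"
  shows "energy \<alpha> \<Omega> (\<lambda>z. trunc k h (w z))
      \<le> ennreal (4 * \<bar>kappa \<alpha>\<bar> * h) * (\<integral>\<^sup>+x. indicator {x. k < \<bar>u x\<bar>} x * ennreal \<bar>f x\<bar> \<partial>lebesgue_on \<Omega>)"
    and "energy \<alpha> \<Omega> (\<lambda>z. trunc k h (w z)) \<le> 16 * energy \<alpha> \<Omega> w"
proof -
  let ?U = "cylinder \<Omega>" let ?M = "lebesgue_on ?U" let ?W = "weak_grad ?U w"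
  let ?g = "trunc k h" let ?D = "deriv (trunc k h)"
  let ?v = "\<lambda>z. ?g (w z)" let ?V = "weak_grad ?U ?v"
  have wX: "w \<in> X0 \<alpha> \<Omega>" using sol by (simp add: weak_extension_solution_def)
  have D: "0 \<le> ?D t" "?D t \<le> 4" "\<bar>?D t\<bar> \<le> 4" for t using deriv_trunc_bounds[OF h, of k t] by auto
  have z: "?g 0 = 0" using trunc_bounds(2)[OF h k, of 0] k by simp
  note X = X0_compose[OF \<Omega> wX u smooth_trunc z D(3)]
  have ae: "AE z in ?M. ?V z = ?D (w z) *\<^sub>R ?W z" by (rule X(3))
  have mW [measurable]: "?W \<in> borel_measurable ?M" and mV [measurable]: "?V \<in> borel_measurable ?M"
    using wX X(1) H1D(2)[of w ?U] H1D(2)[of ?v ?U] by (auto simp: X0_def Lp2_iff)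
  have [measurable]: "u \<in> borel_measurable (lebesgue_on \<Omega>)"
    using u by (simp add: has_trace_def Lp2_iff)
  have [measurable]: "snd \<in> borel_measurable ?M"
    by (rule continuous_borel_measurable_lebesgue_on) (intro continuous_intros)
  have iW: "integrable ?M (\<lambda>z. snd z powr (1 - \<alpha>) * (norm (?W z))\<^sup>2)"
    and iV: "integrable ?M (\<lambda>z. snd z powr (1 - \<alpha>) * (norm (?V z))\<^sup>2)"
    using wX X(1) by (auto simp: X0_def)
  show "energy \<alpha> \<Omega> ?v \<le> 16 * energy \<alpha> \<Omega> w"
  proof -
    have "energy \<alpha> \<Omega> ?v \<le> (\<integral>\<^sup>+z. 16 * ennreal (snd z powr (1 - \<alpha>) * (norm (?W z))\<^sup>2) \<partial>?M)"
      unfolding energy_def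
    proof (rule nn_integral_mono_AE)
      show "AE z in ?M. ennreal (snd z powr (1 - \<alpha>) * (norm (?V z))\<^sup>2)
          \<le> 16 * ennreal (snd z powr (1 - \<alpha>) * (norm (?W z))\<^sup>2)"
        using ae
      proof eventually_elim
        fix z assume e: "?V z = ?D (w z) *\<^sub>R ?W z"
        have "(?D (w z))\<^sup>2 \<le> 4\<^sup>2" using D[of "w z"] by (intro power_mono) auto
        then have "(norm (?V z))\<^sup>2 \<le> 16 * (norm (?W z))\<^sup>2"
          by (simp add: e power_mult_distrib mult_right_mono)
        from mult_left_mono[OF this, of "snd z powr (1 - \<alpha>)"]
        have "snd z powr (1 - \<alpha>) * (norm (?V z))\<^sup>2 \<le> 16 * (snd z powr (1 - \<alpha>) * (norm (?W z))\<^sup>2)"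
          by (simp add: mult.left_commute)
        from ennreal_leI[OF this]
        show "ennreal (snd z powr (1 - \<alpha>) * (norm (?V z))\<^sup>2)
          \<le> 16 * ennreal (snd z powr (1 - \<alpha>) * (norm (?W z))\<^sup>2)" by (simp add: ennreal_mult)
      qed
    qed
    also have "\<dots> = 16 * energy \<alpha> \<Omega> w" unfolding energy_def by (rule nn_integral_cmult) measurable
    finally show ?thesis .
  qed
  have eq: "(LINT z|?M. snd z powr (1 - \<alpha>) * (?W z \<bullet> ?V z)) = kappa \<alpha> * (LINT x|lebesgue_on \<Omega>. f x * ?g (u x))"
    and ifg: "integrable (lebesgue_on \<Omega>) (\<lambda>x. f x * ?g (u x))"
    using sol X(1,2) unfolding weak_extension_solution_def by blast+
  \<comment> \<open>With D the derivative of the truncation at w, the squared gradient of the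
    composite is D^2 times that of \<open>w\<close>, the inner product is D times it, and D^2 \<le>
    4 D because 0 \<le> D \<le> 4. The second half only serves integrability.\<close>
  have ineq: "AE z in ?M. snd z powr (1 - \<alpha>) * (norm (?V z))\<^sup>2 \<le> 4 * (snd z powr (1 - \<alpha>) * (?W z \<bullet> ?V z))
      \<and> \<bar>snd z powr (1 - \<alpha>) * (?W z \<bullet> ?V z)\<bar> \<le> 4 * (snd z powr (1 - \<alpha>) * (norm (?W z))\<^sup>2)"
    using ae
  proof eventually_elim
    fix z assume e: "?V z = ?D (w z) *\<^sub>R ?W z"
    have n: "(norm (?V z))\<^sup>2 = ?D (w z) * (?D (w z) * (norm (?W z))\<^sup>2)"
      by (simp add: e power_mult_distrib power2_eq_square)
    have i: "?W z \<bullet> ?V z = ?D (w z) * (norm (?W z))\<^sup>2"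
      by (simp add: e power2_norm_eq_inner)
    have "(norm (?V z))\<^sup>2 \<le> 4 * (?W z \<bullet> ?V z)"
      unfolding n i using D by (intro mult_right_mono) auto
    from mult_left_mono[OF this, of "snd z powr (1 - \<alpha>)"]
    have 1: "snd z powr (1 - \<alpha>) * (norm (?V z))\<^sup>2 \<le> 4 * (snd z powr (1 - \<alpha>) * (?W z \<bullet> ?V z))"
      by (simp add: mult.left_commute)
    have "\<bar>?W z \<bullet> ?V z\<bar> \<le> 4 * (norm (?W z))\<^sup>2"
      unfolding i using D[of "w z"] by (simp add: abs_mult mult_right_mono)
    from mult_left_mono[OF this, of "snd z powr (1 - \<alpha>)"]
    have 2: "\<bar>snd z powr (1 - \<alpha>) * (?W z \<bullet> ?V z)\<bar> \<le> 4 * (snd z powr (1 - \<alpha>) * (norm (?W z))\<^sup>2)"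
      by (simp add: abs_mult mult.left_commute)
    from 1 2 show "snd z powr (1 - \<alpha>) * (norm (?V z))\<^sup>2 \<le> 4 * (snd z powr (1 - \<alpha>) * (?W z \<bullet> ?V z))
      \<and> \<bar>snd z powr (1 - \<alpha>) * (?W z \<bullet> ?V z)\<bar> \<le> 4 * (snd z powr (1 - \<alpha>) * (norm (?W z))\<^sup>2)" ..
  qed
  have iWV: "integrable ?M (\<lambda>z. snd z powr (1 - \<alpha>) * (?W z \<bullet> ?V z))"
  proof (rule Bochner_Integration.integrable_bound)
    show "integrable ?M (\<lambda>z. 4 * (snd z powr (1 - \<alpha>) * (norm (?W z))\<^sup>2))" using iW by simp
    show "AE z in ?M. norm (snd z powr (1 - \<alpha>) * (?W z \<bullet> ?V z)) \<le> norm (4 * (snd z powr (1 - \<alpha>) * (norm (?W z))\<^sup>2))"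
      using ineq by eventually_elim simp
  qed measurable
  have "energy \<alpha> \<Omega> ?v = ennreal (LINT z|?M. snd z powr (1 - \<alpha>) * (norm (?V z))\<^sup>2)"
    unfolding energy_def by (rule nn_integral_eq_integral[OF iV]) simp
  also have "\<dots> \<le> ennreal (LINT z|?M. 4 * (snd z powr (1 - \<alpha>) * (?W z \<bullet> ?V z)))"
  proof (intro ennreal_leI integral_mono_AE iV)
    show "AE z in ?M. snd z powr (1 - \<alpha>) * (norm (?V z))\<^sup>2 \<le> 4 * (snd z powr (1 - \<alpha>) * (?W z \<bullet> ?V z))"
      using ineq by eventually_elim simp
  qed (use iWV in simp)
  also have "\<dots> = ennreal (4 * kappa \<alpha> * (LINT x|lebesgue_on \<Omega>. f x * ?g (u x)))"
    using iWV by (simp add: eq mult.assoc)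
  also have "\<dots> \<le> ennreal (4 * \<bar>kappa \<alpha>\<bar> * norm (LINT x|lebesgue_on \<Omega>. f x * ?g (u x)))"
  proof (intro ennreal_leI)
    have "kappa \<alpha> * I \<le> \<bar>kappa \<alpha>\<bar> * \<bar>I\<bar>" for I by (simp flip: abs_mult)
    from this[of "LINT x|lebesgue_on \<Omega>. f x * ?g (u x)"]
    show "4 * kappa \<alpha> * (LINT x|lebesgue_on \<Omega>. f x * ?g (u x)) \<le> 4 * \<bar>kappa \<alpha>\<bar> * norm (LINT x|lebesgue_on \<Omega>. f x * ?g (u x))"
      by simp
  qed
  also have "\<dots> = ennreal (4 * \<bar>kappa \<alpha>\<bar>) * ennreal (norm (LINT x|lebesgue_on \<Omega>. f x * ?g (u x)))"
    by (rule ennreal_mult) auto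
  also have "\<dots> \<le> ennreal (4 * \<bar>kappa \<alpha>\<bar>) * (\<integral>\<^sup>+x. ennreal (norm (f x * ?g (u x))) \<partial>lebesgue_on \<Omega>)"
    by (intro mult_left_mono integral_norm_bound_ennreal ifg) auto
  also have "\<dots> \<le> ennreal (4 * \<bar>kappa \<alpha>\<bar>) * (\<integral>\<^sup>+x. ennreal h * (indicator {x. k < \<bar>u x\<bar>} x * ennreal \<bar>f x\<bar>) \<partial>lebesgue_on \<Omega>)"
  proof (intro mult_left_mono nn_integral_mono)
    fix x
    show "ennreal (norm (f x * ?g (u x))) \<le> ennreal h * (indicator {x. k < \<bar>u x\<bar>} x * ennreal \<bar>f x\<bar>)"
    proof (cases "k < \<bar>u x\<bar>")
      case True
      have "norm (f x * ?g (u x)) \<le> h * \<bar>f x\<bar>"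
        using mult_left_mono[OF trunc_bounds(1)[OF h k, of "u x"], of "\<bar>f x\<bar>"] by (simp add: abs_mult mult.commute)
      from ennreal_leI[OF this] show ?thesis using True h by (simp add: ennreal_mult)
    next
      case False
      then show ?thesis using trunc_bounds(2)[OF h k, of "u x"] by simp
    qed
  qed simp
  also have "\<dots> \<le> ennreal (4 * \<bar>kappa \<alpha>\<bar>) * (ennreal h * (\<integral>\<^sup>+x. indicator {x. k < \<bar>u x\<bar>} x * ennreal \<bar>f x\<bar> \<partial>lebesgue_on \<Omega>))"
    by (subst nn_integral_cmult) auto
  also have "\<dots> = ennreal (4 * \<bar>kappa \<alpha>\<bar> * h) * (\<integral>\<^sup>+x. indicator {x. k < \<bar>u x\<bar>} x * ennreal \<bar>f x\<bar> \<partial>lebesgue_on \<Omega>)"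
    using h by (simp add: ennreal_mult mult.assoc)
  finally show "energy \<alpha> \<Omega> ?v \<le> ennreal (4 * \<bar>kappa \<alpha>\<bar> * h)
      * (\<integral>\<^sup>+x. indicator {x. k < \<bar>u x\<bar>} x * ennreal \<bar>f x\<bar> \<partial>lebesgue_on \<Omega>)" .
qed

text \<open>The level set estimate for the truncated trace, with superlevel sets at \<open>k\<close>
  and \<open>k + h\<close> and jump h exp(-1). In the constant, exp 2 undoes the square of exp(-1),
  128 is 2 times 64, and the powers come from expressing the radius of the ball through
  \<open>s\<close>.\<close>

lemma superlevel_estimate:
  fixes \<Omega> :: "'a::euclidean_space set"
  assumes \<Omega>: "open \<Omega>" and \<alpha>: "0 < \<alpha>" and w: "w \<in> X0 \<alpha> \<Omega>" and u: "has_trace \<Omega> w u"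
    and u' [measurable]: "u' \<in> borel_measurable borel"
    and uu: "AE x in lebesgue_on \<Omega>. u' x = u x" and u0: "\<And>x. x \<notin> \<Omega> \<Longrightarrow> u' x = 0"
    and h: "0 < h" and k: "0 \<le> k" and s: "0 < s" "emeasure lborel {x. k < \<bar>u' x\<bar>} \<le> ennreal s"
  shows "emeasure lborel {x. k + h < \<bar>u' x\<bar>} * ennreal (h\<^sup>2)
    \<le> ennreal (128 * exp 2 / \<alpha> * (2 / unit_ball_vol DIM('a)) powr (\<alpha> / DIM('a)) * s powr (\<alpha> / DIM('a)))
      * energy \<alpha> \<Omega> (\<lambda>z. trunc k h (w z))"
proof -
  let ?N = "real DIM('a)" let ?E = "energy \<alpha> \<Omega> (\<lambda>z. trunc k h (w z))"
  \<comment> \<open>The radius of the ball of measure 2 s, from the volume formula.\<close>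
  define \<rho> where "\<rho> = (2 * s / unit_ball_vol ?N) powr (1 / ?N)"
  have vp: "0 < unit_ball_vol ?N" by simp
  then have vn: "unit_ball_vol ?N \<noteq> 0" by linarith
  have \<rho>0: "0 < \<rho>" using s(1) vp vn by (simp add: \<rho>_def)
  have "\<rho> ^ DIM('a) = 2 * s / unit_ball_vol ?N"
    using s(1) vp vn by (simp add: \<rho>_def powr_powr flip: powr_realpow)
  then have \<rho>: "emeasure lborel (ball 0 \<rho> :: 'a set) = ennreal (2 * s)"
    using \<rho>0 vn by (subst emeasure_ball) auto
  have \<rho>a: "\<rho> powr \<alpha> = (2 / unit_ball_vol ?N) powr (\<alpha> / ?N) * s powr (\<alpha> / ?N)"
  proof -
    have "\<rho> powr \<alpha> = (2 / unit_ball_vol ?N * s) powr (\<alpha> / ?N)" by (simp add: \<rho>_def powr_powr)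
    also have "\<dots> = (2 / unit_ball_vol ?N) powr (\<alpha> / ?N) * s powr (\<alpha> / ?N)"
      using s(1) vp by (subst powr_mult) auto
    finally show ?thesis .
  qed
  have D: "\<bar>deriv (trunc k h) t\<bar> \<le> 4" for t using deriv_trunc_bounds[OF h, of k t] by auto
  have z: "trunc k h 0 = 0" using trunc_bounds(2)[OF h k, of 0] k by simp
  have m [measurable]: "trunc k h \<in> borel_measurable borel"
    by (intro borel_measurable_continuous_onI smooth_continuous smooth_trunc)
  have tr: "(\<integral>\<^sup>+x. ennreal ((trunc k h (u' (x + y)) - trunc k h (u' x))\<^sup>2) \<partial>lborel)
      \<le> (64 * (ennreal (1 / \<alpha>) * ?E)) * ennreal (norm y powr \<alpha>)" for y
  proof -
    have "(\<integral>\<^sup>+x. ennreal ((trunc k h (u' (x + y)) - trunc k h (u' x))\<^sup>2) \<partial>lborel)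
      \<le> 64 * (ennreal (norm y powr \<alpha> / \<alpha>) * ?E)"
    proof (rule translation_estimate[OF \<Omega> \<alpha> X0_compose(2)[OF \<Omega> w u smooth_trunc z D]])
      show "AE x in lebesgue_on \<Omega>. trunc k h (u' x) = trunc k h (u x)"
        using uu by eventually_elim simp
    qed (use u0 z in auto)
    also have "ennreal (norm y powr \<alpha> / \<alpha>) = ennreal (1 / \<alpha>) * ennreal (norm y powr \<alpha>)"
      using \<alpha> by (simp flip: ennreal_mult)
    finally show ?thesis by (simp add: ac_simps)
  qed
  have "emeasure lborel {x. k + h < \<bar>u' x\<bar>} * ennreal ((h * exp (- 1))\<^sup>2)
      \<le> 2 * ((64 * (ennreal (1 / \<alpha>) * ?E)) * ennreal (\<rho> powr \<alpha>))"
    by (rule level_set_estimate[OF _ _ _ tr \<alpha> _ _ _ s \<rho> \<rho>0])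
       (use trunc_bounds[OF h k] h in \<open>auto simp: not_less\<close>)
  then have "ennreal (exp 2) * (emeasure lborel {x. k + h < \<bar>u' x\<bar>} * ennreal ((h * exp (- 1))\<^sup>2))
      \<le> ennreal (exp 2) * (2 * ((64 * (ennreal (1 / \<alpha>) * ?E)) * ennreal (\<rho> powr \<alpha>)))"
    by (rule mult_left_mono) simp
  moreover have "ennreal (exp 2) * (emeasure lborel {x. k + h < \<bar>u' x\<bar>} * ennreal ((h * exp (- 1))\<^sup>2))
      = emeasure lborel {x. k + h < \<bar>u' x\<bar>} * ennreal (h\<^sup>2)"
  proof -
    have "exp 2 * (h * exp (- 1))\<^sup>2 = h\<^sup>2"
      by (simp add: power_mult_distrib power2_eq_square mult.left_commute flip: exp_add)
    then have "ennreal (exp 2) * ennreal ((h * exp (- 1))\<^sup>2) = ennreal (h\<^sup>2)"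
      by (simp flip: ennreal_mult)
    then show ?thesis by (simp only: mult.left_commute[of "ennreal (exp 2)"])
  qed
  moreover have "ennreal (exp 2) * (2 * ((64 * (ennreal (1 / \<alpha>) * ?E)) * ennreal (\<rho> powr \<alpha>)))
      = ennreal (128 * exp 2 / \<alpha> * (2 / unit_ball_vol ?N) powr (\<alpha> / ?N) * s powr (\<alpha> / ?N)) * ?E"
  proof -
    have "ennreal (128 * exp 2 / \<alpha> * (2 / unit_ball_vol ?N) powr (\<alpha> / ?N) * s powr (\<alpha> / ?N))
        = ennreal (128 * (exp 2 * (1 / \<alpha> * \<rho> powr \<alpha>)))"
      by (simp add: \<rho>a mult.assoc)
    also have "\<dots> = 128 * (ennreal (exp 2) * (ennreal (1 / \<alpha>) * ennreal (\<rho> powr \<alpha>)))"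
      using \<alpha> by (simp add: ennreal_mult del: times_divide_eq_left)
    finally have e: "ennreal (128 * exp 2 / \<alpha> * (2 / unit_ball_vol ?N) powr (\<alpha> / ?N) * s powr (\<alpha> / ?N))
        = 128 * (ennreal (exp 2) * (ennreal (1 / \<alpha>) * ennreal (\<rho> powr \<alpha>)))" .
    have "2 * (64 * X) = 128 * X" for X :: ennreal by (simp add: mult.assoc[symmetric])
    then have "ennreal (exp 2) * (2 * ((64 * (ennreal (1 / \<alpha>) * ?E)) * ennreal (\<rho> powr \<alpha>)))
        = ennreal (exp 2) * (128 * ((ennreal (1 / \<alpha>) * ?E) * ennreal (\<rho> powr \<alpha>)))"
      by (simp only: mult.assoc)
    then show ?thesis unfolding e by (simp only: ac_simps)
  qed
  ultimately show ?thesis by simp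
qed

subsection \<open>Decreasing rearrangements\<close>

lemma distribution_fun_finite_measure:
  fixes f :: "'a::euclidean_space \<Rightarrow> real"
  assumes \<Omega>: "\<Omega> \<in> lmeasurable" and f: "f \<in> borel_measurable (lebesgue_on \<Omega>)"
  shows "{x \<in> \<Omega>. t < \<bar>f x\<bar>} \<in> lmeasurable"
proof -
  have "{x \<in> \<Omega>. t < \<bar>f x\<bar>} \<in> sets (lebesgue_on \<Omega>)"
  proof -
    have "{x \<in> space (lebesgue_on \<Omega>). t < \<bar>f x\<bar>} \<in> sets (lebesgue_on \<Omega>)" using f by measurable
    then show ?thesis by simp
  qed
  then have "{x \<in> \<Omega>. t < \<bar>f x\<bar>} \<in> sets lebesgue"
    using \<Omega> by (simp add: sets_restrict_space_iff fmeasurableD)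
  then show ?thesis by (intro fmeasurableI2[OF \<Omega>]) auto
qed

lemma distribution_fun_antimono:
  assumes "\<Omega> \<in> lmeasurable" "f \<in> borel_measurable (lebesgue_on \<Omega>)" "s \<le> t"
  shows "distribution_fun \<Omega> f t \<le> distribution_fun \<Omega> f s"
  unfolding distribution_fun_def
  by (rule measure_mono_fmeasurable)
     (use assms distribution_fun_finite_measure[OF assms(1,2)] in \<open>auto dest: fmeasurableD\<close>)

lemma distribution_fun_tendsto_0:
  assumes \<Omega>: "\<Omega> \<in> lmeasurable" and f: "f \<in> borel_measurable (lebesgue_on \<Omega>)"
  shows "(\<lambda>n. distribution_fun \<Omega> f (real n)) \<longlonglongrightarrow> 0"
proof -
  note m = distribution_fun_finite_measure[OF \<Omega> f]
  have "(\<lambda>n. measure lebesgue {x \<in> \<Omega>. real n < \<bar>f x\<bar>}) \<longlonglongrightarrow> measure lebesgue (\<Inter>n. {x \<in> \<Omega>. real n < \<bar>f x\<bar>})"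
  proof (rule Lim_measure_decseq)
    show "range (\<lambda>n. {x \<in> \<Omega>. real n < \<bar>f x\<bar>}) \<subseteq> sets lebesgue" using m by (auto dest: fmeasurableD)
    show "decseq (\<lambda>n. {x \<in> \<Omega>. real n < \<bar>f x\<bar>})" by (auto simp: decseq_def)
    show "emeasure lebesgue {x \<in> \<Omega>. real i < \<bar>f x\<bar>} \<noteq> \<infinity>" for i
      unfolding infinity_ennreal_def by (rule fmeasurableD2[OF m])
  qed
  also have "(\<Inter>n. {x \<in> \<Omega>. real n < \<bar>f x\<bar>}) = {}"
  proof -
    have "\<exists>n. \<not> real n < \<bar>f x\<bar>" for x
      using reals_Archimedean2[of "\<bar>f x\<bar>"] by (auto simp: not_less intro: less_imp_le)
    then show ?thesis by blast
  qed
  finally show ?thesis by (simp add: distribution_fun_def)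
qed

text \<open>For \<open>\<tau> > 0\<close> this is the rearrangement of \<open>f\<close> at \<open>\<tau>\<close>, written as a length instead of a supremum,
  so that Tonelli's theorem applies to it.\<close>

definition layer :: "'a::euclidean_space set \<Rightarrow> ('a \<Rightarrow> real) \<Rightarrow> real \<Rightarrow> ennreal" where
  "layer \<Omega> f \<tau> = (\<integral>\<^sup>+t. indicator {t. 0 \<le> t \<and> \<tau> < distribution_fun \<Omega> f t} t \<partial>lborel)"

text \<open>The set measured by \<open>layer\<close> lies between 0 and its supremum, so its length
  is at most the rearrangement. The supremum of reals needs a bounded set, which follows since the
  distribution function tends to 0 and \<tau> > 0.\<close>

lemma layer_le_rearrangement:
  assumes \<Omega>: "\<Omega> \<in> lmeasurable" and f: "f \<in> borel_measurable (lebesgue_on \<Omega>)" and \<tau>: "0 < \<tau>"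
  shows "layer \<Omega> f \<tau> \<le> ennreal (decreasing_rearrangement \<Omega> f \<tau>)" "0 \<le> decreasing_rearrangement \<Omega> f \<tau>"
proof -
  let ?S = "{t. 0 \<le> t \<and> \<tau> < distribution_fun \<Omega> f t}"
  obtain n where n: "distribution_fun \<Omega> f (real n) < \<tau>"
    using order_tendstoD(2)[OF distribution_fun_tendsto_0[OF \<Omega> f] \<tau>] by (auto simp: eventually_sequentially)
  have ub: "t \<le> real n" if "t \<in> ?S" for t
    using that n distribution_fun_antimono[OF \<Omega> f, of "real n" t] by (cases "t \<le> real n") auto
  have bdd: "bdd_above (insert 0 ?S)" using ub by (intro bdd_aboveI[of _ "real n"]) auto
  \<comment> \<open>For \<tau> at least the measure of \<Omega> the rearrangement is 0 by
    convention; this agrees with the supremum because no level set is larger than \<Omega>.\<close>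
  have em: "?S = {}" if "measure lebesgue \<Omega> \<le> \<tau>"
  proof -
    have "distribution_fun \<Omega> f t \<le> measure lebesgue \<Omega>" for t unfolding distribution_fun_def
      by (rule measure_mono_fmeasurable)
         (use \<Omega> distribution_fun_finite_measure[OF \<Omega> f] in \<open>auto dest: fmeasurableD\<close>)
    then show ?thesis using that by (auto simp: not_less intro: order_trans)
  qed
  have r: "decreasing_rearrangement \<Omega> f \<tau> = Sup (insert 0 ?S)"
  proof (cases "\<tau> < measure lebesgue \<Omega>")
    case False
    then show ?thesis unfolding em[OF leI[OF False]] by (simp add: decreasing_rearrangement_def)
  qed (use \<tau> in \<open>simp add: decreasing_rearrangement_def\<close>)
  have le: "t \<le> decreasing_rearrangement \<Omega> f \<tau>" if "t \<in> insert 0 ?S" for t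
    unfolding r by (rule cSup_upper[OF that bdd])
  show nn: "0 \<le> decreasing_rearrangement \<Omega> f \<tau>" by (rule le) simp
  have "layer \<Omega> f \<tau> \<le> (\<integral>\<^sup>+t. indicator {0..decreasing_rearrangement \<Omega> f \<tau>} t \<partial>lborel)"
    unfolding layer_def using le by (intro nn_integral_mono) (auto simp: indicator_def)
  also have "\<dots> = ennreal (decreasing_rearrangement \<Omega> f \<tau>)" using nn by simp
  finally show "layer \<Omega> f \<tau> \<le> ennreal (decreasing_rearrangement \<Omega> f \<tau>)" .
qed

lemma distribution_fun_measurable:
  assumes "\<Omega> \<in> lmeasurable" "f \<in> borel_measurable (lebesgue_on \<Omega>)"
  shows "distribution_fun \<Omega> f \<in> borel_measurable borel"
proof -
  have "mono (\<lambda>t. - distribution_fun \<Omega> f t)"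
    using distribution_fun_antimono[OF assms] by (auto simp: mono_def)
  then have "(\<lambda>t. - distribution_fun \<Omega> f t) \<in> borel_measurable borel" by (rule borel_measurable_mono)
  then have "(\<lambda>t. - (- distribution_fun \<Omega> f t)) \<in> borel_measurable borel" by (rule borel_measurable_uminus)
  then show ?thesis by simp
qed

lemma layer_pair_measurable:
  assumes "\<Omega> \<in> lmeasurable" "f \<in> borel_measurable (lebesgue_on \<Omega>)"
  shows "(\<lambda>(\<tau>, t). indicator {t. 0 \<le> t \<and> \<tau> < distribution_fun \<Omega> f t} t :: ennreal)
    \<in> borel_measurable (lborel \<Otimes>\<^sub>M lborel)"
proof -
  note [measurable] = distribution_fun_measurable[OF assms]
  have "{p \<in> space (lborel \<Otimes>\<^sub>M lborel). 0 \<le> snd p \<and> fst p < distribution_fun \<Omega> f (snd p)} \<in> sets (lborel \<Otimes>\<^sub>M lborel)"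
    by measurable
  then have "indicator {p. 0 \<le> snd p \<and> fst p < distribution_fun \<Omega> f (snd p)} \<in> borel_measurable (lborel \<Otimes>\<^sub>M lborel)"
    by (intro borel_measurable_indicator) (simp add: space_pair_measure)
  also have "indicator {p. 0 \<le> snd p \<and> fst p < distribution_fun \<Omega> f (snd p)}
      = (\<lambda>(\<tau>, t). indicator {t. 0 \<le> t \<and> \<tau> < distribution_fun \<Omega> f t} t :: ennreal)"
    by (auto simp: indicator_def fun_eq_iff)
  finally show ?thesis .
qed

lemma layer_measurable:
  assumes "\<Omega> \<in> lmeasurable" "f \<in> borel_measurable (lebesgue_on \<Omega>)"
  shows "layer \<Omega> f \<in> borel_measurable borel"
  using lborel.borel_measurable_nn_integral[OF layer_pair_measurable[OF assms]] by (simp add: layer_def[abs_def])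

text \<open>The layer cake formula turns the left side into the integral over t of the measure of
  the part of \<open>A\<close> where \<open>\<bar>f\<bar> > t\<close>. That measure is at most the
  smaller of \<open>s\<close> and the distribution function at t.\<close>

lemma hardy_littlewood:
  fixes f :: "'a::euclidean_space \<Rightarrow> real"
  assumes \<Omega>: "\<Omega> \<in> lmeasurable" and f: "f \<in> borel_measurable (lebesgue_on \<Omega>)"
    and A [measurable]: "A \<in> sets borel" and s: "emeasure lborel A \<le> ennreal s" "0 \<le> s"
  shows "(\<integral>\<^sup>+x. indicator A x * ennreal \<bar>f x\<bar> \<partial>lebesgue_on \<Omega>) \<le> (\<integral>\<^sup>+\<tau>. indicator {0<..<s} \<tau> * layer \<Omega> f \<tau> \<partial>lborel)"
proof -
  have \<Omega>s: "\<Omega> \<in> sets lebesgue" using \<Omega> by (rule fmeasurableD)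
  let ?\<mu> = "distribution_fun \<Omega> f"
  note [measurable] = distribution_fun_measurable[OF \<Omega> f]
  have "(\<lambda>x. \<bar>indicator \<Omega> x *\<^sub>R f x\<bar>) \<in> borel_measurable lebesgue"
  proof -
    have [measurable]: "(\<lambda>x. indicator \<Omega> x *\<^sub>R f x) \<in> borel_measurable lebesgue"
      using f \<Omega>s by (simp add: borel_measurable_restrict_space_iff)
    show ?thesis by measurable
  qed
  then obtain g where g [measurable]: "g \<in> borel_measurable borel" and g0: "\<And>x. 0 \<le> g x"
    and fg: "AE x in lborel. \<bar>indicator \<Omega> x *\<^sub>R f x\<bar> = g x"
    by (rule lebesgue_nonneg_ex_borel) auto
  have lev: "emeasure lborel {x. t < g x} = ennreal (?\<mu> t)" if "0 \<le> t" for t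
  proof -
    have "emeasure lborel {x. t < g x} = emeasure lebesgue {x. t < g x}" by simp
    also have "\<dots> = emeasure lebesgue {x \<in> \<Omega>. t < \<bar>f x\<bar>}"
    proof (rule emeasure_eq_AE)
      have "AE x in lebesgue. \<bar>indicator \<Omega> x *\<^sub>R f x\<bar> = g x" using fg by (rule AE_completion)
      then show "AE x in lebesgue. x \<in> {x. t < g x} \<longleftrightarrow> x \<in> {x \<in> \<Omega>. t < \<bar>f x\<bar>}"
      proof eventually_elim
        fix x assume e: "\<bar>indicator \<Omega> x *\<^sub>R f x\<bar> = g x"
        show "x \<in> {x. t < g x} \<longleftrightarrow> x \<in> {x \<in> \<Omega>. t < \<bar>f x\<bar>}"
          unfolding mem_Collect_eq e[symmetric] using that by (cases "x \<in> \<Omega>") auto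
      qed
    qed (use distribution_fun_finite_measure[OF \<Omega> f] in \<open>auto dest: fmeasurableD\<close>)
    also have "\<dots> = ennreal (?\<mu> t)" unfolding distribution_fun_def
      by (rule emeasure_eq_measure2) (rule distribution_fun_finite_measure[OF \<Omega> f])
    finally show ?thesis .
  qed
  have \<mu>0: "0 \<le> ?\<mu> t" for t by (simp add: distribution_fun_def)
  define J :: "'a \<times> real \<Rightarrow> ennreal" where "J p = indicator {p. fst p \<in> A \<and> 0 \<le> snd p \<and> snd p < g (fst p)} p" for p
  have J: "J \<in> borel_measurable (lborel \<Otimes>\<^sub>M lborel)"
  proof -
    have "{p \<in> space (lborel \<Otimes>\<^sub>M lborel). fst p \<in> A \<and> 0 \<le> snd p \<and> snd p < g (fst p)} \<in> sets (lborel \<Otimes>\<^sub>M lborel)"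
      by measurable
    then show ?thesis unfolding J_def[abs_def]
      by (intro borel_measurable_indicator) (simp add: space_pair_measure)
  qed
  have "(\<integral>\<^sup>+x. indicator A x * ennreal \<bar>f x\<bar> \<partial>lebesgue_on \<Omega>) = (\<integral>\<^sup>+x. indicator \<Omega> x * (indicator A x * ennreal \<bar>f x\<bar>) \<partial>lborel)"
    by (rule nn_integral_lebesgue_on[OF \<Omega>s])
  also have "\<dots> = (\<integral>\<^sup>+x. indicator A x * ennreal (g x) \<partial>lborel)"
  proof (rule nn_integral_cong_AE)
    show "AE x in lborel. indicator \<Omega> x * (indicator A x * ennreal \<bar>f x\<bar>) = indicator A x * ennreal (g x)"
      using fg
    proof eventually_elim
      fix x assume e: "\<bar>indicator \<Omega> x *\<^sub>R f x\<bar> = g x"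
      show "indicator \<Omega> x * (indicator A x * ennreal \<bar>f x\<bar>) = indicator A x * ennreal (g x)"
        unfolding e[symmetric] by (cases "x \<in> \<Omega>") auto
    qed
  qed
  also have "\<dots> = (\<integral>\<^sup>+x. \<integral>\<^sup>+t. J (x, t) \<partial>lborel \<partial>lborel)"
  proof (rule nn_integral_cong)
    fix x
    have "(\<integral>\<^sup>+t. J (x, t) \<partial>lborel) = (\<integral>\<^sup>+t. indicator A x * indicator {0..<g x} t \<partial>lborel)"
      by (rule nn_integral_cong) (auto simp: J_def indicator_def)
    also have "\<dots> = indicator A x * ennreal (g x)"
      using g0[of x] by (subst nn_integral_cmult) auto
    finally show "indicator A x * ennreal (g x) = (\<integral>\<^sup>+t. J (x, t) \<partial>lborel)" ..
  qed
  also have "\<dots> = (\<integral>\<^sup>+t. \<integral>\<^sup>+x. J (x, t) \<partial>lborel \<partial>lborel)"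
    by (rule lborel_pair.Fubini[OF J, symmetric])
  also have "\<dots> \<le> (\<integral>\<^sup>+t. \<integral>\<^sup>+\<tau>. indicator {0<..<s} \<tau> * indicator {t. 0 \<le> t \<and> \<tau> < ?\<mu> t} t \<partial>lborel \<partial>lborel)"
  proof (rule nn_integral_mono)
    fix t
    show "(\<integral>\<^sup>+x. J (x, t) \<partial>lborel) \<le> (\<integral>\<^sup>+\<tau>. indicator {0<..<s} \<tau> * indicator {t. 0 \<le> t \<and> \<tau> < ?\<mu> t} t \<partial>lborel)"
    proof (cases "0 \<le> t")
      case True
      have "(\<integral>\<^sup>+x. J (x, t) \<partial>lborel) = (\<integral>\<^sup>+x. indicator (A \<inter> {x. t < g x}) x \<partial>lborel)"
        using True by (intro nn_integral_cong) (auto simp: J_def indicator_def)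
      also have "\<dots> = emeasure lborel (A \<inter> {x. t < g x})" by simp
      also have "\<dots> \<le> ennreal (min s (?\<mu> t))"
      proof -
        have "emeasure lborel (A \<inter> {x. t < g x}) \<le> emeasure lborel A" by (rule emeasure_mono) auto
        moreover have "emeasure lborel (A \<inter> {x. t < g x}) \<le> emeasure lborel {x. t < g x}" by (rule emeasure_mono) auto
        ultimately show ?thesis using s(1) lev[OF True] by (auto simp: min_def)
      qed
      \<comment> \<open>The minimum is rewritten as the length of an interval in \<tau>; exchanging
        \<tau> and t then assembles \<open>layer\<close>.\<close>
      also have "\<dots> = (\<integral>\<^sup>+\<tau>. indicator {0<..<min s (?\<mu> t)} \<tau> \<partial>lborel)"
        using s(2) \<mu>0[of t] by simp
      also have "\<dots> = (\<integral>\<^sup>+\<tau>. indicator {0<..<s} \<tau> * indicator {t. 0 \<le> t \<and> \<tau> < ?\<mu> t} t \<partial>lborel)"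
        using True by (intro nn_integral_cong) (auto simp: indicator_def)
      finally show ?thesis .
    qed (simp add: J_def)
  qed
  also have "\<dots> = (\<integral>\<^sup>+\<tau>. \<integral>\<^sup>+t. indicator {0<..<s} \<tau> * indicator {t. 0 \<le> t \<and> \<tau> < ?\<mu> t} t \<partial>lborel \<partial>lborel)"
  proof (rule lborel_pair.Fubini')
    show "(\<lambda>(\<tau>, t). indicator {0<..<s} \<tau> * indicator {t. 0 \<le> t \<and> \<tau> < ?\<mu> t} t :: ennreal)
        \<in> borel_measurable (lborel \<Otimes>\<^sub>M lborel)"
      using layer_pair_measurable[OF \<Omega> f] unfolding split_beta' by measurable
  qed
  also have "\<dots> = (\<integral>\<^sup>+\<tau>. indicator {0<..<s} \<tau> * layer \<Omega> f \<tau> \<partial>lborel)"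
    unfolding layer_def by (intro nn_integral_cong nn_integral_cmult) measurable
  finally show ?thesis .
qed

subsection \<open>Dyadic iteration\<close>

lemma dyadic_powr_Suc:
  fixes L p :: real
  shows "0 < L \<Longrightarrow> (L / 2 ^ Suc j) powr p = (L / 2 ^ j) powr p * (1 / 2) powr p"
  by (subst powr_mult[symmetric]) (auto simp: mult.commute)

text \<open>As p < 0, the terms grow geometrically with \<open>j\<close>, by the factor 2 powr (-
  p). The sum is therefore controlled by its last term with scale above \<tau>, and that one is
  below \<tau> powr p.\<close>

lemma dyadic_sum_le:
  fixes L p \<tau> :: real
  assumes L: "0 < L" and p: "p < 0" and \<tau>: "0 < \<tau>"
  shows "(\<Sum>j<n. if \<tau> < L / 2 ^ j then (L / 2 ^ j) powr p else 0) \<le> \<tau> powr p / (1 - 2 powr p)"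
proof -
  define q where "q = (2::real) powr p"
  have q: "0 < q" "q < 1" using p by (auto simp: q_def powr_less_one)
  have hq: "(1 / 2) powr p = 1 / q" by (simp add: q_def powr_divide)
  have full: "(\<Sum>j<Suc m. (L / 2 ^ j) powr p) \<le> (L / 2 ^ m) powr p / (1 - q)" for m
  proof (induction m)
    case 0
    have "1 * L powr p \<le> (1 / (1 - q)) * L powr p" using q by (intro mult_right_mono) auto
    then show ?case by simp
  next
    case (Suc m)
    have e: "(L / 2 ^ m) powr p = q * (L / 2 ^ Suc m) powr p"
      unfolding dyadic_powr_Suc[OF L] hq using q by simp
    have "(\<Sum>j<Suc (Suc m). (L / 2 ^ j) powr p) \<le> (L / 2 ^ m) powr p / (1 - q) + (L / 2 ^ Suc m) powr p"
      using Suc by simp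
    also have "\<dots> = (L / 2 ^ Suc m) powr p / (1 - q)"
      unfolding e using q by (simp add: field_simps)
    finally show ?case .
  qed
  show ?thesis
  proof (induction n)
    case (Suc n)
    show ?case
    proof (cases "\<tau> < L / 2 ^ n")
      case True
      have "\<tau> < L / 2 ^ j" if "j < Suc n" for j
      proof -
        have "L / 2 ^ n \<le> L / 2 ^ j" using that L by (intro divide_left_mono power_increasing) auto
        with True show ?thesis by simp
      qed
      then have "(\<Sum>j<Suc n. if \<tau> < L / 2 ^ j then (L / 2 ^ j) powr p else 0) = (\<Sum>j<Suc n. (L / 2 ^ j) powr p)"
        by (intro sum.cong) auto
      also have "\<dots> \<le> (L / 2 ^ n) powr p / (1 - q)" by (rule full)
      also have "\<dots> \<le> \<tau> powr p / (1 - q)"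
        using True \<tau> p q by (intro divide_right_mono powr_mono2') auto
      finally show ?thesis by (simp add: q_def)
    qed (use Suc in simp)
  qed (use q in \<open>simp add: q_def\<close>)
qed

text \<open>Exchanging sum and integral, each \<tau> collects the coefficients of precisely those
  scales that exceed it, and \<open>dyadic_sum_le\<close> bounds their sum. A dyadic sum of
  integrals over shrinking intervals becomes one weighted integral.\<close>

lemma dyadic_series_le:
  fixes F :: "real \<Rightarrow> ennreal"
  assumes F [measurable]: "F \<in> borel_measurable borel" and L: "0 < L" and p: "p < 0"
  shows "(\<Sum>j. ennreal ((L / 2 ^ j) powr p) * (\<integral>\<^sup>+\<tau>. indicator {0<..<L / 2 ^ j} \<tau> * F \<tau> \<partial>lborel))
    \<le> ennreal (1 / (1 - 2 powr p)) * (\<integral>\<^sup>+\<tau>. indicator {0<..} \<tau> * (ennreal (\<tau> powr p) * F \<tau>) \<partial>lborel)"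
proof -
  have q: "(2::real) powr p < 1" using p by (simp add: powr_less_one)
  have "(\<Sum>j. ennreal ((L / 2 ^ j) powr p) * (\<integral>\<^sup>+\<tau>. indicator {0<..<L / 2 ^ j} \<tau> * F \<tau> \<partial>lborel))
      = (\<Sum>j. \<integral>\<^sup>+\<tau>. ennreal ((L / 2 ^ j) powr p) * (indicator {0<..<L / 2 ^ j} \<tau> * F \<tau>) \<partial>lborel)"
    by (intro suminf_cong nn_integral_cmult[symmetric]) measurable
  also have "\<dots> = (\<integral>\<^sup>+\<tau>. (\<Sum>j. ennreal ((L / 2 ^ j) powr p) * (indicator {0<..<L / 2 ^ j} \<tau> * F \<tau>)) \<partial>lborel)"
    by (rule nn_integral_suminf[symmetric]) measurable
  also have "\<dots> \<le> (\<integral>\<^sup>+\<tau>. ennreal (1 / (1 - 2 powr p)) * (indicator {0<..} \<tau> * (ennreal (\<tau> powr p) * F \<tau>)) \<partial>lborel)"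
  proof (rule nn_integral_mono)
    fix \<tau> :: real
    show "(\<Sum>j. ennreal ((L / 2 ^ j) powr p) * (indicator {0<..<L / 2 ^ j} \<tau> * F \<tau>))
        \<le> ennreal (1 / (1 - 2 powr p)) * (indicator {0<..} \<tau> * (ennreal (\<tau> powr p) * F \<tau>))"
    proof (cases "0 < \<tau>")
      case True
      have "(\<Sum>j. ennreal ((L / 2 ^ j) powr p) * (indicator {0<..<L / 2 ^ j} \<tau> * F \<tau>))
          = (\<Sum>j. ennreal (if \<tau> < L / 2 ^ j then (L / 2 ^ j) powr p else 0) * F \<tau>)"
        using True by (intro suminf_cong) (auto simp: indicator_def)
      also have "\<dots> = (\<Sum>j. ennreal (if \<tau> < L / 2 ^ j then (L / 2 ^ j) powr p else 0)) * F \<tau>" by simp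
      also have "\<dots> \<le> ennreal (\<tau> powr p / (1 - 2 powr p)) * F \<tau>"
      proof (rule mult_right_mono)
        show "(\<Sum>j. ennreal (if \<tau> < L / 2 ^ j then (L / 2 ^ j) powr p else 0)) \<le> ennreal (\<tau> powr p / (1 - 2 powr p))"
          unfolding suminf_eq_SUP
        proof (rule SUP_least)
          fix n
          have "(\<Sum>j<n. ennreal (if \<tau> < L / 2 ^ j then (L / 2 ^ j) powr p else 0))
              = ennreal (\<Sum>j<n. if \<tau> < L / 2 ^ j then (L / 2 ^ j) powr p else 0)"
            by (rule sum_ennreal) auto
          also have "\<dots> \<le> ennreal (\<tau> powr p / (1 - 2 powr p))"
            by (intro ennreal_leI dyadic_sum_le L p True)
          finally show "(\<Sum>j<n. ennreal (if \<tau> < L / 2 ^ j then (L / 2 ^ j) powr p else 0)) \<le> ennreal (\<tau> powr p / (1 - 2 powr p))" .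
        qed
      qed simp
      also have "ennreal (\<tau> powr p / (1 - 2 powr p)) = ennreal (1 / (1 - 2 powr p)) * ennreal (\<tau> powr p)"
        using q by (simp flip: ennreal_mult)
      finally show ?thesis using True by (simp add: mult.assoc)
    qed simp
  qed
  also have "\<dots> = ennreal (1 / (1 - 2 powr p)) * (\<integral>\<^sup>+\<tau>. indicator {0<..} \<tau> * (ennreal (\<tau> powr p) * F \<tau>) \<partial>lborel)"
    by (rule nn_integral_cmult) measurable
  finally show ?thesis .
qed

text \<open>The levels are \<open>k j = (\<Sum>i<j. c i + 1 / 2 ^ i)\<close>; the geometric term makes the increments
  strictly larger than \<open>c j\<close>.\<close>

lemma dyadic_iteration:
  fixes m :: "real \<Rightarrow> ennreal"
  assumes anti: "\<And>s t. s \<le> t \<Longrightarrow> m t \<le> m s" and L: "0 < L" and m0: "m 0 \<le> ennreal L"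
    and c: "\<And>j. 0 \<le> c j" "summable c"
    and step: "\<And>j k h. 0 \<le> k \<Longrightarrow> 0 < h \<Longrightarrow> m k \<le> ennreal (L / 2 ^ j) \<Longrightarrow>
      ennreal (L / 2 ^ Suc j) < m (k + h) \<Longrightarrow> h \<le> c j"
  shows "\<exists>K. m K = 0"
proof -
  define a where "a j = c j + (1 / 2) ^ j" for j :: nat
  have a: "0 < a j" "c j < a j" for j using c(1)[of j] by (auto simp: a_def add_nonneg_pos)
  have sa: "summable a" unfolding a_def by (intro summable_add c(2) summable_geometric) simp
  have mk: "m (\<Sum>i<j. a i) \<le> ennreal (L / 2 ^ j)" for j
  proof (induction j)
    case (Suc j)
    show ?case
    proof (rule ccontr)
      assume "\<not> ?case"
      then have "ennreal (L / 2 ^ Suc j) < m ((\<Sum>i<j. a i) + a j)" by (simp add: not_le)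
      \<comment> \<open>If the measure had not halved after the increment \<open>a j\<close>, then
        \<open>step\<close> would give \<open>a j \<le> c j\<close>, contradicting the extra
        geometric term.\<close>
      from step[OF _ a(1) Suc this] a show False
        by (metis less_imp_le not_less sum_nonneg)
    qed
  qed (use m0 in simp)
  \<comment> \<open>The sum of all increments is a finite level above every \<open>k j\<close>, so
    by monotonicity all the dyadic bounds hold there at once.\<close>
  have "m (suminf a) \<le> ennreal (L / 2 ^ j)" for j
    using anti[OF sum_le_suminf[OF sa, of "{..<j}"]] mk[of j] a(1) by (force intro: order_trans less_imp_le)
  moreover have "(\<lambda>j. ennreal (L / 2 ^ j)) \<longlonglongrightarrow> ennreal 0"
  proof (rule tendsto_ennrealI)
    have "(\<lambda>j. L * (1 / 2) ^ j) \<longlonglongrightarrow> L * 0" by (intro tendsto_mult tendsto_const LIMSEQ_realpow_zero) auto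
    then show "(\<lambda>j. L / 2 ^ j) \<longlonglongrightarrow> 0" by (simp add: power_divide)
  qed
  ultimately have "m (suminf a) \<le> ennreal 0" by (intro LIMSEQ_le_const) auto
  then show ?thesis by auto
qed

lemma finite_series_coefficients:
  fixes G :: "nat \<Rightarrow> ennreal"
  assumes "(\<Sum>j. G j) < \<infinity>"
  shows "summable (\<lambda>j. enn2real (G j))" "G j = ennreal (enn2real (G j))"
proof -
  have G: "G j \<noteq> \<infinity>" for j
  proof -
    have "sum G {j} \<le> (\<Sum>j. G j)" by (rule sum_le_suminf) auto
    then show ?thesis using assms by (auto simp: top_unique)
  qed
  then show e: "G j = ennreal (enn2real (G j))" for j by (simp add: less_top)
  have "(\<Sum>j. ennreal (enn2real (G j))) = (\<Sum>j. G j)" using e by (intro suminf_cong) metis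
  then show "summable (\<lambda>j. enn2real (G j))"
    using assms by (intro summable_suminf_not_top) auto
qed

text \<open>The scale \<open>s\<close> enters the increments through s powr (\<beta> - 1) with
  \<beta> = \<alpha>/N. Since \<alpha> < 2, the case \<beta> > 1 occurs only in dimension one. The
  hypothesis \<alpha> \<noteq> N rules out \<beta> = 1, where this factor is constant.\<close>

theorem theorem4p1:
  fixes \<Omega> :: "(real ^ 'n) set" and \<alpha> :: real and f u :: "real ^ 'n \<Rightarrow> real"
  assumes "open \<Omega>" and "bounded \<Omega>"
    and "0 < \<alpha>" and "\<alpha> < 2" and "\<alpha> \<noteq> real CARD('n)"
    and "f \<in> Lorentz (real CARD('n) / \<alpha>) 1 \<Omega>"
    and "weak_solution \<alpha> \<Omega> f u"
  shows "u \<in> L_infinity \<Omega>"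
proof -
  note \<Omega> = assms(1) and \<alpha> = assms(3)
  define \<beta> where "\<beta> = \<alpha> / real CARD('n)"
  have \<beta>: "0 < \<beta>" "\<beta> \<noteq> 1" using \<alpha> assms(5) by (auto simp: \<beta>_def)
  have \<Omega>m: "\<Omega> \<in> lmeasurable" by (intro lmeasurable_open assms)
  then have \<Omega>s: "\<Omega> \<in> sets lebesgue" by (rule fmeasurableD)
  have \<Omega>b [measurable]: "\<Omega> \<in> sets borel" using \<Omega> by simp
  have f: "f \<in> borel_measurable (lebesgue_on \<Omega>)" using assms(6) by (simp add: Lorentz_def)
  obtain w where sol: "weak_extension_solution \<alpha> \<Omega> f w" and tr: "has_trace \<Omega> w u"
    using assms(7) by (auto simp: weak_solution_def)
  have wX: "w \<in> X0 \<alpha> \<Omega>" using sol by (simp add: weak_extension_solution_def)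
  have um: "u \<in> borel_measurable (lebesgue_on \<Omega>)" using tr by (simp add: has_trace_def Lp2_iff)
  \<comment> \<open>A Borel representative that vanishes outside \<Omega> is required by the
    translation and rearrangement estimates; it agrees with \<open>u\<close> almost everywhere in
    \<Omega>.\<close>
  obtain u1 where u1 [measurable]: "u1 \<in> borel_measurable borel" and u1u: "AE x in lborel. indicator \<Omega> x *\<^sub>R u x = u1 x"
    using completion_ex_borel_measurable_real[of "\<lambda>x. indicator \<Omega> x *\<^sub>R u x" lborel] um \<Omega>s
    by (auto simp: borel_measurable_restrict_space_iff)
  define u' where "u' x = indicator \<Omega> x * u1 x" for x
  have u' [measurable]: "u' \<in> borel_measurable borel" unfolding u'_def by measurable
  have u0: "u' x = 0" if "x \<notin> \<Omega>" for x using that by (simp add: u'_def)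
  have uu: "AE x in lebesgue_on \<Omega>. u' x = u x"
    unfolding AE_lebesgue_on_iff[OF \<Omega>s] using u1u by eventually_elim (auto simp: u'_def)
  define m where "m k = emeasure lborel {x. k < \<bar>u' x\<bar>}" for k
  \<comment> \<open>The summand 1 keeps the initial scale positive even when \<Omega> is
    empty.\<close>
  define L where "L = measure lebesgue \<Omega> + 1"
  have L: "0 < L" by (simp add: L_def add_nonneg_pos)
  have anti: "m t \<le> m s" if "s \<le> t" for s t
    unfolding m_def using that by (intro emeasure_mono) auto
  have m0: "m 0 \<le> ennreal L"
  proof -
    have "x \<in> \<Omega>" if "0 < \<bar>u' x\<bar>" for x using u0[of x] that by (cases "x \<in> \<Omega>") auto
    then have "m 0 \<le> emeasure lborel \<Omega>" unfolding m_def using \<Omega>b by (intro emeasure_mono) auto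
    also have "\<dots> = emeasure lebesgue \<Omega>" by simp
    also have "\<dots> = ennreal (measure lebesgue \<Omega>)" by (rule emeasure_eq_measure2[OF \<Omega>m])
    also have "\<dots> \<le> ennreal L" by (simp add: L_def ennreal_leI)
    finally show ?thesis .
  qed
  define C where "C = 128 * exp 2 / \<alpha> * (2 / unit_ball_vol CARD('n)) powr \<beta>"
  have C: "0 \<le> C" using \<alpha> by (simp add: C_def)
  have level: "m (k + h) * ennreal (h\<^sup>2) \<le> ennreal (C * s powr \<beta>) * energy \<alpha> \<Omega> (\<lambda>z. trunc k h (w z))"
    if "0 \<le> k" "0 < h" "0 < s" "m k \<le> ennreal s" for k h s
    using superlevel_estimate[OF \<Omega> \<alpha> wX tr u' uu u0 that(2,1,3)] that(4) by (simp add: m_def C_def \<beta>_def)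
  have half: "s / 2 * h\<^sup>2 \<le> B" if "ennreal (s / 2) < M" "M * ennreal (h\<^sup>2) \<le> ennreal B" "0 < s" "0 \<le> B"
    for s h B :: real and M :: ennreal
  proof -
    have "ennreal (s / 2 * h\<^sup>2) = ennreal (s / 2) * ennreal (h\<^sup>2)" using that by (intro ennreal_mult) auto
    also have "\<dots> \<le> M * ennreal (h\<^sup>2)" using that by (intro mult_right_mono) auto
    also note that(2)
    finally show ?thesis using that(4) by simp
  qed
  have dy: "0 < L / 2 ^ j" "L / 2 ^ Suc j = L / 2 ^ j / 2" for j using L by auto
  have "\<exists>K. m K = 0"
  proof (cases "\<beta> < 1")
    case True
    define G where "G j = ennreal ((L / 2 ^ j) powr (\<beta> - 1)) * (\<integral>\<^sup>+\<tau>. indicator {0<..<L / 2 ^ j} \<tau> * layer \<Omega> f \<tau> \<partial>lborel)" for j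
    have "(\<Sum>j. G j) \<le> ennreal (1 / (1 - 2 powr (\<beta> - 1))) * (\<integral>\<^sup>+\<tau>. indicator {0<..} \<tau> * (ennreal (\<tau> powr (\<beta> - 1)) * layer \<Omega> f \<tau>) \<partial>lborel)"
      unfolding G_def by (rule dyadic_series_le[OF layer_measurable[OF \<Omega>m f] L]) (use True in simp)
    also have "\<dots> \<le> ennreal (1 / (1 - 2 powr (\<beta> - 1)))
        * (\<integral>\<^sup>+t\<in>{0<..}. ennreal ((t powr (1 / (real CARD('n) / \<alpha>)) * decreasing_rearrangement \<Omega> f t) powr 1 / t) \<partial>lborel)"
    proof (intro mult_left_mono nn_integral_mono)
      fix \<tau> :: real
      show "indicator {0<..} \<tau> * (ennreal (\<tau> powr (\<beta> - 1)) * layer \<Omega> f \<tau>)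
        \<le> ennreal ((\<tau> powr (1 / (real CARD('n) / \<alpha>)) * decreasing_rearrangement \<Omega> f \<tau>) powr 1 / \<tau>) * indicator {0<..} \<tau>"
      proof (cases "0 < \<tau>")
        case t: True
        note d = layer_le_rearrangement[OF \<Omega>m f t]
        have "ennreal (\<tau> powr (\<beta> - 1)) * layer \<Omega> f \<tau> \<le> ennreal (\<tau> powr (\<beta> - 1)) * ennreal (decreasing_rearrangement \<Omega> f \<tau>)"
          by (intro mult_left_mono d) simp
        \<comment> \<open>Here q = 1 and the inverse of N/\<alpha> is \<beta>, so the factor
          \<tau>^\<beta> divided by \<tau> in the Lorentz norm is the weight
          \<tau>^(\<beta>-1).\<close>
        also have "\<dots> = ennreal ((\<tau> powr (1 / (real CARD('n) / \<alpha>)) * decreasing_rearrangement \<Omega> f \<tau>) powr 1 / \<tau>)"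
          using t d(2) by (simp add: \<beta>_def powr_diff flip: ennreal_mult)
        finally show ?thesis using t by simp
      qed simp
    qed simp
    also have "\<dots> < \<infinity>" using assms(6) by (simp add: Lorentz_def ennreal_mult_less_top)
    finally have G: "(\<Sum>j. G j) < \<infinity>" .
    \<comment> \<open>The factor 8 is 4 from the energy bound times 2 from the loss of one half in
      \<open>half\<close>; a common factor s h has been cancelled.\<close>
    define c where "c j = 8 * C * \<bar>kappa \<alpha>\<bar> * enn2real (G j)" for j
    show ?thesis
    proof (rule dyadic_iteration[where m=m and c=c, OF anti L m0])
      show "0 \<le> c j" for j using C by (simp add: c_def)
      show "summable c" unfolding c_def by (intro summable_mult finite_series_coefficients G)
      fix j k h assume k: "0 \<le> k" and h: "0 < (h::real)" and mk: "m k \<le> ennreal (L / 2 ^ j)"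
        and mkh: "ennreal (L / 2 ^ Suc j) < m (k + h)"
      define s where "s = L / 2 ^ j"
      have s: "0 < s" "m k \<le> ennreal s" "ennreal (s / 2) < m (k + h)"
        using dy(1)[of j] mk mkh[unfolded dy(2)] by (simp_all only: s_def)
      have "energy \<alpha> \<Omega> (\<lambda>z. trunc k h (w z))
          \<le> ennreal (4 * \<bar>kappa \<alpha>\<bar> * h) * (\<integral>\<^sup>+x. indicator {x. k < \<bar>u x\<bar>} x * ennreal \<bar>f x\<bar> \<partial>lebesgue_on \<Omega>)"
        by (rule energy_trunc(1)[OF \<Omega> sol tr f h k])
      also have "(\<integral>\<^sup>+x. indicator {x. k < \<bar>u x\<bar>} x * ennreal \<bar>f x\<bar> \<partial>lebesgue_on \<Omega>)
          = (\<integral>\<^sup>+x. indicator {x. k < \<bar>u' x\<bar>} x * ennreal \<bar>f x\<bar> \<partial>lebesgue_on \<Omega>)"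
        by (rule nn_integral_cong_AE) (use uu in \<open>auto elim!: eventually_mono simp: indicator_def\<close>)
      also have "\<dots> \<le> (\<integral>\<^sup>+\<tau>. indicator {0<..<s} \<tau> * layer \<Omega> f \<tau> \<partial>lborel)"
        by (rule hardy_littlewood[OF \<Omega>m f]) (use s in \<open>auto simp: m_def\<close>)
      finally have E: "energy \<alpha> \<Omega> (\<lambda>z. trunc k h (w z))
          \<le> ennreal (4 * \<bar>kappa \<alpha>\<bar> * h) * (\<integral>\<^sup>+\<tau>. indicator {0<..<s} \<tau> * layer \<Omega> f \<tau> \<partial>lborel)"
        by (simp add: mult_left_mono)
      have "m (k + h) * ennreal (h\<^sup>2) \<le> ennreal (C * s powr \<beta>) * energy \<alpha> \<Omega> (\<lambda>z. trunc k h (w z))"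
        by (rule level[OF k h s(1,2)])
      also have "\<dots> \<le> ennreal (C * s powr \<beta>) * (ennreal (4 * \<bar>kappa \<alpha>\<bar> * h) * (\<integral>\<^sup>+\<tau>. indicator {0<..<s} \<tau> * layer \<Omega> f \<tau> \<partial>lborel))"
        by (intro mult_left_mono E) simp
      also have "ennreal (C * s powr \<beta>) = ennreal (C * s) * ennreal (s powr (\<beta> - 1))"
        using s(1) C by (simp add: powr_diff flip: ennreal_mult)
      also have "ennreal (C * s) * ennreal (s powr (\<beta> - 1)) * (ennreal (4 * \<bar>kappa \<alpha>\<bar> * h) * (\<integral>\<^sup>+\<tau>. indicator {0<..<s} \<tau> * layer \<Omega> f \<tau> \<partial>lborel))
          = ennreal (C * s) * ennreal (4 * \<bar>kappa \<alpha>\<bar> * h) * G j"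
        by (simp add: G_def s_def ac_simps)
      also have "\<dots> = ennreal (C * s) * ennreal (4 * \<bar>kappa \<alpha>\<bar> * h) * ennreal (enn2real (G j))"
        by (simp only: finite_series_coefficients(2)[OF G, symmetric])
      also have "\<dots> = ennreal (C * s * (4 * \<bar>kappa \<alpha>\<bar> * h) * enn2real (G j))"
        using C s(1) h by (simp add: ennreal_mult)
      finally have "s / 2 * h\<^sup>2 \<le> C * s * (4 * \<bar>kappa \<alpha>\<bar> * h) * enn2real (G j)"
        by (rule half[OF s(3) _ s(1)]) (use C s(1) h in simp)
      then have "(s * h) * h \<le> (s * h) * c j" by (simp add: c_def power2_eq_square algebra_simps)
      then show "h \<le> c j" using s(1) h by simp
    qed
  next
    case False
    then have b1: "1 < \<beta>" using \<beta> by simp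
    obtain E where E: "energy \<alpha> \<Omega> w = ennreal E" "0 \<le> E"
      using X0_energy_finite[OF wX] by (cases "energy \<alpha> \<Omega> w") auto
    \<comment> \<open>Here the energy bound carries no factor \<open>h\<close> to cancel, hence the
      square root. The factor 32 is 2 from \<open>half\<close> times 16 from the energy
      bound.\<close>
    define c where "c j = sqrt (32 * C * E * (L / 2 ^ j) powr (\<beta> - 1))" for j
    show ?thesis
    proof (rule dyadic_iteration[where m=m and c=c, OF anti L m0])
      show c0: "0 \<le> c j" for j using C E by (simp add: c_def)
      \<comment> \<open>Halving the scale multiplies the increment bound by a fixed ratio, which is
        below 1 precisely because \<beta> > 1.\<close>
      have cS: "c j = c 0 * (sqrt ((1 / 2) powr (\<beta> - 1))) ^ j" for j
      proof (induction j)
        case (Suc j)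
        have "c (Suc j) = sqrt (32 * C * E * ((L / 2 ^ j) powr (\<beta> - 1) * (1 / 2) powr (\<beta> - 1)))"
          unfolding c_def dyadic_powr_Suc[OF L] ..
        also have "\<dots> = c j * sqrt ((1 / 2) powr (\<beta> - 1))"
          unfolding c_def by (simp add: real_sqrt_mult mult.assoc)
        finally show ?case using Suc by simp
      qed simp
      have "(1 / 2) powr (\<beta> - 1) < (1::real) powr (\<beta> - 1)" using b1 by (intro powr_less_mono2) auto
      then have "norm (sqrt ((1 / 2) powr (\<beta> - 1))) < 1" by simp
      from summable_mult[OF summable_geometric[OF this], of "c 0"]
      show "summable c" by (subst (asm) cS[symmetric]) 
      fix j k h assume k: "0 \<le> k" and h: "0 < (h::real)" and mk: "m k \<le> ennreal (L / 2 ^ j)"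
        and mkh: "ennreal (L / 2 ^ Suc j) < m (k + h)"
      define s where "s = L / 2 ^ j"
      have s: "0 < s" "m k \<le> ennreal s" "ennreal (s / 2) < m (k + h)"
        using dy(1)[of j] mk mkh[unfolded dy(2)] by (simp_all only: s_def)
      have "m (k + h) * ennreal (h\<^sup>2) \<le> ennreal (C * s powr \<beta>) * energy \<alpha> \<Omega> (\<lambda>z. trunc k h (w z))"
        by (rule level[OF k h s(1,2)])
      also have "\<dots> \<le> ennreal (C * s powr \<beta>) * (16 * ennreal E)"
        using energy_trunc(2)[OF \<Omega> sol tr f h k] by (intro mult_left_mono) (simp_all add: E)
      also have "\<dots> = ennreal (C * s powr \<beta> * (16 * E))"
        using C E by (simp add: ennreal_mult)
      finally have "s / 2 * h\<^sup>2 \<le> C * s powr \<beta> * (16 * E)"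
        by (rule half[OF s(3) _ s(1)]) (use C E in simp)
      also have "s powr \<beta> = s * s powr (\<beta> - 1)" using s(1) by (simp add: powr_diff)
      finally have "s * h\<^sup>2 \<le> s * (32 * C * E * s powr (\<beta> - 1))" by (simp add: algebra_simps)
      then have "h\<^sup>2 \<le> 32 * C * E * s powr (\<beta> - 1)" using s(1) by simp
      then show "h \<le> c j" unfolding c_def s_def by (rule real_le_rsqrt)
    qed
  qed
  then obtain K where K: "m K = 0" ..
  have "AE x in lborel. x \<notin> {x. K < \<bar>u' x\<bar>}"
    using K by (intro AE_not_in) (simp add: m_def null_sets_def)
  then have "AE x in lebesgue_on \<Omega>. \<bar>u' x\<bar> \<le> K"
    unfolding AE_lebesgue_on_iff[OF \<Omega>s] by eventually_elim auto
  with uu have "AE x in lebesgue_on \<Omega>. \<bar>u x\<bar> \<le> K" by eventually_elim simp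
  with um show ?thesis unfolding L_infinity_def by blast
qed

end
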